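(* Let $W=W(D)$ be an axisymmetric liquid domain for which $F$ is a disk and $B$ is a $C^2$ surface, and consider the sloshing problem on $W$. After multiplication by $\pm1$ assume that $\psi_{1,1}>0$ on $D$. If the angle between $F(D)$ and $B(D)$ at the point where $F(D)$ and $B(D)$ meet is bigger than $\pi/2$ and smaller than $\pi$, then $\psi_{1,1}$ attains its maximum in the interior of $F(D)$, and $\frac{\partial\psi_{1,1}}{\partial r}$ changes sign in $D$.
   Context: Cartesian coordinates on $\mathbb R^3$ are $(x,y,z)$. A liquid domain is a bounded Lipschitz domain $W\subset\{(x,y,z):y<0\}$ whose boundary is split as $\partial W=F\cup B$, where $F\subset\{(x,0,z):x,z\in\mathbb R\}$ (the free surface) is a bounded, simply connected Lipschitz two-dimensional domain and $B=\partial W\setminus F$. Sloshing problem on $W$: find $\nu$ and nonzero $\varphi\in H^1(W)$, continuous on $\overline W$, with $\Delta\varphi=0$ in $W$, $\partial\varphi/\partial y=\nu\varphi$ on $F$, $\partial\varphi/\partial n=0$ at all points of $B$ where the normal derivative is defined, and $\int_F\varphi=0$. Cylindrical coordinates: $x=r\cos\theta$, $z=r\sin\theta$. An axisymmetric (about the $y$-axis) $W$ is regarded as obtained by rotating about the $y$-axis its cross-section $D$ in the $ry$-half-plane ($r>0$, $\theta=0$), written $W=W(D)$; $F(D)$ and $B(D)$ are the cross-sections of $F$ and $B$. If $F$ has radius $R$, then $F(D)=\{(r,0):0\le r<R\}$, its interior is $\{(r,0):0<r<R\}$, and $F(D)$ and $B(D)$ meet at $(R,0)$; the angle is the interior angle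 of $D$ there. Functions $\psi(r,y)\cos\theta$ with $\psi$ bounded near the axis are eigenfunctions with eigenvalue $\nu$ iff $$\psi_{rr}+\tfrac1r\psi_r+\psi_{yy}-\tfrac1{r^2}\psi=0\ \text{in }D,\qquad \psi_y=\nu\psi\ \text{on }F(D),\qquad \partial\psi/\partial n=0\ \text{on }B(D).$$ This problem has eigenvalues $0<\nu_{1,1}\le\nu_{1,2}\le\dots\to\infty$; $\nu_{1,1}$ is the smallest one and $\psi_{1,1}$ is a corresponding eigenfunction (unique up to a nonzero scalar, of constant sign on $D$, continuous on $\overline D$). *)

theory Defs
  imports "HOL-Analysis.Analysis"
begin

section \<open>Domains\<close>

text \<open>Near each boundary point the domain is, in a suitable direction \<open>e\<close>, the strict
  subgraph of a Lipschitz function of the component orthogonal to \<open>e\<close>.\<close>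

definition bounded_lipschitz_domain :: "'a::euclidean_space set \<Rightarrow> bool" where
  "bounded_lipschitz_domain S \<longleftrightarrow>
     S \<noteq> {} \<and> open S \<and> connected S \<and> bounded S \<and>
     (\<forall>p\<in>frontier S. \<exists>U e g L. open U \<and> p \<in> U \<and> norm e = 1 \<and> L-lipschitz_on UNIV g \<and>
        S \<inter> U = {x \<in> U. x \<bullet> e < g (x - (x \<bullet> e) *\<^sub>R e)})"

text \<open>The unit vector \<open>n\<close> is the outward normal of \<open>S\<close> at the boundary point \<open>p\<close>: inside every
  open cone around \<open>-n\<close> (around \<open>n\<close>) with vertex \<open>p\<close>, points near \<open>p\<close> are inside
  (outside) \<open>S\<close>.  No such \<open>n\<close> exists at an edge or corner.\<close>

definition outward_normal :: "'a::euclidean_space set \<Rightarrow> 'a \<Rightarrow> 'a \<Rightarrow> bool" where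
  "outward_normal S p n \<longleftrightarrow> norm n = 1 \<and>
     (\<forall>\<epsilon>>0. \<exists>\<delta>>0. \<forall>q\<in>ball p \<delta>.
        ((q - p) \<bullet> n < - \<epsilon> * norm (q - p) \<longrightarrow> q \<in> S) \<and>
        ((q - p) \<bullet> n > \<epsilon> * norm (q - p) \<longrightarrow> q \<notin> S))"

text \<open>Near \<open>p\<close> the planar set \<open>D\<close> is asymptotic to a sector with vertex \<open>p\<close> and
  opening \<open>\<alpha>\<close>.\<close>

definition has_interior_angle :: "(real \<times> real) set \<Rightarrow> real \<times> real \<Rightarrow> real \<Rightarrow> bool" where
  "has_interior_angle D p \<alpha> \<longleftrightarrow> 0 \<le> \<alpha> \<and> \<alpha> \<le> 2 * pi \<and>
     (\<exists>\<beta>. \<forall>\<epsilon>>0. \<exists>\<delta>>0. \<forall>\<rho> t. 0 < \<rho> \<and> \<rho> < \<delta> \<longrightarrow>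
        (\<beta> + \<epsilon> < t \<and> t < \<beta> + \<alpha> - \<epsilon> \<longrightarrow> p + \<rho> *\<^sub>R (cos t, sin t) \<in> D) \<and>
        (\<beta> + \<alpha> + \<epsilon> < t \<and> t < \<beta> + 2 * pi - \<epsilon> \<longrightarrow> p + \<rho> *\<^sub>R (cos t, sin t) \<notin> D))"

definition C2_on :: "'a::real_normed_vector set \<Rightarrow> ('a \<Rightarrow> 'b::real_normed_vector) \<Rightarrow> bool" where
  "C2_on U f \<longleftrightarrow>
     (\<exists>(f' :: 'a \<Rightarrow> 'a \<Rightarrow>\<^sub>L 'b) (f'' :: 'a \<Rightarrow> 'a \<Rightarrow>\<^sub>L ('a \<Rightarrow>\<^sub>L 'b)).
        (\<forall>x\<in>U. (f has_derivative blinfun_apply (f' x)) (at x) \<and>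
                (f' has_derivative blinfun_apply (f'' x)) (at x)) \<and>
        continuous_on U f'')"

text \<open>Embedded \<open>C\<^sup>2\<close> surface in space, possibly with boundary: a \<open>C\<^sup>2\<close> diffeomorphism
  straightens it locally to a plane or to a closed half-plane.  The rigid wall contains the rim
  of the free surface, so it is a surface with boundary and is \<open>C\<^sup>2\<close> up to the rim.\<close>

definition C2_surface :: "(real \<times> real \<times> real) set \<Rightarrow> bool" where
  "C2_surface S \<longleftrightarrow>
     (\<forall>p\<in>S. \<exists>U V (f :: real \<times> real \<times> real \<Rightarrow> real \<times> real \<times> real) g.
        open U \<and> p \<in> U \<and> open V \<and> homeomorphism U V f g \<and> C2_on U f \<and> C2_on V g \<and>
        (f ` (S \<inter> U) = {(a, b, c). c = 0} \<inter> V \<or>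
         f ` (S \<inter> U) = {(a, b, c). c = 0 \<and> a \<ge> 0} \<inter> V))"

text \<open>Points of space are triples \<open>(x, y, z)\<close> with \<open>y\<close> the vertical coordinate.\<close>

definition liquid_domain :: "(real \<times> real \<times> real) set \<Rightarrow> (real \<times> real \<times> real) set \<Rightarrow> bool" where
  "liquid_domain W F \<longleftrightarrow>
     bounded_lipschitz_domain W \<and> W \<subseteq> {(x, y, z). y < 0} \<and>
     F \<subseteq> frontier W \<and> F \<subseteq> {(x, y, z). y = 0} \<and>
     bounded_lipschitz_domain {(x, z). (x, 0, z) \<in> F} \<and>
     simply_connected {(x, z). (x, 0, z) \<in> F}"

definition rigid_wall :: "(real \<times> real \<times> real) set \<Rightarrow> (real \<times> real \<times> real) set \<Rightarrow> (real \<times> real \<times> real) set" where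
  "rigid_wall W F = frontier W - F"

definition axisymmetric :: "(real \<times> real \<times> real) set \<Rightarrow> bool" where
  "axisymmetric S \<longleftrightarrow>
     (\<forall>x y z x' z'. x\<^sup>2 + z\<^sup>2 = x'\<^sup>2 + z'\<^sup>2 \<longrightarrow> ((x, y, z) \<in> S \<longleftrightarrow> (x', y, z') \<in> S))"

text \<open>Cross-section in the closed half-plane \<open>\<theta> = 0\<close>, \<open>r \<ge> 0\<close>, used for the free surface and
  the wall, and in the open half-plane \<open>r > 0\<close>, used for the domain.  Points are pairs \<open>(r, y)\<close>.\<close>

definition cross_section :: "(real \<times> real \<times> real) set \<Rightarrow> (real \<times> real) set" where
  "cross_section S = {(r, y). 0 \<le> r \<and> (r, y, 0) \<in> S}"

definition meridian_domain :: "(real \<times> real \<times> real) set \<Rightarrow> (real \<times> real) set" where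
  "meridian_domain W = {(r, y). 0 < r \<and> (r, y, 0) \<in> W}"

section \<open>The Sobolev space \<open>H\<^sup>1\<close>\<close>

definition square_integrable_on ::
    "('a::euclidean_space \<Rightarrow> 'b::euclidean_space) \<Rightarrow> 'a set \<Rightarrow> bool" where
  "square_integrable_on f S \<longleftrightarrow>
     f \<in> borel_measurable (lebesgue_on S) \<and> integrable (lebesgue_on S) (\<lambda>x. (norm (f x))\<^sup>2)"

text \<open>Smooth functions with compact support in \<open>S\<close>.  Here \<open>T [v\<^sub>1, \<dots>, v\<^sub>k] x\<close> is the \<open>k\<close>-th
  order derivative of \<open>\<eta>\<close> at \<open>x\<close> in the directions \<open>v\<^sub>1, \<dots>, v\<^sub>k\<close>.\<close>

definition test_function :: "'a::euclidean_space set \<Rightarrow> ('a \<Rightarrow> real) \<Rightarrow> bool" where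
  "test_function S \<eta> \<longleftrightarrow>
     (\<exists>T :: 'a list \<Rightarrow> 'a \<Rightarrow> real. T [] = \<eta> \<and>
        (\<forall>vs x. (T vs has_derivative (\<lambda>v. T (v # vs) x)) (at x))) \<and>
     (\<exists>K. compact K \<and> K \<subseteq> S \<and> (\<forall>x. x \<notin> K \<longrightarrow> \<eta> x = 0))"

definition in_H1 :: "'a::euclidean_space set \<Rightarrow> ('a \<Rightarrow> real) \<Rightarrow> bool" where
  "in_H1 S \<phi> \<longleftrightarrow> square_integrable_on \<phi> S \<and>
     (\<exists>G :: 'a \<Rightarrow> 'a. square_integrable_on G S \<and>
        (\<forall>\<eta>. test_function S \<eta> \<longrightarrow> (\<forall>b\<in>Basis.
           (\<integral>x. \<phi> x * frechet_derivative \<eta> (at x) b \<partial>(lebesgue_on S)) =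
           - (\<integral>x. (G x \<bullet> b) * \<eta> x \<partial>(lebesgue_on S)))))"

section \<open>The first azimuthal mode of the sloshing problem\<close>

definition d_r :: "(real \<times> real \<Rightarrow> real) \<Rightarrow> real \<times> real \<Rightarrow> real" where
  "d_r \<psi> = (\<lambda>(r, y). deriv (\<lambda>s. \<psi> (s, y)) r)"

definition d_y :: "(real \<times> real \<Rightarrow> real) \<Rightarrow> real \<times> real \<Rightarrow> real" where
  "d_y \<psi> = (\<lambda>(r, y). deriv (\<lambda>s. \<psi> (r, s)) y)"

text \<open>The function \<open>\<psi>(r, y) cos \<theta>\<close> on space; it takes the value \<open>0\<close> on the axis, where
  \<open>x / 0 = 0\<close>.\<close>

definition cos_mode :: "(real \<times> real \<Rightarrow> real) \<Rightarrow> real \<times> real \<times> real \<Rightarrow> real" where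
  "cos_mode \<psi> = (\<lambda>(x, y, z). \<psi> (sqrt (x\<^sup>2 + z\<^sup>2), y) * (x / sqrt (x\<^sup>2 + z\<^sup>2)))"

text \<open>The reduced boundary value problem for the sloshing eigenfunctions \<open>\<psi>(r, y) cos \<theta>\<close>.  The
  admissible class (\<open>H\<^sup>1\<close>, continuous up to the boundary) is that of the sloshing problem on
  \<open>W\<close>; continuity of \<open>\<psi>\<close> on the compact set \<open>closure D\<close> includes boundedness near the axis,
  and the zero mean of \<open>\<psi> cos \<theta>\<close> over \<open>F\<close> holds by symmetry.  The derivatives in the boundary
  conditions are one-sided, taken from inside; the Neumann condition is imposed at all points of the
  wall at which the boundary has a normal.\<close>

definition mode1_eigenfunction ::
    "(real \<times> real \<times> real) set \<Rightarrow> (real \<times> real \<times> real) set \<Rightarrow> real \<Rightarrow> (real \<times> real \<Rightarrow> real) \<Rightarrow> bool" where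
  "mode1_eigenfunction W F \<nu> \<psi> \<longleftrightarrow>
     (let D = meridian_domain W in
       in_H1 W (cos_mode \<psi>) \<and> continuous_on (closure W) (cos_mode \<psi>) \<and>
       continuous_on (closure D) \<psi> \<and> (\<exists>p\<in>D. \<psi> p \<noteq> 0) \<and>
       C2_on D \<psi> \<and>
       (\<forall>(r, y)\<in>D. d_r (d_r \<psi>) (r, y) + 1 / r * d_r \<psi> (r, y) + d_y (d_y \<psi>) (r, y)
                     - 1 / r\<^sup>2 * \<psi> (r, y) = 0) \<and>
       (\<forall>(r, y)\<in>cross_section F.
          ((\<lambda>s. \<psi> (r, s)) has_real_derivative \<nu> * \<psi> (r, y)) (at_left y)) \<and>
       (\<forall>p\<in>cross_section (rigid_wall W F). \<forall>n. outward_normal D p n \<longrightarrow>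
          ((\<lambda>t. \<psi> (p + t *\<^sub>R n)) has_real_derivative 0) (at_left 0)))"

text \<open>\<open>\<nu>\<close> is the smallest eigenvalue \<open>\<nu>\<^sub>1\<^sub>,\<^sub>1\<close> and \<open>\<psi>\<close> a corresponding eigenfunction
  \<open>\<psi>\<^sub>1\<^sub>,\<^sub>1\<close>.\<close>

definition fundamental_mode1 ::
    "(real \<times> real \<times> real) set \<Rightarrow> (real \<times> real \<times> real) set \<Rightarrow> real \<Rightarrow> (real \<times> real \<Rightarrow> real) \<Rightarrow> bool" where
  "fundamental_mode1 W F \<nu> \<psi> \<longleftrightarrow> mode1_eigenfunction W F \<nu> \<psi> \<and>
     (\<forall>\<mu> \<psi>'. mode1_eigenfunction W F \<mu> \<psi>' \<longrightarrow> \<nu> \<le> \<mu>)"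

end

theory Submission
  imports Defs
begin

text \<open>Let \<open>M\<close> be the maximum of \<open>\<psi>\<close> on the closed section.  The zeroth-order term \<open>- \<psi> / r\<^sup>2\<close> of the
  equation is negative, so \<open>M\<close> is not attained inside; \<open>\<psi>\<close> vanishes on the axis, and the Hopf lemma
  excludes the wall away from the rim.  The heart of the matter is the rim, where the interior angle
  \<open>\<alpha> \<in> (\<pi> / 2, \<pi>)\<close> enters through two barriers for \<open>u = M - \<psi> \<ge> 0\<close>.  A sector of opening greater
  than \<open>\<pi> / 2\<close> with a Neumann condition on the wall side admits a positive subsolution that decays
  more slowly than linearly at the vertex (here linear times logarithmic), so away
  from the free surface \<open>u\<close> exceeds every multiple of the distance to the rim.  The flux \<open>- \<nu> \<psi>\<close> through the free surface, on the
  other hand, can only produce a linear decay of \<open>u\<close>.  Hence \<open>u\<close> stays positive up to the rim: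
  \<open>\<psi> < M\<close> there.  The maximum therefore lies in the interior of the free surface, strictly above
  the values at the axis and at the rim, and the mean value theorem on horizontal segments just below
  the free surface yields both signs of the radial derivative.\<close>

section \<open>Local maxima, normals and sublevel sets\<close>

text \<open>The value pi / 2 is a threshold of the mixed problem in a sector of opening \<alpha>:
  the positive harmonic function that vanishes on one side and has Neumann data zero on the other is
  homogeneous of degree pi / (2 \<alpha>), below one exactly when \<alpha> > pi / 2. Linear times
  logarithmic replaces this power and keeps all constants explicit. The first barrier alone is not
  enough: it vanishes at the rim and leaves \<open>\<psi> (R, 0) = M\<close> possible. It is used on
  a single small arc, where the logarithm outweighs any prescribed slope; there the second barrier
  finds room both for a slope that beats the flux and for a positive constant that survives at the
  rim. Derivatives of \<psi> are not controlled near the boundary, so every comparison is made at a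
  point where \<psi> plus a smooth barrier is maximal. At the corner there is not even a normal. A
  further obstacle is geometric: the angle describes \<open>D\<close> only asymptotically, and the
  wall is known only through charts of unknown orientation. Together they yield wall normals that
  converge at the rim at a linear rate, as both barriers require.\<close>

lemma local_max_second_derivative:
  fixes f f' :: "real \<Rightarrow> real"
  assumes f: "\<forall>\<^sub>F s in nhds x. (f has_real_derivative f' s) (at s)"
    and f': "(f' has_real_derivative D) (at x)"
    and max: "\<forall>\<^sub>F s in nhds x. f s \<le> f x"
  shows "f' x = 0 \<and> D \<le> 0"
proof
  obtain d where d: "d > 0" "\<And>s. dist s x < d \<Longrightarrow> (f has_real_derivative f' s) (at s) \<and> f s \<le> f x"
    using eventually_conj[OF f max] unfolding eventually_nhds_metric by auto
  have fx: "(f has_real_derivative f' x) (at x)"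
    using d by simp
  show zero: "f' x = 0"
    by (rule DERIV_local_max[OF fx d(1)]) (use d(2) in \<open>auto simp: dist_real_def abs_minus_commute\<close>)
  show "D \<le> 0"
  proof (rule ccontr)
    assume "\<not> D \<le> 0"
    then obtain d' where d': "d' > 0" "\<And>h. 0 < h \<Longrightarrow> h < d' \<Longrightarrow> f' x < f' (x + h)"
      using DERIV_pos_inc_right[OF f'] by force
    define h where "h = min d d' / 2"
    have h: "0 < h" "h < d" "h < d'"
      using d(1) d'(1) by (auto simp: h_def)
    have "f x < f (x + h)"
    proof (rule DERIV_pos_imp_increasing_open[where f = f])
      show "x < x + h" using h by simp
      show "\<exists>y. (f has_real_derivative y) (at t) \<and> 0 < y" if "x < t" "t < x + h" for t
        using d(2)[of t] d'(2)[of "t - x"] that h zero by (intro exI[of _ "f' t"]) (auto simp: dist_real_def)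
      show "continuous_on {x..x + h} f"
      proof (intro DERIV_atLeastAtMost_imp_continuous_on)
        show "\<exists>y. (f has_real_derivative y) (at t)" if "x \<le> t" "t \<le> x + h" for t
          using d(2)[of t] that h by (intro exI[of _ "f' t"]) (simp add: dist_real_def)
      qed
    qed
    moreover have "f (x + h) \<le> f x"
      using d(2)[of "x + h"] h by (simp add: dist_real_def)
    ultimately show False by simp
  qed
qed

text \<open>The free surface and wall conditions prescribe derivatives from inside only; this is the
  form of the first-order test that both admit.\<close>

lemma left_local_max_derivative_nonneg:
  fixes f :: "real \<Rightarrow> real"
  assumes f: "(f has_real_derivative d) (at_left x)"
    and max: "\<forall>\<^sub>F t in at_left x. f t \<le> f x"
  shows "0 \<le> d"
proof (rule tendsto_lowerbound)
  show "((\<lambda>t. (f t - f x) / (t - x)) \<longlongrightarrow> d) (at_left x)"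
    using f by (simp add: has_field_derivative_iff)
  show "\<forall>\<^sub>F t in at_left x. 0 \<le> (f t - f x) / (t - x)"
  proof -
    have "\<forall>\<^sub>F t in at_left x. t < x"
      by (simp add: eventually_at_filter)
    then show ?thesis
      using max by eventually_elim (simp add: divide_nonpos_neg)
  qed
qed simp

section \<open>Partial derivatives along coordinate lines\<close>

lemma eventually_nhds_in_open_fst:
  assumes "open U" "(r, y) \<in> U"
  shows "\<forall>\<^sub>F s in nhds r. (s, y) \<in> U"
proof -
  have "open ((\<lambda>s. (s, y)) -` U)"
    by (intro open_vimage assms continuous_intros)
  then show ?thesis
    using eventually_nhds_in_open[of "(\<lambda>s. (s, y)) -` U" r] assms(2) by simp
qed

lemma eventually_nhds_in_open_snd:
  assumes "open U" "(r, y) \<in> U"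
  shows "\<forall>\<^sub>F s in nhds y. (r, s) \<in> U"
proof -
  have "open ((\<lambda>s. (r, s)) -` U)"
    by (intro open_vimage assms continuous_intros)
  then show ?thesis
    using eventually_nhds_in_open[of "(\<lambda>s. (r, s)) -` U" y] assms(2) by simp
qed

lemma has_derivative_fst_line:
  assumes "(f has_derivative f') (at (r, y))"
  shows "((\<lambda>s. f (s, y)) has_derivative (\<lambda>h. f' (h, 0))) (at r)"
  by (rule has_derivative_compose[where g = f and f = "\<lambda>s. (s, y)", OF _ assms])
    (auto intro!: derivative_eq_intros)

lemma has_derivative_snd_line:
  assumes "(f has_derivative f') (at (r, y))"
  shows "((\<lambda>s. f (r, s)) has_derivative (\<lambda>h. f' (0, h))) (at y)"
  by (rule has_derivative_compose[where g = f and f = "\<lambda>s. (r, s)", OF _ assms])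
    (auto intro!: derivative_eq_intros)

lemma real_derivative_fst_line:
  fixes f :: "real \<times> real \<Rightarrow> real"
  assumes "(f has_derivative f') (at (r, y))"
  shows "((\<lambda>s. f (s, y)) has_real_derivative f' (1, 0)) (at r)"
proof -
  have "(\<lambda>h. f' (h, 0)) = (*) (f' (1, 0))"
  proof
    fix h
    have "f' (h *\<^sub>R (1, 0)) = h *\<^sub>R f' (1, 0)"
      by (rule linear_scale[OF has_derivative_linear[OF assms]])
    then show "f' (h, 0) = f' (1, 0) * h" by (simp add: mult.commute)
  qed
  with has_derivative_fst_line[OF assms] show ?thesis
    by (simp only: has_field_derivative_def)
qed

lemma real_derivative_snd_line:
  fixes f :: "real \<times> real \<Rightarrow> real"
  assumes "(f has_derivative f') (at (r, y))"
  shows "((\<lambda>s. f (r, s)) has_real_derivative f' (0, 1)) (at y)"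
proof -
  have "(\<lambda>h. f' (0, h)) = (*) (f' (0, 1))"
  proof
    fix h
    have "f' (h *\<^sub>R (0, 1)) = h *\<^sub>R f' (0, 1)"
      by (rule linear_scale[OF has_derivative_linear[OF assms]])
    then show "f' (0, h) = f' (0, 1) * h" by (simp add: mult.commute)
  qed
  with has_derivative_snd_line[OF assms] show ?thesis
    by (simp only: has_field_derivative_def)
qed

lemma C2_partial_derivatives:
  fixes f :: "real \<times> real \<Rightarrow> real"
  assumes "open D" "C2_on D f" "(r, y) \<in> D"
  shows "\<forall>\<^sub>F s in nhds r. ((\<lambda>s. f (s, y)) has_real_derivative d_r f (s, y)) (at s)"
    and "((\<lambda>s. d_r f (s, y)) has_real_derivative d_r (d_r f) (r, y)) (at r)"
    and "\<forall>\<^sub>F s in nhds y. ((\<lambda>s. f (r, s)) has_real_derivative d_y f (r, s)) (at s)"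
    and "((\<lambda>s. d_y f (r, s)) has_real_derivative d_y (d_y f) (r, y)) (at y)"
proof -
  obtain f' :: "real \<times> real \<Rightarrow> (real \<times> real) \<Rightarrow>\<^sub>L real"
    and f'' :: "real \<times> real \<Rightarrow> (real \<times> real) \<Rightarrow>\<^sub>L ((real \<times> real) \<Rightarrow>\<^sub>L real)"
    where f': "\<And>x. x \<in> D \<Longrightarrow> (f has_derivative blinfun_apply (f' x)) (at x)"
      and f'': "\<And>x. x \<in> D \<Longrightarrow> (f' has_derivative blinfun_apply (f'' x)) (at x)"
    using assms(2) unfolding C2_on_def by blast
  have r1: "((\<lambda>s. f (s, y)) has_real_derivative f' (r, y) (1, 0)) (at r)" if "(r, y) \<in> D" for r y
    by (rule real_derivative_fst_line[OF f'[OF that]])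
  have y1: "((\<lambda>s. f (r, s)) has_real_derivative f' (r, y) (0, 1)) (at y)" if "(r, y) \<in> D" for r y
    by (rule real_derivative_snd_line[OF f'[OF that]])
  have dr: "d_r f (r, y) = f' (r, y) (1, 0)" and dy: "d_y f (r, y) = f' (r, y) (0, 1)" if "(r, y) \<in> D" for r y
    using r1[OF that] y1[OF that] by (auto simp: d_r_def d_y_def DERIV_imp_deriv)
  have evr: "\<forall>\<^sub>F s in nhds r. (s, y) \<in> D"
    by (rule eventually_nhds_in_open_fst[OF assms(1) assms(3)])
  have evy: "\<forall>\<^sub>F s in nhds y. (r, s) \<in> D"
    by (rule eventually_nhds_in_open_snd[OF assms(1) assms(3)])
  show "\<forall>\<^sub>F s in nhds r. ((\<lambda>s. f (s, y)) has_real_derivative d_r f (s, y)) (at s)"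
    using evr by eventually_elim (simp add: dr r1)
  show "\<forall>\<^sub>F s in nhds y. ((\<lambda>s. f (r, s)) has_real_derivative d_y f (r, s)) (at s)"
    using evy by eventually_elim (simp add: dy y1)
  have "((\<lambda>s. f' (s, y) (1, 0)) has_derivative (\<lambda>h. f'' (r, y) (h, 0) (1, 0))) (at r)"
    by (rule bounded_linear.has_derivative[OF blinfun.bounded_linear_left
          has_derivative_fst_line[OF f''[OF assms(3)]]])
  then have "(\<lambda>s. f' (s, y) (1, 0)) differentiable (at r)"
    by (auto simp: differentiable_def)
  then have *: "((\<lambda>s. f' (s, y) (1, 0)) has_real_derivative deriv (\<lambda>s. f' (s, y) (1, 0)) r) (at r)"
    by (simp add: DERIV_deriv_iff_real_differentiable)
  \<comment> \<open>\<open>d_r\<close> is a \<open>deriv\<close> and is known to be a component of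
    \<open>f'\<close> only on \<open>D\<close>; differentiating once more needs the equality on a
    whole neighbourhood of \<open>r\<close>.\<close>
  have eq: "\<forall>\<^sub>F s in nhds r. d_r f (s, y) = f' (s, y) (1, 0)"
    using evr by eventually_elim (simp add: dr)
  have "((\<lambda>s. d_r f (s, y)) has_real_derivative deriv (\<lambda>s. f' (s, y) (1, 0)) r) (at r)"
    using * DERIV_cong_ev[OF refl eq refl] by simp
  then show "((\<lambda>s. d_r f (s, y)) has_real_derivative d_r (d_r f) (r, y)) (at r)"
    by (simp add: d_r_def[of "d_r f"] DERIV_imp_deriv)
  have "((\<lambda>s. f' (r, s) (0, 1)) has_derivative (\<lambda>h. f'' (r, y) (0, h) (0, 1))) (at y)"
    by (rule bounded_linear.has_derivative[OF blinfun.bounded_linear_left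
          has_derivative_snd_line[OF f''[OF assms(3)]]])
  then have "(\<lambda>s. f' (r, s) (0, 1)) differentiable (at y)"
    by (auto simp: differentiable_def)
  then have *: "((\<lambda>s. f' (r, s) (0, 1)) has_real_derivative deriv (\<lambda>s. f' (r, s) (0, 1)) y) (at y)"
    by (simp add: DERIV_deriv_iff_real_differentiable)
  have eq: "\<forall>\<^sub>F s in nhds y. d_y f (r, s) = f' (r, s) (0, 1)"
    using evy by eventually_elim (simp add: dy)
  have "((\<lambda>s. d_y f (r, s)) has_real_derivative deriv (\<lambda>s. f' (r, s) (0, 1)) y) (at y)"
    using * DERIV_cong_ev[OF refl eq refl] by simp
  then show "((\<lambda>s. d_y f (r, s)) has_real_derivative d_y (d_y f) (r, y)) (at y)"
    by (simp add: d_y_def[of "d_y f"] DERIV_imp_deriv)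
qed

text \<open>Only \<open>G q\<close> and \<open>G p\<close> are compared, so differentiability of the
  gradient at the single point \<open>p\<close> is enough to obtain it; the Taylor remainder at
  \<open>p\<close> is quadratic nevertheless.\<close>

definition gradient_Lipschitz_at ::
    "'a::real_inner \<Rightarrow> 'a set \<Rightarrow> ('a \<Rightarrow> real) \<Rightarrow> ('a \<Rightarrow> 'a) \<Rightarrow> real \<Rightarrow> bool" where
  "gradient_Lipschitz_at p N h G C \<longleftrightarrow> open N \<and> p \<in> N \<and>
     (\<forall>q\<in>N. (h has_derivative (\<lambda>v. G q \<bullet> v)) (at q)) \<and>
     (\<forall>q\<in>N. norm (G q - G p) \<le> C * norm (q - p))"

text \<open>Mean value inequality for \<open>h\<close> minus its linear part at \<open>p\<close>, on
  the segment from \<open>p\<close> to \<open>q\<close>; hence the constant \<open>C\<close> and not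
  \<open>C / 2\<close>.\<close>

lemma gradient_Lipschitz_at_Taylor:
  assumes "gradient_Lipschitz_at p N h G C" "ball p \<delta> \<subseteq> N" "q \<in> ball p \<delta>"
  shows "\<bar>h q - h p - G p \<bullet> (q - p)\<bar> \<le> C * (norm (q - p))\<^sup>2"
proof (cases "q = p")
  case False
  let ?S = "closed_segment p q"
  have S: "?S \<subseteq> ball p \<delta>"
    using assms(3) by (intro closed_segment_subset) (auto simp: dist_commute intro: le_less_trans[OF zero_le_dist])
  have d: "norm (x - p) \<le> norm (q - p)" if "x \<in> ?S" for x
    using segment_bound(1)[OF that] by (simp add: norm_minus_commute)
  \<comment> \<open>The definition does not ask for a nonnegative \<open>C\<close>; the estimate at
    a point \<open>q \<noteq> p\<close> forces it.\<close>
  have C: "0 \<le> C"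
  proof -
    have "q \<in> N"
      using assms(2,3) by blast
    then have "norm (G q - G p) \<le> C * norm (q - p)"
      using assms(1) by (simp add: gradient_Lipschitz_at_def)
    then have "0 \<le> C * norm (q - p)"
      using norm_ge_zero[of "G q - G p"] by linarith
    then show ?thesis
      using False by (simp add: zero_le_mult_iff)
  qed
  have "norm ((\<lambda>x. h x - G p \<bullet> x) q - (\<lambda>x. h x - G p \<bullet> x) p) \<le> C * norm (q - p) * norm (q - p)"
  proof (rule differentiable_bound)
    show "convex ?S" by simp
    show "((\<lambda>x. h x - G p \<bullet> x) has_derivative (\<lambda>v. (G x - G p) \<bullet> v)) (at x within ?S)" if "x \<in> ?S" for x
    proof -
      have "x \<in> N"
        using assms(2) S that by blast
      then have "(h has_derivative (\<lambda>v. G x \<bullet> v)) (at x within ?S)"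
        using assms(1) by (simp add: gradient_Lipschitz_at_def has_derivative_at_withinI)
      then have "((\<lambda>x. h x - G p \<bullet> x) has_derivative (\<lambda>v. G x \<bullet> v - G p \<bullet> v)) (at x within ?S)"
        by (intro has_derivative_diff has_derivative_inner_right has_derivative_ident)
      then show ?thesis
        by (simp add: inner_diff_left)
    qed
    show "onorm (\<lambda>v. (G x - G p) \<bullet> v) \<le> C * norm (q - p)" if "x \<in> ?S" for x
    proof -
      have "norm (G x - G p) \<le> C * norm (x - p)"
        using assms(1,2) S that unfolding gradient_Lipschitz_at_def by blast
      also have "\<dots> \<le> C * norm (q - p)"
        using C d[OF that] by (simp add: mult_left_mono)
      finally have "norm (G x - G p) \<le> C * norm (q - p)" .
      note le = this
      show ?thesis
      proof (rule onorm_bound)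
        show "0 \<le> C * norm (q - p)"
          using C by simp
        fix v
        have "norm ((G x - G p) \<bullet> v) \<le> norm (G x - G p) * norm v"
          by (simp add: Cauchy_Schwarz_ineq2)
        also have "\<dots> \<le> C * norm (q - p) * norm v"
          by (rule mult_right_mono[OF le]) simp
        finally show "norm ((G x - G p) \<bullet> v) \<le> C * norm (q - p) * norm v" .
      qed
    qed
  qed auto
  then show ?thesis
    by (simp add: inner_diff_right power2_eq_square algebra_simps)
qed simp

text \<open>In the two cones the linear part of \<open>h\<close> exceeds \<epsilon> |g| |q - p| in
  size, which bounds the first-order error in a small ball, so the linear part decides the sign of
  \<open>h\<close>.\<close>

lemma outward_normal_sublevel:
  fixes h :: "'a::euclidean_space \<Rightarrow> real"
  assumes h: "(h has_derivative (\<lambda>v. g \<bullet> v)) (at p)" and "h p = 0" "g \<noteq> 0"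
    and "\<delta> > 0" and D: "\<And>q. q \<in> ball p \<delta> \<Longrightarrow> q \<in> D \<longleftrightarrow> h q < 0"
  shows "outward_normal D p (g /\<^sub>R norm g)"
  unfolding outward_normal_def
proof (intro conjI allI impI)
  show "norm (g /\<^sub>R norm g) = 1"
    using assms(3) by simp
  fix \<epsilon> :: real
  assume "\<epsilon> > 0"
  then have "\<epsilon> * norm g > 0"
    using assms(3) by simp
  then obtain d where d: "d > 0"
    "\<And>q. norm (q - p) < d \<Longrightarrow> norm (h q - h p - g \<bullet> (q - p)) \<le> \<epsilon> * norm g * norm (q - p)"
    using h unfolding has_derivative_at_alt by blast
  show "\<exists>\<delta>>0. \<forall>q\<in>ball p \<delta>.
      ((q - p) \<bullet> (g /\<^sub>R norm g) < - \<epsilon> * norm (q - p) \<longrightarrow> q \<in> D) \<and>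
      (\<epsilon> * norm (q - p) < (q - p) \<bullet> (g /\<^sub>R norm g) \<longrightarrow> q \<notin> D)"
  proof (intro exI[of _ "min d \<delta>"] conjI ballI)
    show "min d \<delta> > 0" using d assms by simp
    fix q assume q: "q \<in> ball p (min d \<delta>)"
    then have T: "\<bar>h q - g \<bullet> (q - p)\<bar> \<le> \<epsilon> * norm g * norm (q - p)" and q': "q \<in> D \<longleftrightarrow> h q < 0"
      using d(2)[of q] D[of q] assms(2) by (auto simp: dist_norm norm_minus_commute)
    have g: "g \<bullet> (q - p) = norm g * ((q - p) \<bullet> (g /\<^sub>R norm g))"
      using assms(3) by (simp add: inner_commute)
    show "(q - p) \<bullet> (g /\<^sub>R norm g) < - \<epsilon> * norm (q - p) \<longrightarrow> q \<in> D"
    proof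
      assume "(q - p) \<bullet> (g /\<^sub>R norm g) < - \<epsilon> * norm (q - p)"
      then have "norm g * ((q - p) \<bullet> (g /\<^sub>R norm g)) < norm g * (- \<epsilon> * norm (q - p))"
        using assms(3) by (intro mult_strict_left_mono) auto
      then have "g \<bullet> (q - p) < - (\<epsilon> * norm g * norm (q - p))"
        unfolding g by (simp add: mult_ac)
      then show "q \<in> D" using T q' by linarith
    qed
    show "\<epsilon> * norm (q - p) < (q - p) \<bullet> (g /\<^sub>R norm g) \<longrightarrow> q \<notin> D"
    proof
      assume "\<epsilon> * norm (q - p) < (q - p) \<bullet> (g /\<^sub>R norm g)"
      then have "norm g * (\<epsilon> * norm (q - p)) < norm g * ((q - p) \<bullet> (g /\<^sub>R norm g))"
        using assms(3) by (intro mult_strict_left_mono) auto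
      then have "\<epsilon> * norm g * norm (q - p) < g \<bullet> (q - p)"
        unfolding g by (simp add: mult_ac)
      then show "q \<notin> D" using T q' by linarith
    qed
  qed
qed

text \<open>Interior sphere condition. In a ball of radius \<rho> touching at \<open>p\<close> from
  inside, 2 \<rho> n . (q - p) < - |q - p|^2 for the unit normal n, so the linear part of
  \<open>h\<close> dominates the quadratic remainder once 2 \<rho> C \<le> |G p|.\<close>

lemma interior_ball_sublevel:
  fixes h :: "'a::euclidean_space \<Rightarrow> real"
  assumes h: "gradient_Lipschitz_at p N h G C" and "h p = 0" "G p \<noteq> 0"
    and "\<delta> > 0" and D: "\<And>q. q \<in> ball p \<delta> \<Longrightarrow> q \<in> D \<longleftrightarrow> h q < 0"
  shows "\<exists>\<rho>\<^sub>0>0. \<forall>\<rho>. 0 < \<rho> \<longrightarrow> \<rho> < \<rho>\<^sub>0 \<longrightarrow> ball (p - \<rho> *\<^sub>R (G p /\<^sub>R norm (G p))) \<rho> \<subseteq> D"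
proof -
  obtain d where d: "d > 0" "ball p d \<subseteq> N"
    using h openE unfolding gradient_Lipschitz_at_def by meson
  define n where "n = G p /\<^sub>R norm (G p)"
  have n: "norm n = 1" "G p = norm (G p) *\<^sub>R n"
    using assms(3) by (auto simp: n_def)
  \<comment> \<open>Points of the ball are within 2 \<rho> of \<open>p\<close>: the first bound
    keeps them where the expansion and the side condition hold, the second gives 2 \<rho> C \<le> |G
    p|.\<close>
  define \<rho>\<^sub>0 where "\<rho>\<^sub>0 = min (min d \<delta> / 2) (norm (G p) / (2 * (\<bar>C\<bar> + 1)))"
  show ?thesis
  proof (intro exI[of _ \<rho>\<^sub>0] conjI allI impI)
    show "\<rho>\<^sub>0 > 0" using d assms by (simp add: \<rho>\<^sub>0_def)
    fix \<rho> :: real assume \<rho>: "0 < \<rho>" "\<rho> < \<rho>\<^sub>0"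
    show "ball (p - \<rho> *\<^sub>R (G p /\<^sub>R norm (G p))) \<rho> \<subseteq> D"
      unfolding n_def[symmetric]
    proof
      fix q assume "q \<in> ball (p - \<rho> *\<^sub>R n) \<rho>"
      then have q: "norm ((q - p) + \<rho> *\<^sub>R n) < \<rho>"
        by (simp add: dist_norm norm_minus_commute algebra_simps)
      have "(norm ((q - p) + \<rho> *\<^sub>R n))\<^sup>2 < \<rho>\<^sup>2"
        using q \<rho> by (intro power_strict_mono) auto
      moreover have "(norm ((q - p) + \<rho> *\<^sub>R n))\<^sup>2 = (norm (q - p))\<^sup>2 + 2 * \<rho> * (n \<bullet> (q - p)) + \<rho>\<^sup>2"
        unfolding power2_norm_eq_inner using n(1)
        by (simp add: inner_add_left inner_add_right inner_commute power2_eq_square norm_eq_1)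
      ultimately have nq: "2 * \<rho> * (n \<bullet> (q - p)) < - (norm (q - p))\<^sup>2"
        by linarith
      have "norm (q - p) \<le> norm ((q - p) + \<rho> *\<^sub>R n) + norm (\<rho> *\<^sub>R n)"
        by (metis add_diff_cancel_right' norm_triangle_ineq4)
      then have small: "norm (q - p) < 2 * \<rho>"
        using q n \<rho> by simp
      then have qd: "q \<in> ball p d" "q \<in> ball p \<delta>"
        using \<rho> by (auto simp: \<rho>\<^sub>0_def dist_norm norm_minus_commute)
      have qp: "q \<noteq> p" using nq by auto
      have "h q \<le> G p \<bullet> (q - p) + C * (norm (q - p))\<^sup>2"
        using gradient_Lipschitz_at_Taylor[OF h d(2) qd(1)] assms(2) by linarith
      also have "G p \<bullet> (q - p) = norm (G p) * (n \<bullet> (q - p))"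
        using n(2) by (metis inner_scaleR_left)
      finally have "2 * \<rho> * h q \<le> 2 * \<rho> * (norm (G p) * (n \<bullet> (q - p)) + C * (norm (q - p))\<^sup>2)"
        using \<rho> by (intro mult_left_mono) auto
      also have "\<dots> = norm (G p) * (2 * \<rho> * (n \<bullet> (q - p))) + 2 * \<rho> * C * (norm (q - p))\<^sup>2"
        by (simp add: algebra_simps)
      also have "\<dots> < norm (G p) * (- (norm (q - p))\<^sup>2) + norm (G p) * (norm (q - p))\<^sup>2"
      proof (intro add_less_le_mono mult_strict_left_mono mult_right_mono nq)
        have "2 * \<rho> * C \<le> 2 * \<rho> * (\<bar>C\<bar> + 1)"
          using \<rho> by (intro mult_left_mono) auto
        also have "\<dots> \<le> norm (G p)"
          using \<rho> by (auto simp: \<rho>\<^sub>0_def field_simps)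
        finally show "2 * \<rho> * C \<le> norm (G p)" .
      qed (use assms(3) in auto)
      finally have "h q < 0"
        using \<rho> by (simp add: mult_less_0_iff)
      then show "q \<in> D"
        using D[OF qd(2)] by simp
    qed
  qed
qed

section \<open>Gradients and axial Laplacians of barriers\<close>

text \<open>The number \<open>L\<close> is the value at \<open>q = (r, y)\<close> of \<open>E\<^sub>r\<^sub>r + E\<^sub>y\<^sub>y + E\<^sub>r / r\<close>; the term
  \<open>- E / r\<^sup>2\<close> of the equation is left out, which makes constants harmless.\<close>

definition axial_jet ::
    "(real \<times> real \<Rightarrow> real) \<Rightarrow> real \<times> real \<Rightarrow> real \<Rightarrow> real \<times> real \<Rightarrow> bool" where
  "axial_jet E g L q \<longleftrightarrow>
     (\<exists>G H. (\<forall>\<^sub>F x in nhds q. (E has_derivative (\<lambda>v. G x \<bullet> v)) (at x)) \<and>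
        (G has_derivative H) (at q) \<and> g = G q \<and>
        L = fst (H (1, 0)) + snd (H (0, 1)) + fst g / fst q)"

lemma axial_jet_derivative: "axial_jet E g L q \<Longrightarrow> (E has_derivative (\<lambda>v. g \<bullet> v)) (at q)"
  unfolding axial_jet_def by (auto dest: eventually_nhds_x_imp_x)

lemma axial_jet_eqI: "axial_jet E g' L' q \<Longrightarrow> g' = g \<Longrightarrow> L' = L \<Longrightarrow> axial_jet E g L q"
  by simp

lemma axial_jet_const: "axial_jet (\<lambda>q. c) 0 0 q"
  unfolding axial_jet_def by (rule exI[of _ "\<lambda>q. 0"], rule exI[of _ "\<lambda>q. 0"])
    (auto intro!: always_eventually derivative_eq_intros)

lemma axial_jet_linear: "axial_jet (\<lambda>q. v \<bullet> (q - p)) v (fst v / fst q) q"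
  unfolding axial_jet_def
  by (rule exI[of _ "\<lambda>q. v"], rule exI[of _ "\<lambda>q. 0"])
    (auto intro!: always_eventually derivative_eq_intros)

lemma axial_jet_add:
  assumes "axial_jet E g L q" "axial_jet E' g' L' q"
  shows "axial_jet (\<lambda>q. E q + E' q) (g + g') (L + L') q"
proof -
  obtain G H where E: "\<forall>\<^sub>F x in nhds q. (E has_derivative (\<lambda>v. G x \<bullet> v)) (at x)"
    "(G has_derivative H) (at q)" "g = G q" "L = fst (H (1, 0)) + snd (H (0, 1)) + fst g / fst q"
    using assms(1) unfolding axial_jet_def by blast
  obtain G' H' where E': "\<forall>\<^sub>F x in nhds q. (E' has_derivative (\<lambda>v. G' x \<bullet> v)) (at x)"
    "(G' has_derivative H') (at q)" "g' = G' q" "L' = fst (H' (1, 0)) + snd (H' (0, 1)) + fst g' / fst q"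
    using assms(2) unfolding axial_jet_def by blast
  have "\<forall>\<^sub>F x in nhds q. ((\<lambda>q. E q + E' q) has_derivative (\<lambda>v. (G x + G' x) \<bullet> v)) (at x)"
    using E(1) E'(1) by eventually_elim (simp add: inner_add_left has_derivative_add)
  moreover have "((\<lambda>x. G x + G' x) has_derivative (\<lambda>v. H v + H' v)) (at q)"
    by (intro has_derivative_add E E')
  ultimately show ?thesis
    unfolding axial_jet_def using E E'
    by (intro exI[of _ "\<lambda>x. G x + G' x"] exI[of _ "\<lambda>v. H v + H' v"]) (simp add: add_divide_distrib)
qed

text \<open>The cross term \<open>2 * (g \<bullet> g')\<close> is what the product of wedge and
  logarithm later has to absorb.\<close>

lemma axial_jet_mult:
  assumes "axial_jet E g L q" "axial_jet E' g' L' q"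
  shows "axial_jet (\<lambda>q. E q * E' q) (E q *\<^sub>R g' + E' q *\<^sub>R g) (E q * L' + E' q * L + 2 * (g \<bullet> g')) q"
proof -
  obtain G H where E: "\<forall>\<^sub>F x in nhds q. (E has_derivative (\<lambda>v. G x \<bullet> v)) (at x)"
    "(G has_derivative H) (at q)" "g = G q" "L = fst (H (1, 0)) + snd (H (0, 1)) + fst g / fst q"
    using assms(1) unfolding axial_jet_def by blast
  obtain G' H' where E': "\<forall>\<^sub>F x in nhds q. (E' has_derivative (\<lambda>v. G' x \<bullet> v)) (at x)"
    "(G' has_derivative H') (at q)" "g' = G' q" "L' = fst (H' (1, 0)) + snd (H' (0, 1)) + fst g' / fst q"
    using assms(2) unfolding axial_jet_def by blast
  let ?G = "\<lambda>x. E x *\<^sub>R G' x + E' x *\<^sub>R G x"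
  let ?H = "\<lambda>v. (E q *\<^sub>R H' v + (g \<bullet> v) *\<^sub>R g') + (E' q *\<^sub>R H v + (g' \<bullet> v) *\<^sub>R g)"
  have "\<forall>\<^sub>F x in nhds q. ((\<lambda>q. E q * E' q) has_derivative (\<lambda>v. ?G x \<bullet> v)) (at x)"
    using E(1) E'(1)
  proof eventually_elim
    case (elim x)
    have "((\<lambda>q. E q * E' q) has_derivative (\<lambda>v. E x * (G' x \<bullet> v) + (G x \<bullet> v) * E' x)) (at x)"
      by (rule has_derivative_mult[OF elim])
    then show ?case
      by (simp add: inner_add_left mult.commute)
  qed
  moreover have "(?G has_derivative ?H) (at q)"
    unfolding E(3) E'(3)
    by (intro has_derivative_add has_derivative_scaleR E E' eventually_nhds_x_imp_x[OF E(1)]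
        eventually_nhds_x_imp_x[OF E'(1)])
  moreover have "E q * L' + E' q * L + 2 * (g \<bullet> g') =
      fst (?H (1, 0)) + snd (?H (0, 1)) + fst (E q *\<^sub>R g' + E' q *\<^sub>R g) / fst q"
    unfolding E(4) E'(4) by (cases g; cases g') (simp add: algebra_simps add_divide_distrib)
  ultimately show ?thesis
    unfolding axial_jet_def by (intro exI[of _ ?G] exI[of _ ?H]) (simp add: E(3) E'(3))
qed

lemma axial_jet_cmult:
  assumes "axial_jet E g L q"
  shows "axial_jet (\<lambda>q. c * E q) (c *\<^sub>R g) (c * L) q"
  using axial_jet_mult[OF axial_jet_const[of c] assms] by simp

lemma has_derivative_norm_diff:
  fixes x p :: "'a::real_inner"
  assumes "x \<noteq> p"
  shows "((\<lambda>x. norm (x - p)) has_derivative (\<lambda>v. ((x - p) /\<^sub>R norm (x - p)) \<bullet> v)) (at x)"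
proof -
  have "((\<lambda>x. x - p) has_derivative (\<lambda>v. v)) (at x)"
    by (auto intro!: derivative_eq_intros)
  then have "((\<lambda>x. norm (x - p)) has_derivative (\<lambda>v. v \<bullet> sgn (x - p))) (at x)"
    by (rule has_derivative_compose) (use assms in \<open>simp add: has_derivative_norm\<close>)
  then show ?thesis
    by (simp add: sgn_div_norm inner_commute)
qed

text \<open>The planar Laplacian of the distance is its reciprocal. This unbounded positive term is
  what absorbs the bounded contributions of \<open>E\<^sub>r / r\<close> near the rim.\<close>

lemma axial_jet_norm:
  assumes "q \<noteq> p"
  shows "axial_jet (\<lambda>q. norm (q - p)) ((q - p) /\<^sub>R norm (q - p))
    (1 / norm (q - p) + fst (q - p) / (fst q * norm (q - p))) q"
proof -
  let ?N = "\<lambda>x. norm (x - p)"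
  note N = has_derivative_norm_diff[of _ p]
  have ev: "\<forall>\<^sub>F x in nhds q. x \<noteq> p"
    using assms by (intro t1_space_nhds)
  let ?H = "\<lambda>v. v /\<^sub>R ?N q - ((((q - p) /\<^sub>R ?N q) \<bullet> v) / (?N q)\<^sup>2) *\<^sub>R (q - p)"
  have "((\<lambda>x. (x - p) /\<^sub>R ?N x) has_derivative ?H) (at q)"
    using assms by (auto intro!: derivative_eq_intros N simp: power2_eq_square field_simps)
  moreover have "1 / ?N q + fst (q - p) / (fst q * ?N q) =
      fst (?H (1, 0)) + snd (?H (0, 1)) + fst ((q - p) /\<^sub>R ?N q) / fst q"
  proof -
    have N0: "?N q > 0" using assms by simp
    have sq: "(?N q)\<^sup>2 = (fst (q - p))\<^sup>2 + (snd (q - p))\<^sup>2"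
      by (cases "q - p") (simp add: norm_Pair)
    have "fst (?H (1, 0)) + snd (?H (0, 1)) = 2 / ?N q - ((fst (q - p))\<^sup>2 + (snd (q - p))\<^sup>2) / (?N q * (?N q)\<^sup>2)"
      by (cases "q - p") (simp add: field_simps power2_eq_square add_divide_distrib)
    also have "\<dots> = 1 / ?N q"
      unfolding sq[symmetric] using N0 by (simp add: field_simps)
    finally have H: "fst (?H (1, 0)) + snd (?H (0, 1)) = 1 / ?N q" .
    have "fst ((q - p) /\<^sub>R ?N q) / fst q = fst (q - p) / (fst q * ?N q)"
      by (simp add: divide_inverse mult_ac)
    then show ?thesis by (simp only: H)
  qed
  ultimately show ?thesis
    unfolding axial_jet_def using ev
    by (intro exI[of _ "\<lambda>x. (x - p) /\<^sub>R ?N x"] exI[of _ ?H]) (auto elim!: eventually_mono intro: N)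
qed

text \<open>The logarithm of the distance is harmonic in the plane, so only the first-order term
  \<open>E\<^sub>r / r\<close> is left.\<close>

lemma axial_jet_ln_norm:
  assumes "q \<noteq> p"
  shows "axial_jet (\<lambda>q. ln (norm (q - p))) ((q - p) /\<^sub>R (norm (q - p))\<^sup>2)
    (fst (q - p) / (fst q * (norm (q - p))\<^sup>2)) q"
proof -
  let ?N = "\<lambda>x. norm (x - p)"
  note N = has_derivative_norm_diff[of _ p]
  have lnN: "((\<lambda>x. ln (?N x)) has_derivative (\<lambda>v. ((x - p) /\<^sub>R (norm (x - p))\<^sup>2) \<bullet> v)) (at x)" if "x \<noteq> p" for x
    using that by (auto intro!: derivative_eq_intros N simp: power2_eq_square divide_inverse mult_ac)
  have ev: "\<forall>\<^sub>F x in nhds q. x \<noteq> p"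
    using assms by (intro t1_space_nhds)
  let ?H = "\<lambda>v. v /\<^sub>R (?N q)\<^sup>2 - (2 * ((q - p) \<bullet> v) / (?N q) ^ 4) *\<^sub>R (q - p)"
  have "((\<lambda>x. (x - p) /\<^sub>R (?N x)\<^sup>2) has_derivative ?H) (at q)"
  proof -
    have "((\<lambda>x. (norm (x - p))\<^sup>2) has_derivative (\<lambda>v. 2 * ((q - p) \<bullet> v))) (at q)"
      unfolding power2_norm_eq_inner by (auto intro!: derivative_eq_intros simp: inner_commute)
    then have "((\<lambda>x. inverse ((norm (x - p))\<^sup>2)) has_derivative
        (\<lambda>v. - (2 * ((q - p) \<bullet> v) / (?N q) ^ 4))) (at q)"
      using assms
      by (intro has_derivative_eq_rhs[OF Deriv.has_derivative_inverse])
        (auto simp: fun_eq_iff power2_eq_square power4_eq_xxxx divide_inverse)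
    moreover have "((\<lambda>x. x - p) has_derivative (\<lambda>v. v)) (at q)"
      by (auto intro!: derivative_eq_intros)
    ultimately show ?thesis
      by (rule has_derivative_eq_rhs[OF has_derivative_scaleR]) simp
  qed
  moreover have "fst (q - p) / (fst q * (?N q)\<^sup>2) =
      fst (?H (1, 0)) + snd (?H (0, 1)) + fst ((q - p) /\<^sub>R (?N q)\<^sup>2) / fst q"
  proof -
    have N0: "?N q > 0" using assms by simp
    have sq: "(?N q)\<^sup>2 = (fst (q - p))\<^sup>2 + (snd (q - p))\<^sup>2"
      by (cases "q - p") (simp add: norm_Pair)
    have "fst (?H (1, 0)) + snd (?H (0, 1)) = 2 / (?N q)\<^sup>2 - 2 * ((fst (q - p))\<^sup>2 + (snd (q - p))\<^sup>2) / (?N q) ^ 4"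
      by (cases "q - p") (simp add: field_simps power2_eq_square add_divide_distrib)
    also have "\<dots> = 0"
      unfolding sq[symmetric] using N0 by (simp add: field_simps power2_eq_square power4_eq_xxxx)
    finally have H: "fst (?H (1, 0)) + snd (?H (0, 1)) = 0" .
    have "fst ((q - p) /\<^sub>R (?N q)\<^sup>2) / fst q = fst (q - p) / (fst q * (?N q)\<^sup>2)"
      by (simp add: divide_inverse mult_ac)
    then show ?thesis by (simp only: H add_0)
  qed
  ultimately show ?thesis
    unfolding axial_jet_def using ev
    by (intro exI[of _ "\<lambda>x. (x - p) /\<^sub>R (?N x)\<^sup>2"] exI[of _ ?H]) (auto elim!: eventually_mono intro: lnN)
qed

lemma axial_jet_partial_derivatives:
  assumes "axial_jet E g L (r, y)"
  obtains Er Ey Err Eyy where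
    "\<forall>\<^sub>F s in nhds r. ((\<lambda>s. E (s, y)) has_real_derivative Er s) (at s)"
    "(Er has_real_derivative Err) (at r)"
    "\<forall>\<^sub>F s in nhds y. ((\<lambda>s. E (r, s)) has_real_derivative Ey s) (at s)"
    "(Ey has_real_derivative Eyy) (at y)"
    "L = Err + Eyy + Er r / r"
proof -
  obtain G H where E: "\<forall>\<^sub>F x in nhds (r, y). (E has_derivative (\<lambda>v. G x \<bullet> v)) (at x)"
    and G: "(G has_derivative H) (at (r, y))" and g: "g = G (r, y)"
    and L: "L = fst (H (1, 0)) + snd (H (0, 1)) + fst g / r"
    using assms unfolding axial_jet_def by auto
  obtain U where U: "open U" "(r, y) \<in> U" "\<And>x. x \<in> U \<Longrightarrow> (E has_derivative (\<lambda>v. G x \<bullet> v)) (at x)"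
    using E unfolding eventually_nhds by blast
  have evr: "\<forall>\<^sub>F s in nhds r. (s, y) \<in> U"
    by (rule eventually_nhds_in_open_fst[OF U(1) U(2)])
  have evy: "\<forall>\<^sub>F s in nhds y. (r, s) \<in> U"
    by (rule eventually_nhds_in_open_snd[OF U(1) U(2)])
  show ?thesis
  proof
    show "\<forall>\<^sub>F s in nhds r. ((\<lambda>s. E (s, y)) has_real_derivative fst (G (s, y))) (at s)"
      using evr by eventually_elim (use real_derivative_fst_line[OF U(3)] in \<open>simp add: inner_prod_def\<close>)
    show "\<forall>\<^sub>F s in nhds y. ((\<lambda>s. E (r, s)) has_real_derivative snd (G (r, s))) (at s)"
      using evy by eventually_elim (use real_derivative_snd_line[OF U(3)] in \<open>simp add: inner_prod_def\<close>)
    show "((\<lambda>s. fst (G (s, y))) has_real_derivative fst (H (1, 0))) (at r)"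
      by (rule real_derivative_fst_line[OF has_derivative_fst[OF G]])
    show "((\<lambda>s. snd (G (r, s))) has_real_derivative snd (H (0, 1))) (at y)"
      by (rule real_derivative_snd_line[OF has_derivative_snd[OF G]])
    show "L = fst (H (1, 0)) + snd (H (0, 1)) + fst (G (r, y)) / r"
      using L g by simp
  qed
qed

text \<open>One \<eta> is the error in length, the other the error of the vector itself, both
  relative to \<gamma>.\<close>

lemma norm_normalize_diff_le:
  fixes e v :: "'a::real_normed_vector"
  assumes "norm e = 1" "0 < \<gamma>" "norm (v - \<gamma> *\<^sub>R e) \<le> \<eta>" "\<eta> < \<gamma>"
  shows "v \<noteq> 0" "norm (v /\<^sub>R norm v - e) \<le> 2 * \<eta> / \<gamma>"
proof -
  have n: "norm (\<gamma> *\<^sub>R e) = \<gamma>" using assms by simp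
  have d: "\<bar>norm v - \<gamma>\<bar> \<le> \<eta>"
    using norm_triangle_ineq3[of v "\<gamma> *\<^sub>R e"] assms(3) n by linarith
  then show v: "v \<noteq> 0" using assms by auto
  have "\<gamma> *\<^sub>R (v /\<^sub>R norm v - e) = (\<gamma> - norm v) *\<^sub>R (v /\<^sub>R norm v) + (v - \<gamma> *\<^sub>R e)"
    using v by (simp add: algebra_simps)
  then have "\<gamma> * norm (v /\<^sub>R norm v - e) \<le> \<bar>\<gamma> - norm v\<bar> * norm (v /\<^sub>R norm v) + norm (v - \<gamma> *\<^sub>R e)"
    by (metis abs_of_pos assms(2) norm_scaleR norm_triangle_ineq)
  also have "\<dots> \<le> 2 * \<eta>"
    using d assms(3) v by simp
  finally show "norm (v /\<^sub>R norm v - e) \<le> 2 * \<eta> / \<gamma>"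
    using assms(2) by (simp add: field_simps)
qed

lemma abs_fst_le_norm: "\<bar>fst v\<bar> \<le> norm (v :: real \<times> real)"
  using norm_fst_le[of "fst v" "snd v"] by simp

text \<open>This is \<open>ln t \<le> t - 1\<close> at \<open>t = 1 / sqrt x\<close>. It supplies an
  explicit radius within which the logarithmic barrier is small at the rim.\<close>

lemma neg_ln_le_sqrt:
  assumes "0 < (x::real)"
  shows "- (x * ln x) \<le> 2 * sqrt x"
proof -
  have "ln (1 / sqrt x) \<le> 1 / sqrt x"
    using assms ln_le_minus_one[of "1 / sqrt x"] by simp
  then have "- ln x \<le> 2 / sqrt x"
    using assms by (simp add: ln_div ln_sqrt)
  then have "x * - ln x \<le> x * (2 / sqrt x)"
    using assms by (intro mult_left_mono) auto
  also have "x * (2 / sqrt x) = 2 * (x / sqrt x)" by simp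
  also have "x / sqrt x = sqrt x" using assms by (simp add: real_div_sqrt)
  finally show ?thesis by simp
qed

section \<open>The eigenfunction in the meridian section\<close>

text \<open>\<open>\<Gamma>\<close> is the section of the wall off the axis.  In \<open>chart\<close>, a defining function of the wall
  whose gradient is Lipschitz at the base point (all that the Hopf lemma needs) lives on a whole
  neighbourhood; the side \<open>\<sigma>\<close> on which \<open>D\<close> lies may a priori depend on the point, and no side is
  prescribed at the rim.\<close>

locale sloshing_section =
  fixes D \<Gamma> :: "(real \<times> real) set" and R \<nu> \<alpha> :: real and \<psi> :: "real \<times> real \<Rightarrow> real"
  assumes R_pos: "0 < R"
    and open_D: "open D" and bounded_D: "bounded D"
    and D_quadrant: "q \<in> D \<Longrightarrow> 0 < fst q \<and> snd q < 0"
    and cont: "continuous_on (closure D) \<psi>"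
    and pos: "q \<in> D \<Longrightarrow> 0 < \<psi> q"
    and C2: "C2_on D \<psi>"
    and PDE: "(r, y) \<in> D \<Longrightarrow>
      d_r (d_r \<psi>) (r, y) + 1 / r * d_r \<psi> (r, y) + d_y (d_y \<psi>) (r, y) - 1 / r\<^sup>2 * \<psi> (r, y) = 0"
    and free: "0 < r \<Longrightarrow> r < R \<Longrightarrow>
      ((\<lambda>s. \<psi> (r, s)) has_real_derivative \<nu> * \<psi> (r, 0)) (at_left 0)"
    and wall: "p \<in> \<Gamma> \<Longrightarrow> outward_normal D p n \<Longrightarrow>
      ((\<lambda>t. \<psi> (p + t *\<^sub>R n)) has_real_derivative 0) (at_left 0)"
    and wall_closure: "p \<in> \<Gamma> \<Longrightarrow> p \<in> closure D \<and> p \<notin> D \<and> 0 < fst p"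
    and wall_free: "0 \<le> r \<Longrightarrow> r < R \<Longrightarrow> (r, 0) \<notin> \<Gamma>"
    and closure_cases: "q \<in> closure D \<Longrightarrow>
      q \<in> D \<or> fst q = 0 \<and> \<psi> q = 0 \<or> (\<exists>r. 0 < r \<and> r < R \<and> q = (r, 0)) \<or> q \<in> \<Gamma>"
    and rim: "(R, 0) \<in> \<Gamma>"
    and free_local: "0 < r \<Longrightarrow> r < R \<Longrightarrow> \<exists>\<delta>>0. \<forall>q\<in>ball (r, 0) \<delta>. snd q < 0 \<longrightarrow> q \<in> D"
    and chart: "p \<in> \<Gamma> \<Longrightarrow> \<exists>N h G C. gradient_Lipschitz_at p N h G C \<and>
      (\<forall>q\<in>N \<inter> \<Gamma>. h q = 0 \<and> G q \<noteq> 0 \<and>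
        (q \<noteq> (R, 0) \<longrightarrow> (\<exists>\<sigma>\<in>{-1, 1}. \<exists>\<delta>>0. \<forall>x\<in>ball q \<delta>. x \<in> D \<longleftrightarrow> \<sigma> * h x < 0)))"
    and angle: "has_interior_angle D (R, 0) \<alpha>" "pi / 2 < \<alpha>" "\<alpha> < pi"
begin

section \<open>Maximum principle and Hopf lemma away from the rim\<close>

lemma nonneg: "q \<in> closure D \<Longrightarrow> 0 \<le> \<psi> q"
  by (rule continuous_ge_on_closure[OF cont]) (auto intro: less_imp_le pos)

lemma compact_closure: "compact (closure D)"
  using bounded_D by (simp add: compact_closure)

text \<open>At the maximum both pure second derivatives of the sum are at most 0 and the radial
  derivatives cancel; the equation for \<psi> turns this into the bound. As \<psi> > 0, a barrier
  with \<open>L \<ge> 0\<close> admits no interior maximum.\<close>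

lemma interior_max_laplacian:
  assumes q: "q \<in> D" and jet: "axial_jet E g L q"
    and max: "\<forall>\<^sub>F x in nhds q. \<psi> x + E x \<le> \<psi> q + E q"
  shows "L \<le> - \<psi> q / (fst q)\<^sup>2"
proof -
  obtain r y where ry: "q = (r, y)" by (cases q)
  obtain Er Ey Err Eyy where E:
    "\<forall>\<^sub>F s in nhds r. ((\<lambda>s. E (s, y)) has_real_derivative Er s) (at s)"
    "(Er has_real_derivative Err) (at r)"
    "\<forall>\<^sub>F s in nhds y. ((\<lambda>s. E (r, s)) has_real_derivative Ey s) (at s)"
    "(Ey has_real_derivative Eyy) (at y)"
    "L = Err + Eyy + Er r / r"
    by (rule axial_jet_partial_derivatives[OF jet[unfolded ry]])
  have P: "(r, y) \<in> D" using q ry by simp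
  note \<psi> = C2_partial_derivatives[OF open_D C2 P]
  obtain U where U: "open U" "(r, y) \<in> U" "\<And>x. x \<in> U \<Longrightarrow> \<psi> x + E x \<le> \<psi> q + E q"
    using max unfolding eventually_nhds ry by blast
  have maxr: "\<forall>\<^sub>F s in nhds r. \<psi> (s, y) + E (s, y) \<le> \<psi> (r, y) + E (r, y)"
    using eventually_nhds_in_open_fst[OF U(1,2)] by eventually_elim (use U(3) ry in auto)
  have maxy: "\<forall>\<^sub>F s in nhds y. \<psi> (r, s) + E (r, s) \<le> \<psi> (r, y) + E (r, y)"
    using eventually_nhds_in_open_snd[OF U(1,2)] by eventually_elim (use U(3) ry in auto)
  have 1: "d_r \<psi> (r, y) + Er r = 0 \<and> d_r (d_r \<psi>) (r, y) + Err \<le> 0"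
  proof (rule local_max_second_derivative[where f = "\<lambda>s. \<psi> (s, y) + E (s, y)"
        and f' = "\<lambda>s. d_r \<psi> (s, y) + Er s"])
    show "\<forall>\<^sub>F s in nhds r. ((\<lambda>s. \<psi> (s, y) + E (s, y)) has_real_derivative d_r \<psi> (s, y) + Er s) (at s)"
      using \<psi>(1) E(1) by eventually_elim (rule DERIV_add)
  qed (use \<psi> E maxr in \<open>auto intro: DERIV_add\<close>)
  have 2: "d_y \<psi> (r, y) + Ey y = 0 \<and> d_y (d_y \<psi>) (r, y) + Eyy \<le> 0"
  proof (rule local_max_second_derivative[where f = "\<lambda>s. \<psi> (r, s) + E (r, s)"
        and f' = "\<lambda>s. d_y \<psi> (r, s) + Ey s"])
    show "\<forall>\<^sub>F s in nhds y. ((\<lambda>s. \<psi> (r, s) + E (r, s)) has_real_derivative d_y \<psi> (r, s) + Ey s) (at s)"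
      using \<psi>(3) E(3) by eventually_elim (rule DERIV_add)
  qed (use \<psi> E maxy in \<open>auto intro: DERIV_add\<close>)
  have "Er r = - d_r \<psi> (r, y)" using 1 by linarith
  then have "L = Err + Eyy - d_r \<psi> (r, y) / r" using E(5) by simp
  moreover have "d_r (d_r \<psi>) (r, y) + d_r \<psi> (r, y) / r + d_y (d_y \<psi>) (r, y) = \<psi> (r, y) / r\<^sup>2"
    using PDE[OF P] by simp
  ultimately have "L \<le> - (\<psi> (r, y) / r\<^sup>2)"
    using 1 2 by linarith
  then show ?thesis
    using ry by simp
qed

lemma not_interior_max:
  assumes "q \<in> D"
  shows "\<exists>p\<in>D. \<psi> q < \<psi> p"
proof (rule ccontr)
  assume "\<not> ?thesis"
  then have "\<forall>\<^sub>F x in nhds q. \<psi> x + 0 \<le> \<psi> q + 0"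
    unfolding eventually_nhds using open_D assms by (intro exI[of _ D]) (auto simp: not_less)
  from interior_max_laplacian[OF assms axial_jet_const this] show False
    using pos[OF assms] D_quadrant[OF assms] by (simp add: field_simps)
qed

text \<open>The Neumann condition removes \<psi> from the first-order test along the inward normal
  segment, so the test concerns the barrier alone.\<close>

lemma wall_max_normal_derivative:
  assumes p: "p \<in> \<Gamma>" and n: "outward_normal D p n"
    and E: "(E has_derivative (\<lambda>v. g \<bullet> v)) (at p)"
    and max: "\<forall>\<^sub>F x in at p. x \<in> D \<longrightarrow> \<psi> x + E x \<le> \<psi> p + E p"
  shows "0 \<le> g \<bullet> n"
proof -
  have n1: "norm n = 1" using n by (simp add: outward_normal_def)
  have "((\<lambda>t. E (p + t *\<^sub>R n)) has_derivative (\<lambda>t. g \<bullet> (t *\<^sub>R n))) (at 0)"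
    by (rule has_derivative_compose[where g = E and f = "\<lambda>t. p + t *\<^sub>R n" and f' = "\<lambda>t. t *\<^sub>R n"])
      (auto intro!: derivative_eq_intros E)
  then have "((\<lambda>t. E (p + t *\<^sub>R n)) has_real_derivative g \<bullet> n) (at 0)"
    unfolding has_field_derivative_def by (simp add: mult.commute[of _ "g \<bullet> n"])
  then have "((\<lambda>t. E (p + t *\<^sub>R n)) has_real_derivative g \<bullet> n) (at_left 0)"
    by (rule has_field_derivative_at_within)
  from DERIV_add[OF wall[OF p n] this]
  have D: "((\<lambda>t. \<psi> (p + t *\<^sub>R n) + E (p + t *\<^sub>R n)) has_real_derivative g \<bullet> n) (at_left 0)"
    by simp
  \<comment> \<open>On the inward normal segment (q - p) . n = - |q - p|, so any cone constant below
    1 would serve.\<close>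
  obtain d where d: "d > 0" "\<And>q. q \<in> ball p d \<Longrightarrow> (q - p) \<bullet> n < - (1 / 2) * norm (q - p) \<Longrightarrow> q \<in> D"
    using n unfolding outward_normal_def by (meson half_gt_zero zero_less_one)
  obtain d' where d': "d' > 0" "\<And>x. x \<noteq> p \<Longrightarrow> dist x p < d' \<Longrightarrow> x \<in> D \<Longrightarrow> \<psi> x + E x \<le> \<psi> p + E p"
    using max unfolding eventually_at by auto
  show ?thesis
  proof (rule left_local_max_derivative_nonneg[OF D])
    show "\<forall>\<^sub>F t in at_left 0. \<psi> (p + t *\<^sub>R n) + E (p + t *\<^sub>R n) \<le> \<psi> (p + 0 *\<^sub>R n) + E (p + 0 *\<^sub>R n)"
      unfolding eventually_at
    proof (intro exI[of _ "min d d'"] conjI ballI impI)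
      show "min d d' > 0" using d d' by simp
      fix t :: real assume t: "t \<in> {..<0}" "t \<noteq> 0 \<and> dist t 0 < min d d'"
      have "p + t *\<^sub>R n \<in> D"
      proof (rule d(2))
        show "p + t *\<^sub>R n \<in> ball p d" using t n1 by (simp add: dist_norm)
        show "(p + t *\<^sub>R n - p) \<bullet> n < - (1 / 2) * norm (p + t *\<^sub>R n - p)"
          using t n1 by (simp add: dot_square_norm)
      qed
      moreover have "p + t *\<^sub>R n \<noteq> p" "dist (p + t *\<^sub>R n) p < d'"
        using t n1 by (auto simp: dist_norm)
      ultimately show "\<psi> (p + t *\<^sub>R n) + E (p + t *\<^sub>R n) \<le> \<psi> (p + 0 *\<^sub>R n) + E (p + 0 *\<^sub>R n)"
        using d'(2) by simp
    qed
  qed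
qed

text \<open>Multiplying the chart by its side \<sigma> puts \<open>D\<close> on the negative side
  and keeps the Lipschitz constant.\<close>

lemma wall_normal_and_ball:
  assumes p: "p \<in> \<Gamma>" "p \<noteq> (R, 0)"
  obtains n \<rho>\<^sub>0 where "outward_normal D p n" "\<rho>\<^sub>0 > 0"
    "\<And>\<rho>. 0 < \<rho> \<Longrightarrow> \<rho> < \<rho>\<^sub>0 \<Longrightarrow> ball (p - \<rho> *\<^sub>R n) \<rho> \<subseteq> D"
proof -
  obtain N h G C where c: "gradient_Lipschitz_at p N h G C"
    and hG: "h p = 0" "G p \<noteq> 0" "\<exists>\<sigma>\<in>{-1, 1}. \<exists>\<delta>>0. \<forall>x\<in>ball p \<delta>. x \<in> D \<longleftrightarrow> \<sigma> * h x < 0"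
    using chart[OF p(1)] p unfolding gradient_Lipschitz_at_def by blast
  then obtain \<sigma> \<delta> where \<sigma>: "\<sigma> = -1 \<or> \<sigma> = (1::real)" and \<delta>: "\<delta> > 0" "\<And>x. x \<in> ball p \<delta> \<Longrightarrow> x \<in> D \<longleftrightarrow> \<sigma> * h x < 0"
    by blast
  have c': "gradient_Lipschitz_at p N (\<lambda>x. \<sigma> * h x) (\<lambda>x. \<sigma> *\<^sub>R G x) C"
  proof -
    have "((\<lambda>x. \<sigma> * h x) has_derivative (\<lambda>v. (\<sigma> *\<^sub>R G q) \<bullet> v)) (at q)" if "q \<in> N" for q
      unfolding inner_scaleR_left
      using c that by (intro has_derivative_mult_right) (simp add: gradient_Lipschitz_at_def)
    moreover have "norm (\<sigma> *\<^sub>R G q - \<sigma> *\<^sub>R G p) = norm (G q - G p)" for q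
      using \<sigma> by (auto simp flip: scaleR_diff_right)
    ultimately show ?thesis
      using c by (simp add: gradient_Lipschitz_at_def)
  qed
  have d: "((\<lambda>x. \<sigma> * h x) has_derivative (\<lambda>v. (\<sigma> *\<^sub>R G p) \<bullet> v)) (at p)"
    using c' unfolding gradient_Lipschitz_at_def by blast
  have z: "\<sigma> * h p = 0" "\<sigma> *\<^sub>R G p \<noteq> 0" using hG \<sigma> by auto
  let ?n = "(\<sigma> *\<^sub>R G p) /\<^sub>R norm (\<sigma> *\<^sub>R G p)"
  have n: "outward_normal D p ?n"
    by (rule outward_normal_sublevel[OF d z \<delta>])
  obtain \<rho>\<^sub>0 where \<rho>\<^sub>0: "0 < \<rho>\<^sub>0" "\<And>\<rho>. 0 < \<rho> \<Longrightarrow> \<rho> < \<rho>\<^sub>0 \<Longrightarrow> ball (p - \<rho> *\<^sub>R ?n) \<rho> \<subseteq> D"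
    using interior_ball_sublevel[OF c' z \<delta>] by blast
  show ?thesis
    by (rule that[OF n \<rho>\<^sub>0])
qed

text \<open>On an interior ball the paraboloid \<open>E\<close> is a Hopf barrier: the strictly negative right-hand side
  \<open>- \<psi> / r\<^sup>2\<close> in \<open>interior_max_laplacian\<close> makes the usual annulus unnecessary.\<close>

lemma wall_not_max:
  assumes p: "p \<in> \<Gamma>" "p \<noteq> (R, 0)"
  shows "\<exists>q\<in>closure D. \<psi> p < \<psi> q"
proof (rule ccontr)
  assume "\<not> ?thesis"
  then have M: "\<And>q. q \<in> closure D \<Longrightarrow> \<psi> q \<le> \<psi> p" by force
  obtain n \<rho>\<^sub>0 where n: "outward_normal D p n" and \<rho>\<^sub>0: "\<rho>\<^sub>0 > 0"
    "\<And>\<rho>. 0 < \<rho> \<Longrightarrow> \<rho> < \<rho>\<^sub>0 \<Longrightarrow> ball (p - \<rho> *\<^sub>R n) \<rho> \<subseteq> D"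
    using wall_normal_and_ball[OF p] by metis
  have n1: "norm n = 1" using n by (simp add: outward_normal_def)
  have pcl: "p \<in> closure D" and rp: "0 < fst p"
    using wall_closure[OF p(1)] by auto
  have Mpos: "0 < \<psi> p"
  proof -
    have "D \<noteq> {}" using pcl by auto
    then obtain q where "q \<in> D" by auto
    then show ?thesis using pos[of q] M[of q] closure_subset by fastforce
  qed
  obtain \<delta> where \<delta>: "\<delta> > 0" "\<And>q. q \<in> closure D \<Longrightarrow> dist q p < \<delta> \<Longrightarrow> \<psi> p / 2 < \<psi> q"
  proof -
    have "\<exists>d>0. \<forall>q\<in>closure D. dist q p < d \<longrightarrow> dist (\<psi> q) (\<psi> p) < \<psi> p / 2"
      using cont pcl Mpos half_gt_zero unfolding continuous_on_iff by blast
    then obtain d where d: "d > 0" "\<And>q. q \<in> closure D \<Longrightarrow> dist q p < d \<Longrightarrow> dist (\<psi> q) (\<psi> p) < \<psi> p / 2"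
      by blast
    have "\<psi> p / 2 < \<psi> q" if "q \<in> closure D" "dist q p < d" for q
    proof -
      have "\<bar>\<psi> q - \<psi> p\<bar> < \<psi> p / 2"
        using d(2)[OF that] by (simp add: dist_real_def)
      then show ?thesis by arith
    qed
    then show ?thesis
      using that d(1) by blast
  qed
  \<comment> \<open>On the ball \<psi> must exceed half of its value at \<open>p\<close>, and the
    radius coordinate must stay comparable to \<open>fst p\<close>.\<close>
  define \<rho> where "\<rho> = min (\<rho>\<^sub>0 / 2) (min (\<delta> / 4) (fst p / 8))"
  have \<rho>: "0 < \<rho>" "\<rho> < \<rho>\<^sub>0" "2 * \<rho> < \<delta>" "8 * \<rho> \<le> fst p"
    using \<rho>\<^sub>0 \<delta> rp by (auto simp: \<rho>_def)
  define c where "c = p - \<rho> *\<^sub>R n"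
  have ball: "ball c \<rho> \<subseteq> D" using \<rho>\<^sub>0(2) \<rho> by (simp add: c_def)
  then have cball: "cball c \<rho> \<subseteq> closure D"
    using closure_mono[OF ball] \<rho> by simp
  \<comment> \<open>The factor 80 is 5 for the axial Laplacian of the paraboloid divided by
    \<epsilon>, 2 for \<psi> > \<psi> p / 2, and 8 for r^2 < 8 (fst p)^2.\<close>
  define \<epsilon> where "\<epsilon> = \<psi> p / (80 * (fst p)\<^sup>2)"
  have \<epsilon>: "0 < \<epsilon>" using Mpos rp by (simp add: \<epsilon>_def)
  \<comment> \<open>Written through products of linear functions so that the jet rules apply; it
    equals \<epsilon> (\<rho>^2 - |q - c|^2).\<close>
  define E where "E q = \<epsilon> * \<rho>\<^sup>2 + (- \<epsilon>) *
      (((1, 0) \<bullet> (q - c)) * ((1, 0) \<bullet> (q - c)) + ((0, 1) \<bullet> (q - c)) * ((0, 1) \<bullet> (q - c)))" for q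
  define g where "g q = - (2 * \<epsilon>) *\<^sub>R (q - c)" for q
  define L where "L q = - \<epsilon> * (4 + 2 * fst (q - c) / fst q)" for q
  have E: "E q = \<epsilon> * (\<rho>\<^sup>2 - (norm (q - c))\<^sup>2)" for q
    unfolding E_def power2_norm_eq_inner by (cases "q - c") (simp add: algebra_simps)
  have jet: "axial_jet E (g q) (L q) q" for q
    unfolding E_def
  proof (rule axial_jet_eqI[OF axial_jet_add[OF axial_jet_const axial_jet_cmult[OF axial_jet_add[OF
      axial_jet_mult[OF axial_jet_linear axial_jet_linear] axial_jet_mult[OF axial_jet_linear axial_jet_linear]]]]])
  qed (cases "q - c"; simp add: g_def L_def algebra_simps)+
  have near: "fst p / 2 < fst q \<and> fst q < 2 * fst p \<and> dist q p < \<delta>" if "q \<in> cball c \<rho>" for q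
  proof -
    have "dist q p \<le> dist c q + dist c p"
      by (metis dist_commute dist_triangle)
    also have "\<dots> \<le> 2 * \<rho>"
      using that n1 \<rho> by (simp add: c_def dist_norm)
    finally have "dist q p \<le> 2 * \<rho>" .
    moreover have "\<bar>fst q - fst p\<bar> \<le> dist q p"
      using dist_fst_le[of q p] by (simp add: dist_real_def)
    ultimately show ?thesis using \<rho> rp by arith
  qed
  have le: "\<psi> q + E q \<le> \<psi> p" if "q \<in> cball c \<rho>" for q
  proof -
    have "continuous_on (cball c \<rho>) (\<lambda>q. \<psi> q + E q)"
      unfolding E by (intro continuous_intros continuous_on_subset[OF cont cball])
    then obtain q' where q': "q' \<in> cball c \<rho>" "\<And>q. q \<in> cball c \<rho> \<Longrightarrow> \<psi> q + E q \<le> \<psi> q' + E q'"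
      using continuous_attains_sup[of "cball c \<rho>" "\<lambda>q. \<psi> q + E q"] \<rho> by auto
    \<comment> \<open>An interior maximum would give 5 \<epsilon> \<ge> \<psi> / r^2, against the
      choice of \<epsilon>; on the circle E vanishes.\<close>
    have "dist c q' = \<rho>"
    proof (rule ccontr)
      assume "dist c q' \<noteq> \<rho>"
      then have b: "q' \<in> ball c \<rho>" using q'(1) by simp
      then have "\<forall>\<^sub>F x in nhds q'. \<psi> x + E x \<le> \<psi> q' + E q'"
        unfolding eventually_nhds using q'(2) by (intro exI[of _ "ball c \<rho>"]) auto
      then have "L q' \<le> - \<psi> q' / (fst q')\<^sup>2"
        using b ball by (intro interior_max_laplacian[OF _ jet]) auto
      moreover have "- \<epsilon> * 5 \<le> L q'"
      proof -
        have "fst (q' - c) \<le> \<rho>"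
          using b dist_fst_le[of q' c] by (simp add: dist_real_def dist_commute)
        then have "2 * fst (q' - c) \<le> fst q'"
          using near[OF q'(1)] \<rho> by linarith
        then have "2 * fst (q' - c) / fst q' \<le> 1"
          using near[OF q'(1)] rp by simp
        then have "\<epsilon> * (4 + 2 * fst (q' - c) / fst q') \<le> \<epsilon> * 5"
          using \<epsilon> by (intro mult_left_mono) auto
        then show ?thesis by (simp add: L_def)
      qed
      moreover have "\<epsilon> * 5 < \<psi> q' / (fst q')\<^sup>2"
      proof -
        have "\<epsilon> * 5 = \<psi> p / 2 / (8 * (fst p)\<^sup>2)" by (simp add: \<epsilon>_def)
        also have "\<dots> < \<psi> p / 2 / (fst q')\<^sup>2"
        proof (rule divide_strict_left_mono)
          have "(fst q')\<^sup>2 < (2 * fst p)\<^sup>2"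
            using near[OF q'(1)] rp by (intro power_strict_mono) auto
          also have "\<dots> \<le> 8 * (fst p)\<^sup>2" by (simp add: power2_eq_square)
          finally show "(fst q')\<^sup>2 < 8 * (fst p)\<^sup>2" .
        qed (use near[OF q'(1)] rp Mpos in auto)
        also have "\<dots> < \<psi> q' / (fst q')\<^sup>2"
          using \<delta>(2)[of q'] near[OF q'(1)] cball q'(1) rp by (intro divide_strict_right_mono) auto
        finally show ?thesis .
      qed
      ultimately show False by simp
    qed
    then have "E q' = 0" by (simp add: E dist_norm norm_minus_commute)
    then show ?thesis
      using q'(2)[OF that] M[of q'] q'(1) cball by force
  qed
  have Ep: "E p = 0" using n1 \<rho> by (simp add: E c_def)
  have "0 \<le> g p \<bullet> n"
  proof (rule wall_max_normal_derivative[OF p(1) n axial_jet_derivative[OF jet]])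
    \<comment> \<open>The ball does not fill \<open>D\<close> near \<open>p\<close>; outside it E
      \<le> 0 and \<psi> \<le> \<psi> p suffice.\<close>
    show "\<forall>\<^sub>F x in at p. x \<in> D \<longrightarrow> \<psi> x + E x \<le> \<psi> p + E p"
    proof (intro always_eventually allI impI)
      fix x assume x: "x \<in> D"
      show "\<psi> x + E x \<le> \<psi> p + E p"
      proof (cases "x \<in> cball c \<rho>")
        case True
        then show ?thesis using le Ep by simp
      next
        case False
        then have "\<rho>\<^sup>2 \<le> (norm (x - c))\<^sup>2"
          using \<rho> by (intro power_mono) (auto simp: dist_norm norm_minus_commute)
        then have "E x \<le> 0" using \<epsilon> by (simp add: E mult_le_0_iff)
        then show ?thesis using M[of x] x closure_subset Ep by force
      qed
    qed
  qed
  moreover have "g p \<bullet> n = - (2 * \<epsilon> * \<rho>)"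
    using n1 by (simp add: g_def c_def dot_square_norm)
  moreover have "0 < \<epsilon> * \<rho>" using \<epsilon> \<rho> by simp
  ultimately show False by linarith
qed

section \<open>Geometry of the section at the rim\<close>

text \<open>The ray of the wall at the rim has direction \<open>\<pi> + \<alpha>\<close>, since the free surface has direction
  \<open>\<pi>\<close> and \<open>D\<close> lies below it.\<close>

definition rim_normal :: "real \<times> real" where "rim_normal = (sin \<alpha>, - cos \<alpha>)"
definition rim_tangent :: "real \<times> real" where "rim_tangent = (- cos \<alpha>, - sin \<alpha>)"

lemma sin_angle: "0 < sin \<alpha>" "sin \<alpha> < 1" and cos_angle: "cos \<alpha> < 0" "- 1 < cos \<alpha>"
proof -
  show s: "0 < sin \<alpha>" using angle(2,3) pi_gt_zero by (intro sin_gt_zero) linarith+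
  have "0 < sin (\<alpha> - pi / 2)" using angle(2,3) pi_gt_zero by (intro sin_gt_zero) linarith+
  then show c: "cos \<alpha> < 0" by (simp add: sin_diff)
  have "(sin \<alpha>)\<^sup>2 < 1\<^sup>2" "(cos \<alpha>)\<^sup>2 < 1\<^sup>2"
    using s c sin_cos_squared_add[of \<alpha>] by (smt (verit) one_power2 zero_less_power2)+
  then show "sin \<alpha> < 1" "- 1 < cos \<alpha>"
    using abs_le_square_iff[of 1 "sin \<alpha>"] abs_le_square_iff[of 1 "cos \<alpha>"] s c by auto
qed

lemma rim_frame: "norm rim_normal = 1" "norm rim_tangent = 1" "rim_normal \<bullet> rim_tangent = 0"
  by (simp_all add: rim_normal_def rim_tangent_def norm_Pair)

lemma rim_frame_expand: "v = (v \<bullet> rim_tangent) *\<^sub>R rim_tangent + (v \<bullet> rim_normal) *\<^sub>R rim_normal"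
proof -
  obtain a b where v: "v = (a, b)" by (cases v)
  have 1: "c * (cos \<alpha> * cos \<alpha>) + c * (sin \<alpha> * sin \<alpha>) = c" for c
    by (metis distrib_left mult.right_neutral power2_eq_square sin_cos_squared_add2)
  show ?thesis
    unfolding v rim_normal_def rim_tangent_def by (simp add: algebra_simps 1)
qed

text \<open>The starting direction \<open>\<beta>\<close> of the sector is not given; it is \<open>\<pi>\<close> modulo \<open>2 \<pi>\<close> because \<open>D\<close>
  lies in \<open>y < 0\<close> and contains the points just below the free surface.\<close>

lemma interior_angle_start:
  "\<forall>\<epsilon>>0. \<exists>\<delta>>0. \<forall>\<rho> t. 0 < \<rho> \<and> \<rho> < \<delta> \<longrightarrow>
     (pi + \<epsilon> < t \<and> t < pi + \<alpha> - \<epsilon> \<longrightarrow> (R, 0) + \<rho> *\<^sub>R (cos t, sin t) \<in> D) \<and>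
     (pi + \<alpha> + \<epsilon> < t \<and> t < pi + 2 * pi - \<epsilon> \<longrightarrow> (R, 0) + \<rho> *\<^sub>R (cos t, sin t) \<notin> D)"
proof -
  define P where "P \<beta> \<longleftrightarrow> (\<forall>\<epsilon>>0. \<exists>\<delta>>0. \<forall>\<rho> t. 0 < \<rho> \<and> \<rho> < \<delta> \<longrightarrow>
     (\<beta> + \<epsilon> < t \<and> t < \<beta> + \<alpha> - \<epsilon> \<longrightarrow> (R, 0) + \<rho> *\<^sub>R (cos t, sin t) \<in> D) \<and>
     (\<beta> + \<alpha> + \<epsilon> < t \<and> t < \<beta> + 2 * pi - \<epsilon> \<longrightarrow> (R, 0) + \<rho> *\<^sub>R (cos t, sin t) \<notin> D))" for \<beta>
  obtain \<beta>\<^sub>0 where \<beta>\<^sub>0: "P \<beta>\<^sub>0"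
    using angle(1) unfolding has_interior_angle_def P_def by blast
  \<comment> \<open>Shifts the starting direction into the interval from pi to 3 pi.\<close>
  define m where "m = \<lfloor>(\<beta>\<^sub>0 - pi) / (2 * pi)\<rfloor>"
  define \<beta> where "\<beta> = \<beta>\<^sub>0 - 2 * pi * m"
  have range: "pi \<le> \<beta>" "\<beta> < 3 * pi"
  proof -
    have "m \<le> (\<beta>\<^sub>0 - pi) / (2 * pi)" "(\<beta>\<^sub>0 - pi) / (2 * pi) < m + 1"
      unfolding m_def by linarith+
    then show "pi \<le> \<beta>" "\<beta> < 3 * pi"
      using pi_gt_zero by (simp_all add: \<beta>_def field_simps)
  qed
  have per: "cos (t + 2 * pi * m) = cos t" "sin (t + 2 * pi * m) = sin t" for t
    using sin_int_2pin[of m] cos_int_2pin[of m] by (simp_all add: cos_add sin_add)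
  have P: "P \<beta>"
    unfolding P_def
  proof (intro allI impI)
    fix \<epsilon> :: real assume "\<epsilon> > 0"
    then obtain \<delta> where \<delta>: "\<delta> > 0" and D: "\<And>\<rho> t. 0 < \<rho> \<Longrightarrow> \<rho> < \<delta> \<Longrightarrow>
      (\<beta>\<^sub>0 + \<epsilon> < t \<and> t < \<beta>\<^sub>0 + \<alpha> - \<epsilon> \<longrightarrow> (R, 0) + \<rho> *\<^sub>R (cos t, sin t) \<in> D) \<and>
      (\<beta>\<^sub>0 + \<alpha> + \<epsilon> < t \<and> t < \<beta>\<^sub>0 + 2 * pi - \<epsilon> \<longrightarrow> (R, 0) + \<rho> *\<^sub>R (cos t, sin t) \<notin> D)"
      using \<beta>\<^sub>0[unfolded P_def, THEN spec, THEN mp, OF \<open>\<epsilon> > 0\<close>] by blast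
    show "\<exists>\<delta>>0. \<forall>\<rho> t. 0 < \<rho> \<and> \<rho> < \<delta> \<longrightarrow>
     (\<beta> + \<epsilon> < t \<and> t < \<beta> + \<alpha> - \<epsilon> \<longrightarrow> (R, 0) + \<rho> *\<^sub>R (cos t, sin t) \<in> D) \<and>
     (\<beta> + \<alpha> + \<epsilon> < t \<and> t < \<beta> + 2 * pi - \<epsilon> \<longrightarrow> (R, 0) + \<rho> *\<^sub>R (cos t, sin t) \<notin> D)"
    proof (intro exI[of _ \<delta>] conjI \<delta> allI impI; elim conjE)
      fix \<rho> t :: real
      assume \<rho>: "0 < \<rho>" "\<rho> < \<delta>"
      note D' = D[OF \<rho>, of "t + 2 * pi * m", unfolded per]
      show "(R, 0) + \<rho> *\<^sub>R (cos t, sin t) \<in> D" if "\<beta> + \<epsilon> < t" "t < \<beta> + \<alpha> - \<epsilon>"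
        using D' that unfolding \<beta>_def by linarith
      show "(R, 0) + \<rho> *\<^sub>R (cos t, sin t) \<notin> D" if "\<beta> + \<alpha> + \<epsilon> < t" "t < \<beta> + 2 * pi - \<epsilon>"
        using D' that unfolding \<beta>_def by linarith
    qed
  qed
  have "\<beta> = pi"
  proof (rule ccontr)
    assume "\<beta> \<noteq> pi"
    then have gt: "pi < \<beta>" using range by simp
    show False
    proof (cases "\<beta> < 2 * pi")
      case True
      define \<epsilon> where "\<epsilon> = min (2 * pi - \<beta>) (\<beta> - pi) / 4"
      have \<epsilon>: "0 < \<epsilon>" "\<beta> + \<epsilon> < 2 * pi" "pi + 2 * \<epsilon> < \<beta>"
        using True gt by (auto simp: \<epsilon>_def min_def field_simps)
      then obtain \<delta> where \<delta>: "\<delta> > 0" and D: "\<And>\<rho> t. 0 < \<rho> \<Longrightarrow> \<rho> < \<delta> \<Longrightarrow>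
          \<beta> + \<alpha> + \<epsilon> < t \<Longrightarrow> t < \<beta> + 2 * pi - \<epsilon> \<Longrightarrow> (R, 0) + \<rho> *\<^sub>R (cos t, sin t) \<notin> D"
        using P[unfolded P_def, THEN spec, THEN mp, OF \<epsilon>(1)] by blast
      define \<rho> where "\<rho> = min \<delta> R / 2"
      have \<rho>: "0 < \<rho>" "\<rho> < \<delta>" "\<rho> < R" using \<delta> R_pos by (auto simp: \<rho>_def)
      obtain d where d: "d > 0" "\<And>q. q \<in> ball (R - \<rho>, 0) d \<Longrightarrow> snd q < 0 \<Longrightarrow> q \<in> D"
        using free_local[of "R - \<rho>"] \<rho> by auto
      \<comment> \<open>The direction 3 pi + \<tau> points just below the free surface, hence into
        \<open>D\<close>, but lies in the range that a start \<beta> strictly between pi and 2 pi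
        excludes.\<close>
      define f where "f \<tau> = (R, 0) + \<rho> *\<^sub>R (cos (3 * pi + \<tau>), sin (3 * pi + \<tau>))" for \<tau>
      have f: "f \<tau> = (R - \<rho> * cos \<tau>, - \<rho> * sin \<tau>)" for \<tau>
        by (simp add: f_def cos_add sin_add)
      have "isCont f 0" unfolding f[abs_def] by (intro continuous_intros)
      then have "f \<midarrow>0\<rightarrow> f 0" by (simp add: isCont_def)
      then have "\<forall>\<^sub>F \<tau> in at 0. dist (f \<tau>) (f 0) < d"
        using d(1) by (rule tendstoD)
      then obtain \<tau>\<^sub>0 where \<tau>\<^sub>0: "\<tau>\<^sub>0 > 0" "\<And>\<tau>. \<tau> \<noteq> 0 \<Longrightarrow> dist \<tau> 0 < \<tau>\<^sub>0 \<Longrightarrow> dist (f \<tau>) (f 0) < d"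
        unfolding eventually_at by auto
      define \<tau> where "\<tau> = min (min \<tau>\<^sub>0 \<epsilon>) pi / 4"
      have "min (min \<tau>\<^sub>0 \<epsilon>) pi > 0" using \<tau>\<^sub>0 \<epsilon> by simp
      then have \<tau>: "0 < \<tau>" "\<tau> < \<tau>\<^sub>0" "\<tau> < \<epsilon>" "\<tau> < pi" unfolding \<tau>_def by linarith+
      have "f \<tau> \<in> D"
      proof (rule d(2))
        show "f \<tau> \<in> ball (R - \<rho>, 0) d"
          using \<tau>\<^sub>0(2)[of \<tau>] \<tau> f[of 0] by (simp add: dist_commute)
        show "snd (f \<tau>) < 0"
          using \<rho> \<tau> sin_gt_zero[of \<tau>] by (simp add: f)
      qed
      moreover have "f \<tau> \<notin> D"
        unfolding f_def using \<tau> \<epsilon> angle(3) by (intro D \<rho>) linarith+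
      ultimately show False by simp
    next
      case False
      define \<epsilon> where "\<epsilon> = min (3 * pi - \<beta>) \<alpha> / 4"
      have "0 < 3 * pi - \<beta>" "0 < \<alpha>" using range angle(2) pi_gt_zero by linarith+
      then have \<epsilon>: "0 < \<epsilon>" "2 * \<epsilon> < 3 * pi - \<beta>" "3 * \<epsilon> < \<alpha>"
        by (auto simp: \<epsilon>_def min_def field_simps)
      then obtain \<delta> where \<delta>: "\<delta> > 0" and D: "\<And>\<rho> t. 0 < \<rho> \<Longrightarrow> \<rho> < \<delta> \<Longrightarrow>
          \<beta> + \<epsilon> < t \<Longrightarrow> t < \<beta> + \<alpha> - \<epsilon> \<Longrightarrow> (R, 0) + \<rho> *\<^sub>R (cos t, sin t) \<in> D"
        using P[unfolded P_def, THEN spec, THEN mp, OF \<epsilon>(1)] by blast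
      \<comment> \<open>For \<beta> \<ge> 2 pi this direction belongs to the sector and yet points
        into y > 0.\<close>
      have "(R, 0) + (\<delta> / 2) *\<^sub>R (cos (\<beta> + 2 * \<epsilon>), sin (\<beta> + 2 * \<epsilon>)) \<in> D"
        using \<epsilon> \<delta> by (intro D) linarith+
      then have "\<delta> / 2 * sin (\<beta> + 2 * \<epsilon>) < 0"
        using D_quadrant by fastforce
      moreover have "0 < sin (\<beta> + 2 * \<epsilon> - 2 * pi)"
        using False \<epsilon> by (intro sin_gt_zero) linarith+
      ultimately show False using \<delta> by (simp add: mult_less_0_iff sin_diff)
    qed
  qed
  then show ?thesis using P unfolding P_def by simp
qed

text \<open>In polar coordinates with length \<rho> and angle t, the height is \<rho> sin t and the
  component along \<open>rim_normal\<close> is - \<rho> sin (t - \<alpha>). Since sin x \<le> x, the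
  threshold \<open>c\<close> for sines also serves as the angular tolerance.\<close>

lemma rim_sector:
  assumes c: "0 < c" "c < 1"
  shows "\<exists>\<delta>>0. \<forall>v. v \<noteq> 0 \<longrightarrow> norm v < \<delta> \<longrightarrow> snd v < - c * norm v \<longrightarrow>
    (v \<bullet> rim_normal < - c * norm v \<longrightarrow> (R, 0) + v \<in> D) \<and>
    (c * norm v < v \<bullet> rim_normal \<longrightarrow> (R, 0) + v \<notin> D)"
proof -
  obtain \<delta> where \<delta>: "\<delta> > 0" and D: "\<And>\<rho> t. 0 < \<rho> \<Longrightarrow> \<rho> < \<delta> \<Longrightarrow>
     (pi + c < t \<and> t < pi + \<alpha> - c \<longrightarrow> (R, 0) + \<rho> *\<^sub>R (cos t, sin t) \<in> D) \<and>
     (pi + \<alpha> + c < t \<and> t < pi + 2 * pi - c \<longrightarrow> (R, 0) + \<rho> *\<^sub>R (cos t, sin t) \<notin> D)"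
    using interior_angle_start[rule_format, OF c(1)] by blast
  show ?thesis
  proof (intro exI[of _ \<delta>] conjI \<delta> allI impI)
    fix v :: "real \<times> real"
    assume v: "v \<noteq> 0" "norm v < \<delta>" and sv: "snd v < - c * norm v"
    define \<rho> where "\<rho> = norm v"
    have \<rho>: "0 < \<rho>" "\<rho> < \<delta>" using v by (auto simp: \<rho>_def)
    have sq: "\<rho>\<^sup>2 = (fst v)\<^sup>2 + (snd v)\<^sup>2"
      unfolding \<rho>_def by (cases v) (simp add: norm_Pair)
    have "(fst v / \<rho>)\<^sup>2 + (snd v / \<rho>)\<^sup>2 = ((fst v)\<^sup>2 + (snd v)\<^sup>2) / \<rho>\<^sup>2"
      by (simp add: power_divide add_divide_distrib)
    also have "\<dots> = 1"
      unfolding sq[symmetric] using \<rho> by simp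
    finally have "(fst v / \<rho>)\<^sup>2 + (snd v / \<rho>)\<^sup>2 = 1" .
    then obtain t where t: "0 \<le> t" "t < 2 * pi" "fst v / \<rho> = cos t" "snd v / \<rho> = sin t"
      using sincos_total_2pi by blast
    have veq: "v = \<rho> *\<^sub>R (cos t, sin t)"
      using t(3,4) \<rho> by (cases v) (simp add: field_simps)
    have "\<rho> * sin t < \<rho> * - c"
      using sv t(4) \<rho> by (simp add: \<rho>_def[symmetric] field_simps)
    then have st: "sin t < - c" by (simp only: mult_less_cancel_left_pos[OF \<rho>(1)])
    have tpi: "pi < t"
      using st c t(1) sin_ge_zero[of t] by linarith
    have "sin (t - pi) \<le> t - pi" using tpi by (intro sin_x_le_x) simp
    then have tc: "pi + c < t" using st by (simp add: sin_diff)
    have en: "v \<bullet> rim_normal = - (\<rho> * sin (t - \<alpha>))"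
      by (subst veq) (simp add: rim_normal_def sin_diff algebra_simps)
    show "(R, 0) + v \<in> D" if "v \<bullet> rim_normal < - c * norm v"
    proof -
      have "\<rho> * c < \<rho> * sin (t - \<alpha>)"
        using that unfolding en \<rho>_def[symmetric] by (simp add: mult.commute)
      then have s: "c < sin (t - \<alpha>)" by (simp only: mult_less_cancel_left_pos[OF \<rho>(1)])
      have "t - \<alpha> < pi"
      proof (rule ccontr)
        assume "\<not> t - \<alpha> < pi"
        then have "sin (t - \<alpha>) \<le> 0"
          using t angle(2) pi_gt_zero by (intro sin_le_zero) linarith+
        then show False using s c by linarith
      qed
      then have "sin (pi - (t - \<alpha>)) \<le> pi - (t - \<alpha>)" by (intro sin_x_le_x) simp
      then have "t < pi + \<alpha> - c" using s by (simp add: sin_diff)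
      then show ?thesis
        using D[OF \<rho>] tc veq by simp
    qed
    show "(R, 0) + v \<notin> D" if "c * norm v < v \<bullet> rim_normal"
    proof -
      have "\<rho> * sin (t - \<alpha>) < \<rho> * - c"
        using that unfolding en \<rho>_def[symmetric] by (simp add: mult.commute)
      then have s: "sin (t - \<alpha>) < - c" by (simp only: mult_less_cancel_left_pos[OF \<rho>(1)])
      have gt: "pi < t - \<alpha>"
        using sin_ge_zero[of "t - \<alpha>"] s c tpi angle(3) by linarith
      then have "sin (t - \<alpha> - pi) \<le> t - \<alpha> - pi" by (intro sin_x_le_x) simp
      then have "pi + \<alpha> + c < t" using s sin_diff[of "t - \<alpha>" pi] by simp
      moreover have "t < pi + 2 * pi - c" using t(2) c pi_gt3 by linarith
      ultimately show ?thesis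
        using D[OF \<rho>] veq by simp
    qed
  qed
qed

lemma frontier_in_wall:
  assumes "x \<in> frontier D" "0 < fst x" "snd x < 0"
  shows "x \<in> \<Gamma>"
proof -
  have "x \<in> closure D" "x \<notin> D"
    using assms(1) open_D by (auto simp: frontier_def interior_open)
  then show ?thesis
    using closure_cases[of x] assms(2,3) by auto
qed

lemma closure_snd_nonpos: "q \<in> closure D \<Longrightarrow> snd q \<le> 0"
  by (rule continuous_le_on_closure[of D snd]) (auto intro!: continuous_intros less_imp_le D_quadrant[THEN conjunct2])

text \<open>A short segment across the tangent ray starts in \<open>D\<close> and ends outside, so
  it contains a wall point, where \<open>h\<close> vanishes. The Taylor formula there bounds the
  tangential component of the gradient by a multiple of the relative segment length
  \<open>b\<close>, for every small \<open>b\<close>.\<close>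

lemma rim_gradient_parallel:
  assumes h: "gradient_Lipschitz_at (R, 0) N h G C" and wall: "\<And>q. q \<in> N \<Longrightarrow> q \<in> \<Gamma> \<Longrightarrow> h q = 0"
  shows "G (R, 0) = (G (R, 0) \<bullet> rim_normal) *\<^sub>R rim_normal"
proof -
  let ?p = "(R, 0) :: real \<times> real"
  let ?G = "G ?p"
  obtain d where d: "d > 0" "ball ?p d \<subseteq> N"
    using h openE unfolding gradient_Lipschitz_at_def by meson
  have h0: "h ?p = 0"
    using wall[of ?p] rim h by (simp add: gradient_Lipschitz_at_def)
  have bound: "\<bar>?G \<bullet> rim_tangent\<bar> \<le> b * (norm ?G + 1)" if b: "0 < b" "b < sin \<alpha> / 2" for b
  proof -
    have b1: "b < 1 / 2" using b sin_angle by linarith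
    \<comment> \<open>The ends of the segment are off the ray by \<rho> b, while |v| < 2 \<rho>; the
      tolerance \<open>b / 4\<close> separates them.\<close>
    have "0 < b / 4" "b / 4 < 1" using b b1 by auto
    from rim_sector[OF this] obtain \<delta> where \<delta>: "\<delta> > 0" and S: "\<And>v. v \<noteq> 0 \<Longrightarrow> norm v < \<delta> \<Longrightarrow> snd v < - (b / 4) * norm v \<Longrightarrow>
      (v \<bullet> rim_normal < - (b / 4) * norm v \<longrightarrow> ?p + v \<in> D) \<and> (b / 4 * norm v < v \<bullet> rim_normal \<longrightarrow> ?p + v \<notin> D)"
      by blast
    \<comment> \<open>The last bound makes the Taylor remainder at most \<rho> b; the bound by
      \<open>R\<close> keeps the segment off the axis.\<close>
    define m where "m = min (min \<delta> d) (min R (b / (4 * (\<bar>C\<bar> + 1))))"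
    define \<rho> where "\<rho> = m / 4"
    have \<rho>: "0 < \<rho>" "2 * \<rho> < \<delta>" "2 * \<rho> < d" "2 * \<rho> < R" "4 * (\<bar>C\<bar> + 1) * \<rho> \<le> b"
    proof -
      have m: "0 < m" "m \<le> \<delta>" "m \<le> d" "m \<le> R" "m \<le> b / (4 * (\<bar>C\<bar> + 1))"
        using \<delta> d R_pos b by (auto simp: m_def)
      then show "0 < \<rho>" "2 * \<rho> < \<delta>" "2 * \<rho> < d" "2 * \<rho> < R"
        unfolding \<rho>_def by linarith+
      have "\<rho> \<le> b / (4 * (\<bar>C\<bar> + 1))" using m unfolding \<rho>_def by linarith
      then show "4 * (\<bar>C\<bar> + 1) * \<rho> \<le> b" by (simp add: field_simps)
    qed
    define v where "v \<tau> = \<rho> *\<^sub>R (rim_tangent + \<tau> *\<^sub>R rim_normal)" for \<tau>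
    have nv: "\<rho> \<le> norm (v \<tau>)" "norm (v \<tau>) < 2 * \<rho>" "snd (v \<tau>) < - \<rho> * (sin \<alpha> / 2)"
      "v \<tau> \<bullet> rim_normal = \<rho> * \<tau>" if \<tau>: "\<bar>\<tau>\<bar> \<le> b" for \<tau>
    proof -
      have en: "(rim_tangent + \<tau> *\<^sub>R rim_normal) \<bullet> rim_tangent = 1"
        using rim_frame by (simp add: inner_add_left dot_square_norm)
      have "1 \<le> norm (rim_tangent + \<tau> *\<^sub>R rim_normal)"
        using Cauchy_Schwarz_ineq2[of "rim_tangent + \<tau> *\<^sub>R rim_normal" rim_tangent] en rim_frame by simp
      then show "\<rho> \<le> norm (v \<tau>)" using \<rho> by (simp add: v_def)
      have "norm (rim_tangent + \<tau> *\<^sub>R rim_normal) \<le> 1 + \<bar>\<tau>\<bar>"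
        using norm_triangle_ineq[of rim_tangent "\<tau> *\<^sub>R rim_normal"] rim_frame by simp
      then show "norm (v \<tau>) < 2 * \<rho>" using \<rho> \<tau> b1 by (simp add: v_def)
      have "\<bar>\<tau> * cos \<alpha>\<bar> \<le> \<bar>\<tau>\<bar> * 1"
        unfolding abs_mult using abs_cos_le_one by (intro mult_left_mono) auto
      then have "- sin \<alpha> - \<tau> * cos \<alpha> < - (sin \<alpha> / 2)"
        using \<tau> b by linarith
      then have "\<rho> * (- sin \<alpha> - \<tau> * cos \<alpha>) < \<rho> * - (sin \<alpha> / 2)"
        using \<rho> by (simp only: mult_less_cancel_left_pos)
      then show "snd (v \<tau>) < - \<rho> * (sin \<alpha> / 2)"
        by (simp add: v_def rim_tangent_def rim_normal_def)
      show "v \<tau> \<bullet> rim_normal = \<rho> * \<tau>"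
        using rim_frame by (simp add: v_def inner_add_left inner_commute[of rim_tangent] dot_square_norm)
    qed
    have sv: "snd (v \<tau>) < - (b / 4) * norm (v \<tau>)" and vd: "norm (v \<tau>) < \<delta>" "norm (v \<tau>) < d" and v0: "v \<tau> \<noteq> 0"
      if \<tau>: "\<bar>\<tau>\<bar> \<le> b" for \<tau>
    proof -
      have "(b / 4) * norm (v \<tau>) \<le> (b / 4) * (2 * \<rho>)"
        using nv(2)[OF \<tau>] b by (intro mult_left_mono) auto
      also have "\<dots> = \<rho> * (b / 2)" by simp
      also have "\<dots> \<le> \<rho> * (sin \<alpha> / 2)" using b \<rho> sin_angle by (intro mult_left_mono) auto
      finally show "snd (v \<tau>) < - (b / 4) * norm (v \<tau>)" using nv(3)[OF \<tau>] by linarith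
      show "norm (v \<tau>) < \<delta>" "norm (v \<tau>) < d" using nv(2)[OF \<tau>] \<rho> by linarith+
      show "v \<tau> \<noteq> 0" using nv(1)[OF \<tau>] \<rho> by auto
    qed
    have mb: "\<bar>- b\<bar> \<le> b" and pb: "\<bar>b\<bar> \<le> b" using b by auto
    have b2: "b / 4 * norm (v \<tau>) < \<rho> * b" if "\<bar>\<tau>\<bar> \<le> b" for \<tau>
    proof -
      have "b / 4 * norm (v \<tau>) \<le> b / 4 * (2 * \<rho>)"
        using nv(2)[OF that] b by (intro mult_left_mono) auto
      also have "\<dots> < \<rho> * b" using b \<rho> by simp
      finally show ?thesis .
    qed
    have inD: "?p + v (- b) \<in> D"
      using S[OF v0[OF mb] vd(1)[OF mb] sv[OF mb]] nv(4)[OF mb] b2[OF mb] by simp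
    have outD: "?p + v b \<notin> D"
      using S[OF v0[OF pb] vd(1)[OF pb] sv[OF pb]] nv(4)[OF pb] b2[OF pb] by simp
    let ?I = "(\<lambda>\<tau>. ?p + v \<tau>) ` {- b..b}"
    have "connected ?I"
      unfolding v_def by (intro connected_continuous_image continuous_intros) simp
    moreover have "?I \<inter> D \<noteq> {}" using inD b by force
    moreover have "?I - D \<noteq> {}"
    proof -
      have "?p + v b \<in> ?I" using b by (intro imageI) auto
      then show ?thesis using outD by blast
    qed
    ultimately obtain \<tau> where \<tau>: "\<bar>\<tau>\<bar> \<le> b" and fr: "?p + v \<tau> \<in> frontier D"
      using connected_Int_frontier[of ?I D] by fastforce
    have "\<bar>fst (v \<tau>)\<bar> \<le> norm (v \<tau>)" 
      using norm_fst_le[of "fst (v \<tau>)" "snd (v \<tau>)"] by simp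
    then have "0 < fst (?p + v \<tau>)" using nv(2)[OF \<tau>] \<rho> by auto
    moreover have "snd (?p + v \<tau>) < 0"
    proof -
      have "0 < \<rho> * (sin \<alpha> / 2)" using \<rho> sin_angle by simp
      then show ?thesis using nv(3)[OF \<tau>] by simp
    qed
    ultimately have "?p + v \<tau> \<in> \<Gamma>" using fr by (intro frontier_in_wall)
    moreover have inball: "?p + v \<tau> \<in> ball ?p d" using vd(2)[OF \<tau>] by (simp add: dist_norm)
    ultimately have "h (?p + v \<tau>) = 0" using d wall by blast
    then have "\<bar>?G \<bullet> v \<tau>\<bar> \<le> C * (norm (v \<tau>))\<^sup>2"
      using gradient_Lipschitz_at_Taylor[OF h d(2) inball] h0 by simp
    also have "\<dots> \<le> (\<bar>C\<bar> + 1) * (2 * \<rho>)\<^sup>2"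
      using nv(2)[OF \<tau>] by (intro mult_mono power_mono) auto
    also have "\<dots> = \<rho> * (4 * (\<bar>C\<bar> + 1) * \<rho>)" by (simp add: power2_eq_square)
    also have "\<dots> \<le> \<rho> * b" using \<rho> by (intro mult_left_mono) auto
    finally have "\<rho> * \<bar>?G \<bullet> rim_tangent + \<tau> * (?G \<bullet> rim_normal)\<bar> \<le> \<rho> * b"
      using \<rho> by (simp add: v_def inner_add_right abs_mult)
    then have "\<bar>?G \<bullet> rim_tangent + \<tau> * (?G \<bullet> rim_normal)\<bar> \<le> b" using \<rho> by simp
    moreover have "\<bar>\<tau> * (?G \<bullet> rim_normal)\<bar> \<le> b * norm ?G"
      unfolding abs_mult using \<tau> Cauchy_Schwarz_ineq2[of ?G rim_normal] rim_frame
      by (intro mult_mono) auto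
    ultimately show ?thesis by (simp add: distrib_left)
  qed
  have "?G \<bullet> rim_tangent = 0"
  proof (rule ccontr)
    assume nz: "?G \<bullet> rim_tangent \<noteq> 0"
    define b where "b = min (sin \<alpha> / 4) (\<bar>?G \<bullet> rim_tangent\<bar> / (2 * (norm ?G + 1)))"
    have gp: "0 < norm ?G + 1" using norm_ge_zero[of ?G] by linarith
    have "b \<le> sin \<alpha> / 4" unfolding b_def by (rule min.cobounded1)
    then have b: "0 < b" "b < sin \<alpha> / 2" using sin_angle nz gp by (auto simp: b_def)
    have "b \<le> \<bar>?G \<bullet> rim_tangent\<bar> / (2 * (norm ?G + 1))"
      unfolding b_def by (rule min.cobounded2)
    then have "b * (2 * (norm ?G + 1)) \<le> \<bar>?G \<bullet> rim_tangent\<bar>"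
    proof (rule iffD1[OF pos_le_divide_eq, rotated])
      show "0 < 2 * (norm ?G + 1)" using gp by simp
    qed
    then have "2 * (b * (norm ?G + 1)) \<le> \<bar>?G \<bullet> rim_tangent\<bar>"
      by (simp add: algebra_simps)
    then show False using bound[OF b] nz by linarith
  qed
  then show ?thesis using rim_frame_expand[of ?G] by simp
qed

text \<open>\<open>h\<close> and \<open>- h\<close> describe the same wall. Multiplication by
  \<open>sgn \<gamma>\<close> turns the gradient at the rim into the direction of
  \<open>rim_normal\<close>; the sides \<sigma> change by the same factor.\<close>

lemma rim_chart:
  obtains N h G C \<gamma> where "gradient_Lipschitz_at (R, 0) N h G C" "0 < \<gamma>" "0 < C"
    "G (R, 0) = \<gamma> *\<^sub>R rim_normal"
    "\<forall>q\<in>N \<inter> \<Gamma>. h q = 0"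
    "\<forall>q\<in>N \<inter> \<Gamma>. q \<noteq> (R, 0) \<longrightarrow>
      (\<exists>\<sigma>\<in>{-1, 1}. \<exists>\<delta>>0. \<forall>x\<in>ball q \<delta>. x \<in> D \<longleftrightarrow> \<sigma> * h x < 0)"
proof -
  obtain N h G C where h: "gradient_Lipschitz_at (R, 0) N h G C"
    and w: "\<forall>q\<in>N \<inter> \<Gamma>. h q = 0 \<and> G q \<noteq> 0 \<and>
        (q \<noteq> (R, 0) \<longrightarrow> (\<exists>\<sigma>\<in>{-1, 1}. \<exists>\<delta>>0. \<forall>x\<in>ball q \<delta>. x \<in> D \<longleftrightarrow> \<sigma> * h x < 0))"
    using chart[OF rim] by blast
  define \<gamma> where "\<gamma> = G (R, 0) \<bullet> rim_normal"
  have G: "G (R, 0) = \<gamma> *\<^sub>R rim_normal"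
    unfolding \<gamma>_def using rim_gradient_parallel[OF h] w by blast
  have "G (R, 0) \<noteq> 0" using w rim h unfolding gradient_Lipschitz_at_def by blast
  then have \<gamma>0: "\<gamma> \<noteq> 0" using G by auto
  define s where "s = sgn \<gamma>"
  have s: "s = -1 \<or> s = 1" "0 < s * \<gamma>"
    using \<gamma>0 by (auto simp: s_def sgn_if)
  have 1: "gradient_Lipschitz_at (R, 0) N (\<lambda>q. s * h q) (\<lambda>q. s *\<^sub>R G q) (\<bar>C\<bar> + 1)"
    unfolding gradient_Lipschitz_at_def
  proof (intro conjI ballI)
    show "open N" "(R, 0) \<in> N" using h by (auto simp: gradient_Lipschitz_at_def)
    fix q assume q: "q \<in> N"
    show "((\<lambda>q. s * h q) has_derivative (\<lambda>v. s *\<^sub>R G q \<bullet> v)) (at q)"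
      unfolding inner_scaleR_left
      using h q by (intro has_derivative_mult_right) (simp add: gradient_Lipschitz_at_def)
    have "norm (s *\<^sub>R G q - s *\<^sub>R G (R, 0)) = norm (G q - G (R, 0))"
      using s by (auto simp flip: scaleR_diff_right)
    also have "\<dots> \<le> C * norm (q - (R, 0))" using h q by (simp add: gradient_Lipschitz_at_def)
    also have "\<dots> \<le> (\<bar>C\<bar> + 1) * norm (q - (R, 0))" by (intro mult_right_mono) auto
    finally show "norm (s *\<^sub>R G q - s *\<^sub>R G (R, 0)) \<le> (\<bar>C\<bar> + 1) * norm (q - (R, 0))" .
  qed
  have 2: "s *\<^sub>R G (R, 0) = (s * \<gamma>) *\<^sub>R rim_normal" using G by simp
  have 3: "\<exists>\<sigma>\<in>{-1, 1}. \<exists>\<delta>>0. \<forall>x\<in>ball q \<delta>. x \<in> D \<longleftrightarrow> \<sigma> * (s * h x) < 0"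
    if q: "q \<in> N" "q \<in> \<Gamma>" "q \<noteq> (R, 0)" for q
  proof -
    have "\<exists>\<sigma>\<in>{-1, 1}. \<exists>\<delta>>0. \<forall>x\<in>ball q \<delta>. x \<in> D \<longleftrightarrow> \<sigma> * h x < 0"
      using q by (intro bspec[OF w, THEN conjunct2, THEN conjunct2, THEN mp] IntI)
    then obtain \<sigma> where \<sigma>: "\<sigma> \<in> {-1, 1::real}"
      and "\<exists>\<delta>>0. \<forall>x\<in>ball q \<delta>. x \<in> D \<longleftrightarrow> \<sigma> * h x < 0" ..
    then obtain \<delta> where \<delta>: "\<delta> > 0" and D: "\<forall>x\<in>ball q \<delta>. x \<in> D \<longleftrightarrow> \<sigma> * h x < 0"
      by auto
    have eq: "\<sigma> * s * (s * h x) = \<sigma> * h x" for x using s by auto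
    have "\<forall>x\<in>ball q \<delta>. x \<in> D \<longleftrightarrow> \<sigma> * s * (s * h x) < 0"
      unfolding eq by (rule D)
    moreover have "\<sigma> * s \<in> {-1, 1}" using \<sigma> s by auto
    ultimately show ?thesis using \<delta> by (intro bexI[of _ "\<sigma> * s"] exI[of _ \<delta>] conjI)
  qed
  have 4: "s * h q = 0" if "q \<in> N" "q \<in> \<Gamma>" for q
  proof -
    have "h q = 0" using that by (intro conjunct1[OF bspec[OF w]] IntI)
    then show ?thesis by simp
  qed
  have 5: "0 < \<bar>C\<bar> + 1" by simp
  have "\<forall>q\<in>N \<inter> \<Gamma>. s * h q = 0"
    by (intro ballI 4) simp_all
  moreover have "\<forall>q\<in>N \<inter> \<Gamma>. q \<noteq> (R, 0) \<longrightarrow>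
      (\<exists>\<sigma>\<in>{-1, 1}. \<exists>\<delta>>0. \<forall>x\<in>ball q \<delta>. x \<in> D \<longleftrightarrow> \<sigma> * (s * h x) < 0)"
  proof (intro ballI impI)
    fix q assume "q \<in> N \<inter> \<Gamma>" "q \<noteq> (R, 0)"
    then show "\<exists>\<sigma>\<in>{-1, 1}. \<exists>\<delta>>0. \<forall>x\<in>ball q \<delta>. x \<in> D \<longleftrightarrow> \<sigma> * (s * h x) < 0"
      by (intro 3) simp_all
  qed
  ultimately show ?thesis by (rule that[OF 1 s(2) 5 2])
qed

text \<open>The normalised chart gradient at \<open>q\<close> is close to \<open>rim_normal\<close>
  by the Lipschitz bound, and the Taylor formula makes \<open>q - (R, 0)\<close> tangential to
  second order. The point to settle is the orientation: the angle has to force \<open>D\<close> onto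
  the side h < 0 at every nearby wall point.\<close>

lemma rim_wall_normal:
  "\<exists>\<delta>>0. \<exists>C>0. \<forall>q\<in>\<Gamma>. q \<noteq> (R, 0) \<longrightarrow> norm (q - (R, 0)) < \<delta> \<longrightarrow>
     (\<exists>n. outward_normal D q n \<and> norm (n - rim_normal) \<le> C * norm (q - (R, 0)) \<and>
          \<bar>n \<bullet> (q - (R, 0))\<bar> \<le> C * (norm (q - (R, 0)))\<^sup>2)"
proof -
  let ?p = "(R, 0) :: real \<times> real"
  let ?e = rim_normal
  obtain N h G C \<gamma> where h: "gradient_Lipschitz_at ?p N h G C" and \<gamma>: "0 < \<gamma>" and C: "0 < C"
    and G: "G ?p = \<gamma> *\<^sub>R ?e" and w: "\<forall>q\<in>N \<inter> \<Gamma>. h q = 0"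
    and side: "\<forall>q\<in>N \<inter> \<Gamma>. q \<noteq> ?p \<longrightarrow>
      (\<exists>\<sigma>\<in>{-1, 1}. \<exists>\<delta>>0. \<forall>x\<in>ball q \<delta>. x \<in> D \<longleftrightarrow> \<sigma> * h x < 0)"
    by (rule rim_chart)
  have h0: "h q = 0" if "q \<in> N" "q \<in> \<Gamma>" for q
    using w that by simp
  obtain d where d: "d > 0" "ball ?p d \<subseteq> N"
    using h openE unfolding gradient_Lipschitz_at_def by meson
  have hp: "h ?p = 0"
    using h0[of ?p] rim h by (simp add: gradient_Lipschitz_at_def)
  define k where "k = - cos \<alpha>"
  have k: "0 < k" "k < 1" using cos_angle by (auto simp: k_def)
  have e: "?e = (sin \<alpha>, k)" by (simp add: rim_normal_def k_def)
  have ne: "norm ?e = 1" by (rule rim_frame)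
  have "0 < k / 8" "k / 8 < 1" using k by auto
  from rim_sector[OF this] obtain \<delta>\<^sub>1 where \<delta>\<^sub>1: "\<delta>\<^sub>1 > 0" and S: "\<And>v. v \<noteq> 0 \<Longrightarrow> norm v < \<delta>\<^sub>1 \<Longrightarrow>
      snd v < - (k / 8) * norm v \<Longrightarrow> v \<bullet> ?e < - (k / 8) * norm v \<Longrightarrow> ?p + v \<in> D"
    by blast
  \<comment> \<open>The shifted points stay within 2 \<delta> of the rim, and \<gamma> / (8 C) keeps
    the gradient there within \<gamma> / 4 of its value at the rim.\<close>
  define \<delta> where "\<delta> = min (min (d / 2) (\<delta>\<^sub>1 / 2)) (min (R / 2) (\<gamma> / (8 * C)))"
  have \<delta>: "0 < \<delta>" "2 * \<delta> \<le> d" "2 * \<delta> \<le> \<delta>\<^sub>1" "2 * \<delta> \<le> R" "\<delta> \<le> \<gamma> / (8 * C)"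
    using d \<delta>\<^sub>1 R_pos \<gamma> C by (auto simp: \<delta>_def)
  have C\<delta>: "8 * C * \<delta> \<le> \<gamma>" using \<delta>(5) C by (simp add: field_simps)
  \<comment> \<open>Two parts C / \<gamma> come from the deviation of the normal, the third from the
    Taylor formula at the rim.\<close>
  define K where "K = 3 * C / \<gamma>"
  have "\<exists>n. outward_normal D q n \<and> norm (n - ?e) \<le> K * norm (q - ?p) \<and> \<bar>n \<bullet> (q - ?p)\<bar> \<le> K * (norm (q - ?p))\<^sup>2"
    if q: "q \<in> \<Gamma>" "q \<noteq> ?p" "norm (q - ?p) < \<delta>" for q
  proof -
    define \<rho> where "\<rho> = norm (q - ?p)"
    have \<rho>: "0 < \<rho>" "\<rho> < \<delta>" using q by (auto simp: \<rho>_def)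
    have qb: "q \<in> ball ?p d" using \<rho> \<delta> by (simp add: \<rho>_def dist_norm norm_minus_commute)
    then have qN: "q \<in> N" using d by blast
    have hq: "h q = 0" by (rule h0[OF qN q(1)])
    have "\<bar>\<gamma> * (?e \<bullet> (q - ?p))\<bar> \<le> C * \<rho>\<^sup>2"
      using gradient_Lipschitz_at_Taylor[OF h d(2) qb] hp hq G by (simp add: \<rho>_def)
    then have "\<gamma> * \<bar>?e \<bullet> (q - ?p)\<bar> \<le> C * \<rho>\<^sup>2" using \<gamma> by (simp add: abs_mult)
    then have eq: "\<bar>?e \<bullet> (q - ?p)\<bar> \<le> C / \<gamma> * \<rho>\<^sup>2" using \<gamma> by (simp add: field_simps)
    have GC: "norm (G x - \<gamma> *\<^sub>R ?e) \<le> C * norm (x - ?p)" if "x \<in> N" for x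
      using h that G by (auto simp: gradient_Lipschitz_at_def)
    have decr: "h (q - t *\<^sub>R ?e) < 0" if t: "0 < t" "t \<le> \<rho> / 2" for t
    proof -
      have "\<exists>y. ((\<lambda>t. h (q - t *\<^sub>R ?e)) has_real_derivative y) (at s) \<and> y < 0" if s: "0 \<le> s" "s \<le> t" for s
      proof -
        let ?x = "q - s *\<^sub>R ?e"
        have "norm (?x - ?p) \<le> \<rho> + s"
          using norm_triangle_ineq4[of "q - ?p" "s *\<^sub>R ?e"] ne s by (simp add: \<rho>_def algebra_simps)
        then have xp: "norm (?x - ?p) < 2 * \<delta>" using s t \<rho> by linarith
        then have "?x \<in> ball ?p d" using \<delta> by (simp add: dist_norm norm_minus_commute)
        then have xN: "?x \<in> N" using d by blast
        have "C * norm (?x - ?p) \<le> C * (2 * \<delta>)" using xp C by simp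
        then have "norm (G ?x - \<gamma> *\<^sub>R ?e) \<le> \<gamma> / 4" using GC[OF xN] C\<delta> by linarith
        then have "\<bar>(G ?x - \<gamma> *\<^sub>R ?e) \<bullet> ?e\<bar> \<le> \<gamma> / 4"
          using Cauchy_Schwarz_ineq2[of "G ?x - \<gamma> *\<^sub>R ?e" ?e] ne by simp
        moreover have "(G ?x - \<gamma> *\<^sub>R ?e) \<bullet> ?e = G ?x \<bullet> ?e - \<gamma>"
          using ne by (simp add: inner_diff_left dot_square_norm)
        ultimately have pos: "0 < G ?x \<bullet> ?e"
          using \<gamma> by arith
        have "((\<lambda>t. h (q - t *\<^sub>R ?e)) has_derivative (\<lambda>\<tau>. G ?x \<bullet> (- \<tau> *\<^sub>R ?e))) (at s)"
        proof (rule has_derivative_compose[where g = h and f = "\<lambda>t. q - t *\<^sub>R ?e" and f' = "\<lambda>\<tau>. - \<tau> *\<^sub>R ?e"])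
          show "(h has_derivative (\<bullet>) (G ?x)) (at ?x)"
            using h xN by (simp add: gradient_Lipschitz_at_def)
        qed (auto intro!: derivative_eq_intros)
        moreover have "(\<lambda>\<tau>. G ?x \<bullet> (- \<tau> *\<^sub>R ?e)) = (*) (- (G ?x \<bullet> ?e))"
          by (auto simp: mult.commute)
        ultimately have "((\<lambda>t. h (q - t *\<^sub>R ?e)) has_real_derivative - (G ?x \<bullet> ?e)) (at s)"
          by (simp only: has_field_derivative_def)
        then show ?thesis using pos by (intro exI[of _ "- (G ?x \<bullet> ?e)"]) simp
      qed
      from DERIV_neg_imp_decreasing[where f = "\<lambda>t. h (q - t *\<^sub>R ?e)", OF t(1) this]
      show ?thesis using hq by simp
    qed
    have sndq: "snd q \<le> 0"
      using closure_snd_nonpos wall_closure[OF q(1)] by blast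
    have fstq: "R - \<rho> \<le> fst q"
      using norm_fst_le[of "fst q - R" "snd q"] by (cases q) (simp add: \<rho>_def)
    let ?I = "(\<lambda>t. q - t *\<^sub>R ?e) ` {0<..\<rho> / 2}"
    \<comment> \<open>Along this segment h < 0, so it contains no wall point and misses the frontier
      of \<open>D\<close>; one point in \<open>D\<close> puts all of it into
      \<open>D\<close>.\<close>
    have I_D: "q - t *\<^sub>R ?e \<in> D" if "0 < t" "t \<le> \<rho> / 2" for t
    proof -
      have con: "connected ?I"
        by (intro connected_continuous_image continuous_intros) simp
      have fr: "?I \<inter> frontier D = {}"
      proof (rule equals0I)
        fix x assume "x \<in> ?I \<inter> frontier D"
        then obtain t where t: "t \<in> {0<..\<rho> / 2}" and "q - t *\<^sub>R ?e \<in> frontier D"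
          by blast
        moreover have "snd (q - t *\<^sub>R ?e) < 0"
        proof -
          have "0 < t * k" using t k by simp
          then show ?thesis using sndq by (simp add: e)
        qed
        moreover have "0 < fst (q - t *\<^sub>R ?e)"
        proof -
          have "t * sin \<alpha> \<le> \<rho> / 2 * 1" using t sin_angle by (intro mult_mono) auto
          then show ?thesis using fstq \<rho> \<delta> by (simp add: e)
        qed
        ultimately have \<Gamma>: "q - t *\<^sub>R ?e \<in> \<Gamma>" by (intro frontier_in_wall)
        have "norm (q - t *\<^sub>R ?e - ?p) \<le> \<rho> + t"
          using norm_triangle_ineq4[of "q - ?p" "t *\<^sub>R ?e"] ne t by (simp add: \<rho>_def algebra_simps)
        then have "q - t *\<^sub>R ?e \<in> ball ?p d"
          using t \<rho> \<delta> by (simp add: dist_norm norm_minus_commute)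
        then have "h (q - t *\<^sub>R ?e) = 0" using h0 \<Gamma> d by blast
        then show False using decr[of t] t by simp
      qed
      \<comment> \<open>The far end is well inside the sector: its normal component is at most -
        \<rho> / 4, its height at most - k \<rho> / 2 and its distance to the rim at most 3 \<rho> /
        2, which fits the tolerance \<open>k / 8\<close>.\<close>
      have "?I \<inter> D \<noteq> {}"
      proof -
        let ?v = "q - ?p - (\<rho> / 2) *\<^sub>R ?e"
        have nv: "norm ?v \<le> 3 / 2 * \<rho>"
          using norm_triangle_ineq4[of "q - ?p" "(\<rho> / 2) *\<^sub>R ?e"] ne \<rho> by (simp add: \<rho>_def)
        have kv: "k / 8 * norm ?v \<le> k / 8 * (3 / 2 * \<rho>)"
          using nv k by (intro mult_left_mono) auto
        have kr: "0 < k * \<rho>" "k * \<rho> < \<rho>" using k \<rho> by auto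
        have "?v \<bullet> ?e \<le> - (\<rho> / 4)"
        proof -
          have "C / \<gamma> * \<rho>\<^sup>2 \<le> \<rho> / 4"
          proof -
            have "8 * C * \<rho> \<le> 8 * C * \<delta>" using \<rho> C by simp
            then have "8 * C * \<rho> \<le> \<gamma>" using C\<delta> by linarith
            then have "C / \<gamma> * \<rho> \<le> 1 / 8" using \<gamma> by (simp add: field_simps)
            then have "C / \<gamma> * \<rho> * \<rho> \<le> 1 / 8 * \<rho>" using \<rho> by (intro mult_right_mono) auto
            moreover have "C / \<gamma> * \<rho>\<^sup>2 = C / \<gamma> * \<rho> * \<rho>" by (simp add: power2_eq_square)
            ultimately show ?thesis using \<rho> by linarith
          qed
          moreover have "?v \<bullet> ?e = ?e \<bullet> (q - ?p) - \<rho> / 2"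
            using ne by (simp add: inner_diff_left inner_diff_right inner_commute dot_square_norm)
          ultimately show ?thesis using eq by linarith
        qed
        then have 1: "?v \<bullet> ?e < - (k / 8) * norm ?v"
          using kv kr \<rho> by linarith
        have "snd ?v \<le> - (k * \<rho> / 2)" using sndq by (simp add: e mult.commute)
        then have 2: "snd ?v < - (k / 8) * norm ?v" using kv kr by linarith
        have "?v \<noteq> 0"
        proof
          assume z: "?v = 0"
          show False using 2 unfolding z by simp
        qed
        moreover have "norm ?v < \<delta>\<^sub>1" using nv \<rho> \<delta> by linarith
        ultimately have "?p + ?v \<in> D" using S 1 2 by blast
        moreover have "?p + ?v = q - (\<rho> / 2) *\<^sub>R ?e" by simp
        moreover have "q - (\<rho> / 2) *\<^sub>R ?e \<in> ?I" using \<rho> by (intro imageI) simp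
        ultimately have "q - (\<rho> / 2) *\<^sub>R ?e \<in> ?I \<inter> D" by simp
        then show ?thesis by (metis empty_iff)
      qed
      then have sub: "?I - D = {}" using connected_Int_frontier[OF con] fr by blast
      have "q - t *\<^sub>R ?e \<in> ?I" using that by (intro imageI) simp
      then show ?thesis using sub by blast
    qed
    have "\<exists>\<sigma>\<in>{-1, 1}. \<exists>\<delta>>0. \<forall>x\<in>ball q \<delta>. x \<in> D \<longleftrightarrow> \<sigma> * h x < 0"
      using qN q(1,2) by (intro bspec[OF side, THEN mp] IntI)
    then obtain \<sigma> where \<sigma>0: "\<sigma> \<in> {-1, 1::real}"
      and "\<exists>\<delta>>0. \<forall>x\<in>ball q \<delta>. x \<in> D \<longleftrightarrow> \<sigma> * h x < 0" ..
    then obtain \<delta>\<^sub>2 where \<delta>\<^sub>2: "\<delta>\<^sub>2 > 0" "\<And>x. x \<in> ball q \<delta>\<^sub>2 \<Longrightarrow> x \<in> D \<longleftrightarrow> \<sigma> * h x < 0"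
      by auto
    note \<sigma> = \<sigma>0 \<delta>\<^sub>2
    have \<sigma>1: "\<sigma> = 1"
    proof -
      define t where "t = min (\<rho> / 2) (\<delta>\<^sub>2 / 2)"
      have t: "0 < t" "t \<le> \<rho> / 2" "t < \<delta>\<^sub>2" using \<rho> \<sigma> by (auto simp: t_def)
      have "q - t *\<^sub>R ?e \<in> ball q \<delta>\<^sub>2" using t ne by (simp add: dist_norm)
      then have "\<sigma> * h (q - t *\<^sub>R ?e) < 0" using \<sigma>(3) I_D[OF t(1,2)] by blast
      then show ?thesis using decr[OF t(1,2)] \<sigma>(1) by auto
    qed
    define n where "n = G q /\<^sub>R norm (G q)"
    have Gq: "norm (G q - \<gamma> *\<^sub>R ?e) \<le> C * \<rho>" using GC[OF qN] by (simp add: \<rho>_def)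
    have "8 * C * \<rho> \<le> 8 * C * \<delta>" using \<rho> C by simp
    then have "C * \<rho> < \<gamma>" using C\<delta> \<gamma> by linarith
    note nrm = norm_normalize_diff_le[OF ne \<gamma> Gq this]
    have "outward_normal D q n"
      unfolding n_def
    proof (rule outward_normal_sublevel)
      show "(h has_derivative (\<bullet>) (G q)) (at q)" using h qN by (simp add: gradient_Lipschitz_at_def)
      show "\<delta>\<^sub>2 > 0" by (rule \<sigma>)
      show "x \<in> D \<longleftrightarrow> h x < 0" if "x \<in> ball q \<delta>\<^sub>2" for x using \<sigma>(3)[OF that] \<sigma>1 by simp
    qed (rule hq nrm(1))+
    moreover have ndiff: "norm (n - ?e) \<le> 2 * C / \<gamma> * \<rho>" using nrm(2) by (simp add: n_def)
    moreover have "2 * C / \<gamma> * \<rho> \<le> K * \<rho>" 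
    proof -
      have "0 \<le> C / \<gamma> * \<rho>" using C \<gamma> \<rho> by simp
      moreover have "2 * C / \<gamma> * \<rho> = 2 * (C / \<gamma> * \<rho>)" "K * \<rho> = 3 * (C / \<gamma> * \<rho>)" by (simp_all add: K_def)
      ultimately show ?thesis by linarith
    qed
    moreover have "\<bar>n \<bullet> (q - ?p)\<bar> \<le> K * \<rho>\<^sup>2"
    proof -
      have "\<bar>(n - ?e) \<bullet> (q - ?p)\<bar> \<le> norm (n - ?e) * \<rho>"
        unfolding \<rho>_def by (rule Cauchy_Schwarz_ineq2)
      also have "\<dots> \<le> 2 * C / \<gamma> * \<rho> * \<rho>" using ndiff \<rho> by (intro mult_right_mono) auto
      finally have "\<bar>(n - ?e) \<bullet> (q - ?p)\<bar> \<le> 2 * (C / \<gamma> * \<rho>\<^sup>2)" by (simp add: power2_eq_square)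
      moreover have "n \<bullet> (q - ?p) = (n - ?e) \<bullet> (q - ?p) + ?e \<bullet> (q - ?p)" by (simp add: inner_diff_left)
      moreover have "K * \<rho>\<^sup>2 = 3 * (C / \<gamma> * \<rho>\<^sup>2)" by (simp add: K_def)
      ultimately show ?thesis using eq by linarith
    qed
    ultimately show ?thesis unfolding \<rho>_def by (intro exI[of _ n] conjI) linarith+
  qed
  moreover have "0 < K" using C \<gamma> by (simp add: K_def)
  ultimately show ?thesis
    using \<delta>(1) by (intro exI[of _ \<delta>] exI[of _ K] conjI ballI impI)
qed

section \<open>Barriers at the rim\<close>

text \<open>No boundary condition is available at the rim itself, so the upper bound \<open>0\<close> for the limes
  superior of the barrier \<open>E\<close> at the rim replaces it.\<close>

lemma rim_comparison:
  assumes \<delta>: "0 < \<delta>" "\<delta> < R"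
    and M: "\<And>q. q \<in> closure D \<Longrightarrow> \<psi> q \<le> M"
    and jet: "\<And>q. 0 < fst q \<Longrightarrow> q \<noteq> (R, 0) \<Longrightarrow> axial_jet E (g q) (L q) q"
    and L: "\<And>q. q \<in> D \<Longrightarrow> norm (q - (R, 0)) < \<delta> \<Longrightarrow> 0 \<le> L q"
    and wall_neg: "\<And>q. q \<in> \<Gamma> \<Longrightarrow> q \<noteq> (R, 0) \<Longrightarrow> norm (q - (R, 0)) < \<delta> \<Longrightarrow>
      \<exists>n. outward_normal D q n \<and> g q \<bullet> n < 0"
    and free_neg: "\<And>r. R - \<delta> < r \<Longrightarrow> r < R \<Longrightarrow> E (r, 0) \<le> 0 \<or> snd (g (r, 0)) < - \<bar>\<nu>\<bar> * M"
    and sphere: "\<And>q. q \<in> closure D \<Longrightarrow> norm (q - (R, 0)) = \<delta> \<Longrightarrow> \<psi> q + E q \<le> M"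
    and corner: "\<And>\<eta>. 0 < \<eta> \<Longrightarrow> \<exists>\<delta>'>0. \<forall>q\<in>closure D. q \<noteq> (R, 0) \<longrightarrow> norm (q - (R, 0)) < \<delta>' \<longrightarrow> E q \<le> \<eta>"
    and q: "q \<in> closure D" "q \<noteq> (R, 0)" "norm (q - (R, 0)) \<le> \<delta>"
  shows "\<psi> q + E q \<le> M"
proof (rule ccontr)
  let ?p = "(R, 0) :: real \<times> real"
  assume "\<not> \<psi> q + E q \<le> M"
  \<comment> \<open>Half of the excess: where \<open>corner\<close> gives E \<le> \<eta>, the sum is
    at most M + \<eta> and cannot reach M + 2 \<eta>.\<close>
  define \<eta> where "\<eta> = (\<psi> q + E q - M) / 2"
  have \<eta>: "0 < \<eta>" "\<psi> q + E q = M + 2 * \<eta>"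
    using \<open>\<not> \<psi> q + E q \<le> M\<close> by (auto simp: \<eta>_def field_simps)
  obtain \<delta>' where \<delta>': "\<delta>' > 0" "\<And>x. x \<in> closure D \<Longrightarrow> x \<noteq> ?p \<Longrightarrow> norm (x - ?p) < \<delta>' \<Longrightarrow> E x \<le> \<eta>"
    using corner[OF \<eta>(1)] by blast
  define K where "K = (closure D \<inter> cball ?p \<delta>) - ball ?p \<delta>'"
  have K: "x \<in> K \<longleftrightarrow> x \<in> closure D \<and> norm (x - ?p) \<le> \<delta> \<and> \<delta>' \<le> norm (x - ?p)" for x
    by (auto simp: K_def dist_norm norm_minus_commute)
  have fstpos: "0 < fst x" if "norm (x - ?p) \<le> \<delta>" for x
    using norm_fst_le[of "fst x - R" "snd x"] that \<delta> by (cases x) auto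
  have "compact K"
    unfolding K_def by (intro compact_diff compact_Int_closed compact_closure) auto
  moreover have "continuous_on K (\<lambda>x. \<psi> x + E x)"
  proof (intro continuous_on_add)
    show "continuous_on K \<psi>" using cont by (rule continuous_on_subset) (auto simp: K_def)
    show "continuous_on K E"
    proof (rule continuous_at_imp_continuous_on, intro ballI)
      fix x assume "x \<in> K"
      then have "axial_jet E (g x) (L x) x"
        using K[of x] \<delta>' fstpos[of x] by (intro jet) auto
      then show "isCont E x"
        by (rule has_derivative_continuous[OF axial_jet_derivative])
    qed
  qed
  moreover have qK: "q \<in> K"
  proof -
    have "\<not> norm (q - ?p) < \<delta>'"
      using \<delta>'(2)[OF q(1,2)] M[OF q(1)] \<eta> by auto
    then show ?thesis using q K by auto
  qed
  ultimately obtain x where x: "x \<in> K" "\<And>z. z \<in> K \<Longrightarrow> \<psi> z + E z \<le> \<psi> x + E x"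
    using continuous_attains_sup[of K "\<lambda>x. \<psi> x + E x"] by blast
  have big: "M + 2 * \<eta> \<le> \<psi> x + E x" using x(2)[OF qK] \<eta> by simp
  have xD: "x \<in> closure D" "norm (x - ?p) \<le> \<delta>" "\<delta>' \<le> norm (x - ?p)" using x(1) K by auto
  have xp: "x \<noteq> ?p" using xD \<delta>' by auto
  have xd: "norm (x - ?p) < \<delta>"
    using sphere[OF xD(1)] xD(2) big \<eta> by fastforce
  have J: "axial_jet E (g x) (L x) x" by (rule jet[OF fstpos[OF xD(2)] xp])
  \<comment> \<open>A maximum over the compact set \<open>K\<close> is a local maximum relative to
    \<open>D\<close>, since the removed ball around the rim only carries smaller values.\<close>
  have loc: "\<forall>\<^sub>F z in nhds x. z \<in> D \<longrightarrow> \<psi> z + E z \<le> \<psi> x + E x"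
  proof -
    have "\<forall>\<^sub>F z in nhds x. norm (z - ?p) < \<delta>"
    proof (rule eventually_nhds_in_open[of "{z. norm (z - ?p) < \<delta>}" x, simplified])
      show "open {z. norm (z - ?p) < \<delta>}" by (intro open_Collect_less continuous_intros)
    qed (rule xd)
    then show ?thesis
    proof eventually_elim
      case (elim z)
      show ?case
      proof
        assume z: "z \<in> D"
        then have zc: "z \<in> closure D" using closure_subset by blast
        show "\<psi> z + E z \<le> \<psi> x + E x"
        proof (cases "norm (z - ?p) < \<delta>'")
          case True
          have "z \<noteq> ?p" using D_quadrant[OF z] by auto
          then have "E z \<le> \<eta>" using \<delta>'(2)[OF zc _ True] by simp
          then show ?thesis using M[OF zc] big \<eta> by simp
        next
          case False
          then show ?thesis using elim zc K by (intro x(2)) auto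
        qed
      qed
    qed
  qed
  from closure_cases[OF xD(1)] consider "x \<in> D" | r where "0 < r" "r < R" "x = (r, 0)" | "x \<in> \<Gamma>"
    using fstpos[OF xD(2)] by force
  then show False
  proof cases
    case 1
    have "\<forall>\<^sub>F z in nhds x. z \<in> D" using open_D 1 by (rule eventually_nhds_in_open)
    with loc have "\<forall>\<^sub>F z in nhds x. \<psi> z + E z \<le> \<psi> x + E x" by eventually_elim simp
    then have "L x \<le> - \<psi> x / (fst x)\<^sup>2" by (rule interior_max_laplacian[OF 1 J])
    moreover have "0 < \<psi> x / (fst x)\<^sup>2" using pos[OF 1] fstpos[OF xD(2)] by simp
    ultimately show False using L[OF 1 xd] by simp
  next
    case (2 r)
    have rR: "R - \<delta> < r" using xd 2 by (simp add: norm_Pair)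
    \<comment> \<open>As \<psi> \<le> M, the excess forces E > 0 and so selects the slope
      alternative of \<open>free_neg\<close>.\<close>
    have E0: "0 < E x" using big M[OF xD(1)] \<eta> by linarith
    then have neg: "snd (g x) < - \<bar>\<nu>\<bar> * M" using free_neg[OF rR 2(2)] 2 by auto
    have "\<nu> * \<psi> x \<le> \<bar>\<nu>\<bar> * M"
      using nonneg[OF xD(1)] M[OF xD(1)] by (intro mult_mono) auto
    then have "\<nu> * \<psi> x + snd (g x) < 0" using neg by simp
    moreover have "0 \<le> \<nu> * \<psi> x + snd (g x)"
    proof (rule left_local_max_derivative_nonneg[where f = "\<lambda>s. \<psi> (r, s) + E (r, s)" and x = 0])
      have "((\<lambda>s. E (r, s)) has_derivative (\<lambda>h. g x \<bullet> (0, h))) (at 0)"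
        by (rule has_derivative_compose[where g = E and f = "\<lambda>s. (r, s)"])
          (use axial_jet_derivative[OF J] 2(3) in \<open>auto intro!: derivative_eq_intros\<close>)
      moreover have "(\<lambda>h. g x \<bullet> (0, h)) = (*) (snd (g x))"
        by (auto simp: inner_prod_def)
      ultimately have "((\<lambda>s. E (r, s)) has_real_derivative snd (g x)) (at_left 0)"
        by (simp only: has_field_derivative_def has_derivative_at_withinI)
      then show "((\<lambda>s. \<psi> (r, s) + E (r, s)) has_real_derivative \<nu> * \<psi> x + snd (g x)) (at_left 0)"
        using free[OF 2(1,2)] 2(3) by (intro DERIV_add) auto
      obtain d where d: "d > 0" "\<And>z. z \<in> ball (r, 0) d \<Longrightarrow> snd z < 0 \<Longrightarrow> z \<in> D"
        using free_local[OF 2(1,2)] by blast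
      obtain d' where d': "d' > 0" "\<And>z. dist z x < d' \<Longrightarrow> z \<in> D \<Longrightarrow> \<psi> z + E z \<le> \<psi> x + E x"
        using loc unfolding eventually_nhds_metric by blast
      show "\<forall>\<^sub>F s in at_left 0. \<psi> (r, s) + E (r, s) \<le> \<psi> (r, 0) + E (r, 0)"
        unfolding eventually_at
      proof (intro exI[of _ "min d d'"] conjI ballI impI)
        show "0 < min d d'" using d d' by simp
        fix s :: real assume s: "s \<in> {..<0}" "s \<noteq> 0 \<and> dist s 0 < min d d'"
        have dd: "dist (r, s) (r, 0) = \<bar>s\<bar>" by (simp add: dist_Pair_Pair dist_real_def)
        have "(r, s) \<in> D" using s dd by (intro d(2)) (auto simp: dist_commute)
        then show "\<psi> (r, s) + E (r, s) \<le> \<psi> (r, 0) + E (r, 0)"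
          using d'(2)[of "(r, s)"] s dd 2(3) by auto
      qed
    qed
    ultimately show False by simp
  next
    case 3
    obtain n where n: "outward_normal D x n" "g x \<bullet> n < 0"
      using wall_neg[OF 3 xp xd] by blast
    have "\<forall>\<^sub>F z in at x. z \<in> D \<longrightarrow> \<psi> z + E z \<le> \<psi> x + E x"
      using loc by (simp add: eventually_nhds_conv_at)
    then have "0 \<le> g x \<bullet> n"
      by (rule wall_max_normal_derivative[OF 3 n(1) axial_jet_derivative[OF J]])
    then show False using n by simp
  qed
qed

text \<open>In the comments \<open>|q|\<close> is the distance of \<open>q\<close> from the rim.
  The linear part of \<open>wedge a\<close> is the coordinate along the wall, tilted inwards so that its
  outward derivative on the wall is negative; the term \<open>a |q|\<close> makes it strictly subharmonic.  For
  \<open>a \<le> - cos \<alpha> / 2\<close> it is negative on the free surface because \<open>\<alpha> > \<pi> / 2\<close>.\<close>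

definition rim_slope :: "real \<times> real" where
  "rim_slope = rim_tangent - (- cos \<alpha> / 2) *\<^sub>R rim_normal"

definition wedge :: "real \<Rightarrow> real \<times> real \<Rightarrow> real" where
  "wedge a q = rim_slope \<bullet> (q - (R, 0)) + a * norm (q - (R, 0))"

definition wedge_grad :: "real \<Rightarrow> real \<times> real \<Rightarrow> real \<times> real" where
  "wedge_grad a q = rim_slope + a *\<^sub>R ((q - (R, 0)) /\<^sub>R norm (q - (R, 0)))"

definition wedge_lap :: "real \<Rightarrow> real \<times> real \<Rightarrow> real" where
  "wedge_lap a q = fst rim_slope / fst q +
     a * (1 / norm (q - (R, 0)) + fst (q - (R, 0)) / (fst q * norm (q - (R, 0))))"

lemma axial_jet_wedge: "q \<noteq> (R, 0) \<Longrightarrow> axial_jet (wedge a) (wedge_grad a q) (wedge_lap a q) q"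
  unfolding wedge_def[abs_def] wedge_grad_def wedge_lap_def
  by (intro axial_jet_add axial_jet_linear axial_jet_cmult axial_jet_norm)

lemma norm_rim_slope: "norm rim_slope \<le> 3 / 2"
proof -
  have "norm rim_slope \<le> norm rim_tangent + norm ((- cos \<alpha> / 2) *\<^sub>R rim_normal)"
    unfolding rim_slope_def by (rule norm_triangle_ineq4)
  then show ?thesis using rim_frame cos_angle by simp
qed

lemma fst_rim_slope: "\<bar>fst rim_slope\<bar> \<le> 3 / 2"
  using norm_fst_le[of "fst rim_slope" "snd rim_slope"] norm_rim_slope by simp

lemma snd_rim_slope: "snd rim_slope \<le> - sin \<alpha>"
  by (simp add: rim_slope_def rim_tangent_def rim_normal_def)

lemma rim_slope_normal: "rim_slope \<bullet> rim_normal = cos \<alpha> / 2"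
  using rim_frame by (simp add: rim_slope_def inner_add_left inner_commute[of rim_tangent] dot_square_norm)

lemma abs_wedge_le: "0 \<le> a \<Longrightarrow> a \<le> 1 / 2 \<Longrightarrow> \<bar>wedge a q\<bar> \<le> 2 * norm (q - (R, 0))"
proof -
  assume a: "0 \<le> a" "a \<le> 1 / 2"
  have "\<bar>rim_slope \<bullet> (q - (R, 0))\<bar> \<le> 3 / 2 * norm (q - (R, 0))"
    using Cauchy_Schwarz_ineq2[of rim_slope "q - (R, 0)"] norm_rim_slope
    by (meson mult_right_mono norm_ge_zero order_trans)
  moreover have "0 \<le> a * norm (q - (R, 0))" "a * norm (q - (R, 0)) \<le> 1 / 2 * norm (q - (R, 0))"
    using a by (simp, intro mult_right_mono) auto
  ultimately show ?thesis unfolding wedge_def by arith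
qed

lemma wedge_free_neg:
  assumes "r < R" "a \<le> - cos \<alpha> / 2"
  shows "wedge a (r, 0) < 0"
proof -
  define k where "k = - cos \<alpha>"
  have k: "0 < k" using cos_angle by (simp add: k_def)
  have "wedge a (r, 0) = (R - r) * (a - (k - k * sin \<alpha> / 2))"
    using assms(1) by (simp add: wedge_def rim_slope_def rim_tangent_def rim_normal_def norm_Pair k_def field_simps)
  moreover have "k * sin \<alpha> < k * 1" using k sin_angle by (intro mult_strict_left_mono) auto
  then have "a - (k - k * sin \<alpha> / 2) < 0" using assms(2) by (simp add: k_def)
  ultimately show ?thesis using assms(1) by (simp add: mult_pos_neg)
qed

text \<open>Euler's identity: \<open>wedge a\<close> is homogeneous of degree one about the
  rim.\<close>

lemma wedge_grad_radial:
  "q \<noteq> (R, 0) \<Longrightarrow> wedge_grad a q \<bullet> (q - (R, 0)) = wedge a q"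
  by (simp add: wedge_grad_def wedge_def inner_add_left dot_square_norm power2_eq_square divide_inverse)

text \<open>The tilt contributes cos \<alpha> / 2. The deviation of \<open>n\<close> from
  \<open>rim_normal\<close> costs at most 3/2 C |q| and the radial term at most 1/2 C |q|, together
  less than half of that.\<close>

lemma wedge_grad_normal:
  assumes C: "0 < C" and n: "norm (n - rim_normal) \<le> C * norm (q - (R, 0))"
    "\<bar>n \<bullet> (q - (R, 0))\<bar> \<le> C * (norm (q - (R, 0)))\<^sup>2"
    and a: "0 \<le> a" "a \<le> 1 / 2" and q: "q \<noteq> (R, 0)" "norm (q - (R, 0)) < - cos \<alpha> / (8 * C)"
  shows "wedge_grad a q \<bullet> n \<le> cos \<alpha> / 4"
proof -
  define N where "N = norm (q - (R, 0))"
  have N: "0 < N" using q by (simp add: N_def)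
  have CN: "8 * (C * N) < - cos \<alpha>" using q C by (simp add: N_def field_simps)
  have "\<bar>rim_slope \<bullet> (n - rim_normal)\<bar> \<le> norm rim_slope * norm (n - rim_normal)"
    by (rule Cauchy_Schwarz_ineq2)
  also have "\<dots> \<le> 3 / 2 * (C * N)"
    using norm_rim_slope n(1) by (intro mult_mono) (auto simp: N_def)
  finally have s: "\<bar>rim_slope \<bullet> (n - rim_normal)\<bar> \<le> 3 / 2 * (C * N)" .
  have 1: "rim_slope \<bullet> n \<le> cos \<alpha> / 2 + 3 / 2 * (C * N)"
  proof -
    have "rim_slope \<bullet> (n - rim_normal) = rim_slope \<bullet> n - cos \<alpha> / 2"
      using rim_slope_normal by (simp add: inner_diff_right)
    with s show ?thesis by arith
  qed
  have "a / N * (n \<bullet> (q - (R, 0))) \<le> a / N * (C * N\<^sup>2)"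
    using n(2) a N by (intro mult_left_mono) (auto simp: N_def)
  also have "\<dots> = a * (C * N)" using N by (simp add: power2_eq_square)
  also have "\<dots> \<le> 1 / 2 * (C * N)" using a C N by (intro mult_right_mono) auto
  finally have 2: "a / N * (n \<bullet> (q - (R, 0))) \<le> 1 / 2 * (C * N)" .
  have "wedge_grad a q \<bullet> n = rim_slope \<bullet> n + a / N * (n \<bullet> (q - (R, 0)))"
    by (simp add: wedge_grad_def N_def inner_add_left inner_commute[of n] divide_inverse)
  then show ?thesis using 1 2 CN by linarith
qed

text \<open>The planar Laplacian of \<open>wedge a\<close> is a / |q|; the rest is its radial
  derivative divided by r, at least - 2 / r, with r \<ge> R / 2.\<close>

lemma wedge_lap_ge:
  assumes a: "0 \<le> a" "a \<le> 1 / 2" and q: "q \<noteq> (R, 0)" "R / 2 \<le> fst q"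
  shows "a / norm (q - (R, 0)) - 4 / R \<le> wedge_lap a q"
proof -
  define N where "N = norm (q - (R, 0))"
  have N: "0 < N" using q by (simp add: N_def)
  have f: "0 < fst q" using q R_pos by simp
  have i: "1 / fst q \<le> 2 / R" using q f R_pos by (simp add: field_simps)
  have "\<bar>fst (q - (R, 0))\<bar> \<le> N"
    unfolding N_def by (rule abs_fst_le_norm)
  then have "- 1 \<le> fst (q - (R, 0)) / N" using N by (simp add: field_simps abs_le_iff)
  then have "a * - 1 \<le> a * (fst (q - (R, 0)) / N)" using a by (intro mult_left_mono)
  then have "- 2 \<le> fst rim_slope + a * (fst (q - (R, 0)) / N)"
    using fst_rim_slope a by linarith
  then have "- 2 * (1 / fst q) \<le> (fst rim_slope + a * (fst (q - (R, 0)) / N)) * (1 / fst q)"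
    using f by (intro mult_right_mono) auto
  moreover have "wedge_lap a q = a / N + (fst rim_slope + a * (fst (q - (R, 0)) / N)) * (1 / fst q)"
    unfolding wedge_lap_def N_def by (simp add: divide_inverse algebra_simps)
  moreover have "- (4 / R) \<le> - 2 * (1 / fst q)" using i by simp
  ultimately show ?thesis unfolding N_def by linarith
qed

text \<open>The barrier \<open>- \<epsilon> P ln |q|\<close> with \<open>P = wedge (- cos \<alpha> / 2)\<close> is not positive on the free surface,
  so no information about the flux through it is needed.\<close>

lemma rim_log_growth:
  assumes M: "\<And>q. q \<in> closure D \<Longrightarrow> \<psi> q \<le> M"
    and C: "0 < C" and \<delta>: "0 < \<delta>" "\<delta> < R / 2" "\<delta> < - cos \<alpha> / (8 * C)" "\<delta> \<le> - cos \<alpha> * R / 32"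
      "\<delta> \<le> exp (16 / cos \<alpha>)"
    and normal: "\<And>q. q \<in> \<Gamma> \<Longrightarrow> q \<noteq> (R, 0) \<Longrightarrow> norm (q - (R, 0)) < \<delta> \<Longrightarrow>
      \<exists>n. outward_normal D q n \<and> norm (n - rim_normal) \<le> C * norm (q - (R, 0)) \<and>
          \<bar>n \<bullet> (q - (R, 0))\<bar> \<le> C * (norm (q - (R, 0)))\<^sup>2"
  shows "\<exists>\<epsilon>>0. \<forall>q\<in>closure D. q \<noteq> (R, 0) \<longrightarrow> norm (q - (R, 0)) \<le> \<delta> \<longrightarrow>
    \<psi> q - \<epsilon> * (wedge (- cos \<alpha> / 2) q * ln (norm (q - (R, 0)))) \<le> M"
proof -
  let ?p = "(R, 0) :: real \<times> real"
  define k where "k = - cos \<alpha>"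
  have k: "0 < k" "k < 1" using cos_angle by (auto simp: k_def)
  define a where "a = k / 2"
  have a: "0 < a" "a \<le> 1 / 2" using k by (auto simp: a_def)
  define P where "P = wedge a"
  define N where "N q = norm (q - ?p)" for q
  have absP: "\<bar>P q\<bar> \<le> 2 * N q" for q using abs_wedge_le[of a q] a by (simp add: P_def N_def)
  have ln16: "16 / k \<le> - ln t" if "0 < t" "t \<le> \<delta>" for t
  proof -
    have "ln t \<le> ln (exp (16 / cos \<alpha>))"
      by (rule iffD2[OF ln_le_cancel_iff]) (use that \<delta>(5) in auto)
    then show ?thesis by (simp add: k_def)
  qed
  have k16: "16 < 16 / k" using k by (simp add: field_simps)
  \<comment> \<open>Only the part of the arc with P \<ge> 0 needs a gap below \<open>M\<close>. It
    avoids the free surface, so \<psi> < M on it by the interior and wall arguments, and compactness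
    makes the gap uniform.\<close>
  define K where "K = closure D \<inter> {q. N q = \<delta>} \<inter> {q. 0 \<le> P q}"
  have "compact K"
  proof -
    have "closed {q. N q = \<delta>}" "closed {q. 0 \<le> P q}"
      unfolding N_def P_def wedge_def by (intro closed_Collect_eq closed_Collect_le continuous_intros)+
    then show ?thesis unfolding K_def by (intro compact_Int_closed compact_closure)
  qed
  have Klt: "\<psi> q < M" if "q \<in> K" for q
  proof -
    have q: "q \<in> closure D" "N q = \<delta>" "0 \<le> P q" using that by (auto simp: K_def)
    have f: "0 < fst q"
      using abs_fst_le_norm[of "q - ?p"] q(2) \<delta>(2) R_pos by (simp add: N_def abs_le_iff)
    have "\<exists>x\<in>closure D. \<psi> q < \<psi> x"
      using closure_cases[OF q(1)]
    proof (elim disjE)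
      assume "q \<in> D"
      then show ?thesis using not_interior_max closure_subset by blast
    next
      assume "\<exists>r. 0 < r \<and> r < R \<and> q = (r, 0)"
      then obtain r where "r < R" "q = (r, 0)" by blast
      then have "P q < 0" using wedge_free_neg[of r a] by (simp add: P_def a_def k_def)
      then show ?thesis using q(3) by simp
    next
      assume "q \<in> \<Gamma>"
      moreover have "q \<noteq> ?p" using q(2) \<delta>(1) by (auto simp: N_def)
      ultimately show ?thesis by (rule wall_not_max)
    qed (use f in simp)
    then show ?thesis using M by force
  qed
  obtain m where m: "0 < m" "\<And>q. q \<in> K \<Longrightarrow> \<psi> q \<le> M - m"
  proof (cases "K = {}")
    case True
    then show ?thesis using that[of 1] by simp
  next
    case False
    have "continuous_on K \<psi>" using cont by (rule continuous_on_subset) (auto simp: K_def)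
    then obtain x where "x \<in> K" "\<And>q. q \<in> K \<Longrightarrow> \<psi> q \<le> \<psi> x"
      using continuous_attains_sup[OF \<open>compact K\<close> False] by blast
    then show ?thesis using that[of "M - \<psi> x"] Klt by simp
  qed
  \<comment> \<open>The barrier is at most 2 \<epsilon> \<delta> |ln \<delta>| on the arc; this
    makes that bound equal to the gap \<open>m\<close>.\<close>
  define \<epsilon> where "\<epsilon> = m / (2 * \<delta> * - ln \<delta>)"
  have ln\<delta>: "0 < - ln \<delta>" using ln16[OF \<delta>(1) order_refl] k16 by linarith
  have \<epsilon>: "0 < \<epsilon>" unfolding \<epsilon>_def by (intro divide_pos_pos mult_pos_pos m \<delta> ln\<delta>) simp
  have \<epsilon>m: "\<epsilon> * (2 * \<delta> * - ln \<delta>) = m" using \<delta>(1) ln\<delta> by (simp add: \<epsilon>_def)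
  define E where "E q = (- \<epsilon>) * (P q * ln (norm (q - ?p)))" for q
  define g where "g q = (- \<epsilon>) *\<^sub>R (P q *\<^sub>R ((q - ?p) /\<^sub>R (norm (q - ?p))\<^sup>2) + ln (norm (q - ?p)) *\<^sub>R wedge_grad a q)" for q
  define L where "L q = (- \<epsilon>) * (P q * (fst (q - ?p) / (fst q * (norm (q - ?p))\<^sup>2)) + ln (norm (q - ?p)) * wedge_lap a q +
    2 * (wedge_grad a q \<bullet> ((q - ?p) /\<^sub>R (norm (q - ?p))\<^sup>2)))" for q
  have jet: "axial_jet E (g q) (L q) q" if "q \<noteq> ?p" for q
    unfolding E_def[abs_def] g_def L_def P_def
    by (intro axial_jet_cmult axial_jet_mult axial_jet_wedge axial_jet_ln_norm that)
  have main: "\<psi> q + E q \<le> M" if "q \<in> closure D" "q \<noteq> ?p" "norm (q - ?p) \<le> \<delta>" for q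
  proof (rule rim_comparison[OF \<delta>(1) _ M jet _ _ _ _ _ that])
    show "\<delta> < R" using \<delta>(2) R_pos by simp
    show "0 \<le> L q" if q: "q \<in> D" "norm (q - ?p) < \<delta>" for q
    proof -
      have qp: "q \<noteq> ?p" using D_quadrant[OF q(1)] by auto
      have N: "0 < N q" "N q \<le> \<delta>" using qp q by (auto simp: N_def)
      have fN: "\<bar>fst (q - ?p)\<bar> \<le> N q"
        unfolding N_def by (rule abs_fst_le_norm)
      have f: "R / 2 \<le> fst q" using fN N \<delta>(2) by (simp add: abs_le_iff)
      \<comment> \<open>Half of \<Lambda> a / |q| absorbs the cross term 2 P / |q|^2 \<le> 4 / |q|,
        since \<Lambda> a \<ge> 8; the other half absorbs the terms 4 / R and 4 \<Lambda> / R, since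
        |q| \<le> k R / 32.\<close>
      define \<Lambda> where "\<Lambda> = - ln (N q)"
      have \<Lambda>: "16 / k \<le> \<Lambda>" "1 \<le> \<Lambda>" using ln16[OF N] k16 by (auto simp: \<Lambda>_def)
      have 1: "P q * (fst (q - ?p) / (fst q * (N q)\<^sup>2)) \<le> 4 / R"
      proof -
        have "P q * fst (q - ?p) \<le> \<bar>P q\<bar> * \<bar>fst (q - ?p)\<bar>"
          by (metis abs_ge_self abs_mult)
        also have "\<dots> \<le> 2 * N q * N q" using absP fN by (intro mult_mono) auto
        finally have "P q * fst (q - ?p) / (fst q * (N q)\<^sup>2) \<le> 2 * N q * N q / (fst q * (N q)\<^sup>2)"
          using f R_pos by (intro divide_right_mono) auto
        also have "\<dots> = 2 / fst q" using N by (simp add: power2_eq_square)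
        also have "\<dots> \<le> 4 / R" using f R_pos by (simp add: field_simps)
        finally show ?thesis by simp
      qed
      have 2: "wedge_grad a q \<bullet> ((q - ?p) /\<^sub>R (N q)\<^sup>2) \<le> 2 / N q"
      proof -
        have "wedge_grad a q \<bullet> ((q - ?p) /\<^sub>R (N q)\<^sup>2) = P q / (N q)\<^sup>2"
          using wedge_grad_radial[OF qp, of a] by (simp add: P_def divide_inverse mult.commute)
        also have "\<dots> \<le> 2 * N q / (N q)\<^sup>2" using absP[of q] by (intro divide_right_mono) auto
        also have "\<dots> = 2 / N q" using N by (simp add: power2_eq_square)
        finally show ?thesis .
      qed
      have 3: "\<Lambda> * (a / N q - 4 / R) \<le> \<Lambda> * wedge_lap a q"
        using wedge_lap_ge[of a q] a qp f \<Lambda> unfolding N_def by (intro mult_left_mono) auto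
      have 4: "8 * (1 / N q) \<le> \<Lambda> * a * (1 / N q)"
      proof (rule mult_right_mono)
        have "16 \<le> \<Lambda> * k" using \<Lambda>(1) k by (simp add: field_simps)
        then show "8 \<le> \<Lambda> * a" by (simp add: a_def)
      qed (use N in simp)
      have 5: "\<Lambda> * (16 / R) \<le> \<Lambda> * (a / N q)"
      proof (rule mult_left_mono)
        have "N q \<le> k * R / 32" using N \<delta>(4) by (simp add: k_def)
        then show "16 / R \<le> a / N q" using N R_pos by (simp add: a_def field_simps)
      qed (use \<Lambda> in simp)
      have 6: "4 / R \<le> \<Lambda> * (4 / R)" using \<Lambda> R_pos by (simp add: field_simps)
      have "P q * (fst (q - ?p) / (fst q * (N q)\<^sup>2)) + ln (N q) * wedge_lap a q +
          2 * (wedge_grad a q \<bullet> ((q - ?p) /\<^sub>R (N q)\<^sup>2)) \<le> 4 / R - \<Lambda> * (a / N q - 4 / R) + 4 * (1 / N q)"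
        using 1 2 3 unfolding \<Lambda>_def by simp
      also have "\<dots> \<le> 0"
      proof -
        have "16 * (\<Lambda> / R) \<le> \<Lambda> * a * (1 / N q)" "4 / R \<le> 4 * (\<Lambda> / R)"
          "\<Lambda> * (a / N q - 4 / R) = \<Lambda> * a * (1 / N q) - 4 * (\<Lambda> / R)"
          using 5 6 by (simp_all add: algebra_simps)
        then show ?thesis using 4 by linarith
      qed
      finally show ?thesis
        using \<epsilon> unfolding L_def N_def by (intro mult_nonpos_nonpos) auto
    qed
    show "\<exists>n. outward_normal D q n \<and> g q \<bullet> n < 0"
      if q: "q \<in> \<Gamma>" "q \<noteq> ?p" "norm (q - ?p) < \<delta>" for q
    proof -
      obtain n where n: "outward_normal D q n" "norm (n - rim_normal) \<le> C * norm (q - ?p)"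
        "\<bar>n \<bullet> (q - ?p)\<bar> \<le> C * (norm (q - ?p))\<^sup>2"
        using normal[OF q] by blast
      have N: "0 < N q" "N q \<le> \<delta>" using q by (auto simp: N_def)
      have cn: "wedge_grad a q \<bullet> n \<le> - (k / 4)"
        using wedge_grad_normal[OF C n(2,3), of a] a q(2,3) \<delta>(3) by (simp add: k_def)
      have "16 \<le> - ln (N q)" using ln16[OF N] k16 by simp
      \<comment> \<open>The logarithm times the wall derivative of P has a definite sign and size at
        least \<open>k / 4\<close>; differentiating the logarithm instead gives only O(|q|), because
        the wall is tangential to second order.\<close>
      then have "1 * (k / 4) \<le> - ln (N q) * - (wedge_grad a q \<bullet> n)"
        using cn k by (intro mult_mono) auto
      moreover have "\<bar>P q / (N q)\<^sup>2 * (n \<bullet> (q - ?p))\<bar> < k / 4"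
      proof -
        have "\<bar>P q / (N q)\<^sup>2 * (n \<bullet> (q - ?p))\<bar> \<le> 2 * N q / (N q)\<^sup>2 * (C * (N q)\<^sup>2)"
          unfolding abs_mult using absP[of q] n(3)
          by (intro mult_mono) (auto simp: N_def abs_divide divide_right_mono)
        also have "\<dots> = 2 * (C * N q)" using N by (simp add: power2_eq_square)
        also have "\<dots> < k / 4"
        proof -
          have "N q < k / (8 * C)" using q \<delta>(3) by (simp add: N_def k_def)
          then show ?thesis using C by (simp add: field_simps)
        qed
        finally show ?thesis .
      qed
      moreover have "- ln (N q) * - (wedge_grad a q \<bullet> n) = ln (N q) * (wedge_grad a q \<bullet> n)"
        by simp
      ultimately have "0 < P q / (N q)\<^sup>2 * (n \<bullet> (q - ?p)) + ln (N q) * (wedge_grad a q \<bullet> n)"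
        by arith
      moreover have "g q \<bullet> n = - \<epsilon> * (P q / (N q)\<^sup>2 * (n \<bullet> (q - ?p)) + ln (N q) * (wedge_grad a q \<bullet> n))"
        by (simp add: g_def N_def inner_add_left inner_commute[of n] divide_inverse)
      ultimately have "g q \<bullet> n < 0" using \<epsilon> by (simp add: mult_pos_pos)
      then show ?thesis using n by blast
    qed
    show "E (r, 0) \<le> 0 \<or> snd (g (r, 0)) < - \<bar>\<nu>\<bar> * M" if r: "R - \<delta> < r" "r < R" for r
    proof -
      have "P (r, 0) < 0" using wedge_free_neg[OF r(2), of a] by (simp add: P_def a_def k_def)
      moreover have "ln (norm ((r, 0) - ?p)) < 0"
      proof -
        have nr: "norm ((r, 0) - ?p) = R - r" using r by (simp add: norm_Pair)
        have "16 / k \<le> - ln (R - r)" using r by (intro ln16) auto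
        then have "ln (R - r) < 0" using k16 by linarith
        then show ?thesis by (simp only: nr)
      qed
      ultimately have "E (r, 0) \<le> 0"
        using \<epsilon> by (simp add: E_def mult_neg_neg less_imp_le)
      then show ?thesis ..
    qed
    show "\<psi> q + E q \<le> M" if q: "q \<in> closure D" "norm (q - ?p) = \<delta>" for q
    proof (cases "0 \<le> P q")
      case True
      then have "\<psi> q \<le> M - m" using q by (intro m) (simp add: K_def N_def)
      moreover have "E q \<le> m"
      proof -
        have "E q = \<epsilon> * (P q * - ln \<delta>)" by (simp add: E_def q)
        also have "\<dots> \<le> \<epsilon> * (2 * \<delta> * - ln \<delta>)"
          using absP[of q] q ln\<delta> \<epsilon> by (intro mult_left_mono mult_right_mono) (auto simp: N_def)
        finally show ?thesis using \<epsilon>m by simp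
      qed
      ultimately show ?thesis by simp
    next
      case False
      then have "E q \<le> 0"
        using \<epsilon> ln\<delta> by (simp add: E_def q mult_neg_neg less_imp_le)
      then show ?thesis using M[OF q(1)] by simp
    qed
    show "\<exists>\<delta>'>0. \<forall>q\<in>closure D. q \<noteq> ?p \<longrightarrow> norm (q - ?p) < \<delta>' \<longrightarrow> E q \<le> \<eta>" if \<eta>: "0 < \<eta>" for \<eta>
    \<comment> \<open>E is at most 4 \<epsilon> times the square root of |q|, hence the square in
      the radius.\<close>
    proof (intro exI[of _ "min \<delta> ((\<eta> / (4 * \<epsilon>))\<^sup>2)"] conjI ballI impI)
      show "0 < min \<delta> ((\<eta> / (4 * \<epsilon>))\<^sup>2)" using \<delta>(1) \<eta> \<epsilon> by simp
      fix q assume q: "q \<noteq> ?p" "norm (q - ?p) < min \<delta> ((\<eta> / (4 * \<epsilon>))\<^sup>2)"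
      have N: "0 < N q" "N q \<le> \<delta>" using q by (auto simp: N_def)
      have "sqrt (N q) \<le> sqrt ((\<eta> / (4 * \<epsilon>))\<^sup>2)"
        using q by (intro real_sqrt_le_mono) (simp add: N_def)
      then have sq: "sqrt (N q) \<le> \<eta> / (4 * \<epsilon>)" using \<eta> \<epsilon> by simp
      have "E q = \<epsilon> * (P q * - ln (N q))" by (simp add: E_def N_def)
      also have "\<dots> \<le> \<epsilon> * (2 * N q * - ln (N q))"
        using absP[of q] \<epsilon> ln16[OF N] k16 by (intro mult_left_mono mult_right_mono) auto
      also have "\<dots> \<le> \<epsilon> * (2 * (2 * sqrt (N q)))"
        using neg_ln_le_sqrt[OF N(1)] \<epsilon> by (intro mult_left_mono) auto
      also have "\<dots> \<le> \<eta>" using sq \<epsilon> by (simp add: field_simps)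
      finally show "E q \<le> \<eta>" .
    qed
  qed
  show ?thesis
    using \<epsilon> main unfolding E_def P_def a_def k_def by (intro exI[of _ \<epsilon>]) simp
qed

text \<open>The barrier is \<open>\<kappa> + \<zeta> ln |q| + l P\<close> with \<open>P = wedge (- cos \<alpha> / 4)\<close>: the slope \<open>l\<close> beats the flux
  through the free surface, and \<open>\<zeta> ln |q|\<close>, with \<open>\<zeta> \<rightarrow> 0\<close> at the end, removes the rim from the
  comparison.  The smaller coefficient of \<open>|q|\<close> leaves room for \<open>\<kappa> > 0\<close> on the arc \<open>|q| = \<delta>\<close>.\<close>

lemma rim_below_bound:
  assumes M: "\<And>q. q \<in> closure D \<Longrightarrow> \<psi> q \<le> M"
  shows "\<psi> (R, 0) < M"
proof -
  let ?p = "(R, 0) :: real \<times> real"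
  define k where "k = - cos \<alpha>"
  have k: "0 < k" "k < 1" using cos_angle by (auto simp: k_def)
  have pcl: "?p \<in> closure D" using wall_closure[OF rim] by blast
  obtain \<delta>\<^sub>0 C where \<delta>\<^sub>0: "0 < \<delta>\<^sub>0" and C: "0 < C" and normal\<^sub>0: "\<And>q. q \<in> \<Gamma> \<Longrightarrow> q \<noteq> ?p \<Longrightarrow> norm (q - ?p) < \<delta>\<^sub>0 \<Longrightarrow>
      \<exists>n. outward_normal D q n \<and> norm (n - rim_normal) \<le> C * norm (q - ?p) \<and>
          \<bar>n \<bullet> (q - ?p)\<bar> \<le> C * (norm (q - ?p))\<^sup>2"
    using rim_wall_normal by blast
  define \<delta>\<^sub>1 where "\<delta>\<^sub>1 = min (min \<delta>\<^sub>0 (R / 4)) (min (k / (16 * C)) (min (k * R / 32) (exp (16 / cos \<alpha>))))"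
  have \<delta>\<^sub>1: "0 < \<delta>\<^sub>1" "\<delta>\<^sub>1 \<le> \<delta>\<^sub>0" "\<delta>\<^sub>1 \<le> R / 4" "\<delta>\<^sub>1 \<le> k / (16 * C)" "\<delta>\<^sub>1 \<le> k * R / 32" "\<delta>\<^sub>1 \<le> exp (16 / cos \<alpha>)"
    using \<delta>\<^sub>0 R_pos k C unfolding \<delta>\<^sub>1_def by (auto simp: min_le_iff_disj)
  have "k / (16 * C) < k / (8 * C)" using k C by (simp add: field_simps)
  then have \<delta>\<^sub>1C: "\<delta>\<^sub>1 < k / (8 * C)" using \<delta>\<^sub>1(4) by linarith
  have normal: "\<exists>n. outward_normal D q n \<and> norm (n - rim_normal) \<le> C * norm (q - ?p) \<and>
          \<bar>n \<bullet> (q - ?p)\<bar> \<le> C * (norm (q - ?p))\<^sup>2" if "q \<in> \<Gamma>" "q \<noteq> ?p" "norm (q - ?p) < \<delta>\<^sub>1" for q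
    using that \<delta>\<^sub>1(2) by (intro normal\<^sub>0) auto
  obtain \<epsilon> where \<epsilon>: "0 < \<epsilon>" and growth: "\<And>q. q \<in> closure D \<Longrightarrow> q \<noteq> ?p \<Longrightarrow> norm (q - ?p) \<le> \<delta>\<^sub>1 \<Longrightarrow>
    \<psi> q - \<epsilon> * (wedge (k / 2) q * ln (norm (q - ?p))) \<le> M"
  proof -
    have "\<delta>\<^sub>1 < R / 2" using \<delta>\<^sub>1 R_pos by linarith
    from rim_log_growth[OF M C \<delta>\<^sub>1(1) this \<delta>\<^sub>1C[unfolded k_def] \<delta>\<^sub>1(5)[unfolded k_def] \<delta>\<^sub>1(6) normal] that
    show ?thesis unfolding k_def by blast
  qed
  have M0: "0 \<le> M" using nonneg[OF pcl] M[OF pcl] by simp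
  \<comment> \<open>In turn the summands beat the flux \<open>\<bar>\<nu>\<bar> * M\<close>, the
    axial Laplacian of the logarithm, and its wall derivative, which is at most \<open>C\<close>
    because \<zeta> \<le> 1.\<close>
  define l where "l = \<bar>\<nu>\<bar> * M / sin \<alpha> + 16 / (R * k) + 4 * C / k + 1"
  have t: "0 \<le> \<bar>\<nu>\<bar> * M / sin \<alpha>" "0 \<le> 16 / (R * k)" "0 \<le> 4 * C / k"
    using M0 sin_angle R_pos k C by auto
  have l: "1 \<le> l" "\<bar>\<nu>\<bar> * M < l * sin \<alpha>" "16 / (R * k) \<le> l" "C < l * (k / 4)"
  proof -
    show "1 \<le> l" "16 / (R * k) \<le> l" using t unfolding l_def by linarith+
    have "\<bar>\<nu>\<bar> * M / sin \<alpha> < l" "4 * C / k < l" using t unfolding l_def by linarith+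
    then show "\<bar>\<nu>\<bar> * M < l * sin \<alpha>" "C < l * (k / 4)"
      using sin_angle k by (simp_all add: pos_divide_less_eq)
  qed
  \<comment> \<open>Chosen after \<epsilon> and \<open>l\<close>, so that \<epsilon> |ln \<delta>|
    \<ge> 2 l on the arc.\<close>
  define \<delta> where "\<delta> = min \<delta>\<^sub>1 (exp (- (2 * l / \<epsilon>)))"
  have \<delta>: "0 < \<delta>" "\<delta> \<le> \<delta>\<^sub>1" "\<delta> \<le> exp (- (2 * l / \<epsilon>))" using \<delta>\<^sub>1 by (auto simp: \<delta>_def)
  have ln\<delta>: "2 * l / \<epsilon> \<le> - ln \<delta>"
  proof -
    have "ln \<delta> \<le> ln (exp (- (2 * l / \<epsilon>)))" by (rule iffD2[OF ln_le_cancel_iff]) (use \<delta> in auto)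
    then show ?thesis by simp
  qed
  have "0 \<le> 2 * l / \<epsilon>" using l \<epsilon> by simp
  then have ln\<delta>0: "ln \<delta> \<le> 0" using ln\<delta> by linarith
  \<comment> \<open>On the arc the wedge with coefficient \<open>k / 2\<close>, called Q below,
    exceeds P by k \<delta> / 4. Taking half of this gap, \<kappa> + l P > 0 still implies Q > 0 and
    \<kappa> + l P \<le> 2 l Q, which the logarithmic bound covers.\<close>
  define \<kappa> where "\<kappa> = l * (k * \<delta> / 8)"
  have \<kappa>: "0 < \<kappa>" using l k \<delta> by (simp add: \<kappa>_def)
  define P where "P = wedge (k / 4)"
  have absP: "\<bar>P q\<bar> \<le> 2 * norm (q - ?p)" for q
    unfolding P_def using k by (intro abs_wedge_le) auto
  have step: "\<psi> q + (\<kappa> + (\<zeta> * ln (norm (q - ?p)) + l * P q)) \<le> M"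
    if \<zeta>: "0 < \<zeta>" "\<zeta> \<le> 1" and q: "q \<in> closure D" "q \<noteq> ?p" "norm (q - ?p) \<le> \<delta>" for \<zeta> q
  proof -
    define E where "E q = \<kappa> + (\<zeta> * ln (norm (q - ?p)) + l * P q)" for q
    define g where "g q = 0 + (\<zeta> *\<^sub>R ((q - ?p) /\<^sub>R (norm (q - ?p))\<^sup>2) + l *\<^sub>R wedge_grad (k / 4) q)" for q
    define L where "L q = 0 + (\<zeta> * (fst (q - ?p) / (fst q * (norm (q - ?p))\<^sup>2)) + l * wedge_lap (k / 4) q)" for q
    have jet: "axial_jet E (g q) (L q) q" if "q \<noteq> ?p" for q
      unfolding E_def[abs_def] g_def L_def P_def
      by (intro axial_jet_add axial_jet_const axial_jet_cmult axial_jet_wedge axial_jet_ln_norm that)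
    have "\<psi> q + E q \<le> M"
    proof (rule rim_comparison[OF \<delta>(1) _ M jet _ _ _ _ _ q])
      show "\<delta> < R" using \<delta> \<delta>\<^sub>1 R_pos by linarith
      show "0 \<le> L q" if q: "q \<in> D" "norm (q - ?p) < \<delta>" for q
      proof -
        define N where "N = norm (q - ?p)"
        have qp: "q \<noteq> ?p" using D_quadrant[OF q(1)] by auto
        have N: "0 < N" "N \<le> \<delta>" using qp q by (auto simp: N_def)
        have fN: "\<bar>fst (q - ?p)\<bar> \<le> N" unfolding N_def by (rule abs_fst_le_norm)
        have f: "R / 2 \<le> fst q" using fN N \<delta>(2) \<delta>\<^sub>1(3) R_pos by (simp add: abs_le_iff)
        have fp: "0 < fst q" using f R_pos by linarith
        \<comment> \<open>What is left of the logarithm's axial Laplacian is of order 1 / |q| and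
          costs at most half of the gain l k / (4 |q|).\<close>
        have "- (2 / R * (1 / N)) \<le> \<zeta> * (fst (q - ?p) / (fst q * N\<^sup>2))"
        proof -
          have "\<bar>\<zeta> * (fst (q - ?p) / (fst q * N\<^sup>2))\<bar> = \<zeta> * (\<bar>fst (q - ?p)\<bar> / (fst q * N\<^sup>2))"
            using \<zeta> fp by (simp add: abs_mult)
          also have "\<dots> \<le> 1 * (N / (fst q * N\<^sup>2))"
            using \<zeta> fN fp by (intro mult_mono divide_right_mono) auto
          also have "\<dots> = 1 / fst q * (1 / N)" using N by (simp add: power2_eq_square)
          also have "\<dots> \<le> 2 / R * (1 / N)"
            using f fp N R_pos by (intro mult_right_mono) (auto simp: field_simps)
          finally show ?thesis
            using abs_ge_minus_self[of "\<zeta> * (fst (q - ?p) / (fst q * N\<^sup>2))"] by linarith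
        qed
        moreover have "l * (k / 4 / N - 4 / R) \<le> l * wedge_lap (k / 4) q"
          using wedge_lap_ge[of "k / 4" q] k qp f l unfolding N_def by (intro mult_left_mono) auto
        moreover have "2 / R * (1 / N) \<le> l * (k / 8) * (1 / N)"
        proof (rule mult_right_mono)
          show "2 / R \<le> l * (k / 8)" using l(3) k R_pos by (simp add: field_simps)
        qed (use N in simp)
        moreover have "l * (4 / R) \<le> l * (k / 8 * (1 / N))"
        proof (rule mult_left_mono)
          have "N \<le> k * R / 32" using N \<delta> \<delta>\<^sub>1 by linarith
          then show "4 / R \<le> k / 8 * (1 / N)" using N R_pos by (simp add: field_simps)
        qed (use l in simp)
        moreover have "l * (k / 4 / N - 4 / R) = l * (k / 8) * (1 / N) + l * (k / 8 * (1 / N)) - l * (4 / R)"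
          by (simp add: algebra_simps)
        ultimately show ?thesis unfolding L_def N_def[symmetric] by linarith
      qed
      show "\<exists>n. outward_normal D q n \<and> g q \<bullet> n < 0"
        if q: "q \<in> \<Gamma>" "q \<noteq> ?p" "norm (q - ?p) < \<delta>" for q
      proof -
        define N where "N = norm (q - ?p)"
        have N: "0 < N" using q by (simp add: N_def)
        have "norm (q - ?p) < \<delta>\<^sub>1" using q \<delta> by linarith
        then obtain n where n: "outward_normal D q n" "norm (n - rim_normal) \<le> C * norm (q - ?p)"
          "\<bar>n \<bullet> (q - ?p)\<bar> \<le> C * (norm (q - ?p))\<^sup>2"
          using normal[OF q(1,2)] by blast
        have "norm (q - ?p) < - cos \<alpha> / (8 * C)" using q \<delta> \<delta>\<^sub>1C by (simp add: k_def)
        then have "wedge_grad (k / 4) q \<bullet> n \<le> - (k / 4)"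
          using wedge_grad_normal[OF C n(2,3), of "k / 4"] k q(2) by (simp add: k_def)
        then have "l * (wedge_grad (k / 4) q \<bullet> n) \<le> l * - (k / 4)"
          using l by (intro mult_left_mono) auto
        moreover have "\<zeta> * (1 / N\<^sup>2 * (n \<bullet> (q - ?p))) \<le> C"
        proof -
          have "\<zeta> * (1 / N\<^sup>2 * (n \<bullet> (q - ?p))) \<le> \<zeta> * (1 / N\<^sup>2 * (C * N\<^sup>2))"
          proof (intro mult_left_mono)
            show "n \<bullet> (q - ?p) \<le> C * N\<^sup>2" unfolding N_def by (rule abs_le_D1[OF n(3)])
          qed (use \<zeta> in simp_all)
          also have "\<dots> = \<zeta> * C" using N by simp
          also have "\<dots> \<le> C" using \<zeta> C by (simp add: mult_left_le_one_le)
          finally show ?thesis .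
        qed
        moreover have "g q \<bullet> n = \<zeta> * (1 / N\<^sup>2 * (n \<bullet> (q - ?p))) + l * (wedge_grad (k / 4) q \<bullet> n)"
          unfolding g_def N_def inner_add_left inner_scaleR_left inner_commute[of n]
          by (simp only: divide_inverse inner_zero_left add_0 mult_1)
        ultimately have "g q \<bullet> n < 0" using l(4) by linarith
        then show ?thesis using n(1) by blast
      qed
      show "E (r, 0) \<le> 0 \<or> snd (g (r, 0)) < - \<bar>\<nu>\<bar> * M" if r: "R - \<delta> < r" "r < R" for r
      proof -
        have "snd (g (r, 0)) = l * snd rim_slope" by (simp add: g_def wedge_grad_def)
        also have "\<dots> \<le> l * - sin \<alpha>" using snd_rim_slope l by (intro mult_left_mono) auto
        also have "\<dots> < - \<bar>\<nu>\<bar> * M" using l(2) by simp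
        finally show ?thesis ..
      qed
      show "\<psi> q + E q \<le> M" if q: "q \<in> closure D" "norm (q - ?p) = \<delta>" for q
      \<comment> \<open>Where \<kappa> + l P \<le> 0 the barrier is not positive and \<psi> \<le> M
        is enough; elsewhere \<open>growth\<close> supplies the room.\<close>
      proof (cases "\<kappa> + l * P q \<le> 0")
        case True
        moreover have "\<zeta> * ln \<delta> \<le> 0" using \<zeta> ln\<delta>0 by (simp add: mult_nonneg_nonpos)
        ultimately have "E q \<le> 0" by (simp add: E_def q)
        then show ?thesis using M[OF q(1)] by simp
      next
        case False
        define Q where "Q = wedge (k / 2) q"
        have QP: "Q = P q + k * \<delta> / 4" by (simp add: Q_def P_def wedge_def q(2))
        have "0 < l * (k * \<delta> / 8 + P q)" using False by (simp add: \<kappa>_def distrib_left)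
        then have Pk: "- (k * \<delta> / 8) < P q" using l by (simp add: zero_less_mult_iff)
        have k\<delta>: "0 < k * \<delta>" using k \<delta> by simp
        have Q0: "0 < Q" using QP Pk k\<delta> by linarith
        have "\<kappa> + l * P q \<le> l * (2 * Q)"
        proof -
          have "k * \<delta> / 8 + P q \<le> 2 * Q" using QP Pk k\<delta> by linarith
          then have "l * (k * \<delta> / 8 + P q) \<le> l * (2 * Q)" using l by (intro mult_left_mono) auto
          then show ?thesis by (simp add: \<kappa>_def distrib_left)
        qed
        also have "\<dots> = \<epsilon> * (Q * (2 * l / \<epsilon>))" using \<epsilon> by simp
        also have "\<dots> \<le> \<epsilon> * (Q * - ln \<delta>)"
          using ln\<delta> Q0 \<epsilon> by (intro mult_left_mono) auto
        finally have "\<kappa> + l * P q \<le> \<epsilon> * (Q * - ln \<delta>)" .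
        moreover have "\<zeta> * ln \<delta> \<le> 0" using \<zeta> ln\<delta>0 by (simp add: mult_nonneg_nonpos)
        moreover have "\<psi> q - \<epsilon> * (Q * ln \<delta>) \<le> M"
          using growth[OF q(1)] q(2) \<delta> by (auto simp: Q_def)
        ultimately show ?thesis by (simp add: E_def q)
      qed
      show "\<exists>\<delta>'>0. \<forall>q\<in>closure D. q \<noteq> ?p \<longrightarrow> norm (q - ?p) < \<delta>' \<longrightarrow> E q \<le> \<eta>" if \<eta>: "0 < \<eta>" for \<eta>
      \<comment> \<open>For |q| < 1 the rest of the barrier is at most \<kappa> + 2 l, and on this
        ball \<zeta> ln |q| outweighs it.\<close>
      proof (intro exI[of _ "min 1 (exp (- ((\<kappa> + 2 * l) / \<zeta>)))"] conjI ballI impI)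
        show "0 < min 1 (exp (- ((\<kappa> + 2 * l) / \<zeta>)))" by simp
        fix q assume q: "q \<noteq> ?p" "norm (q - ?p) < min 1 (exp (- ((\<kappa> + 2 * l) / \<zeta>)))"
        have N: "0 < norm (q - ?p)" using q by simp
        have "ln (norm (q - ?p)) \<le> ln (exp (- ((\<kappa> + 2 * l) / \<zeta>)))"
          by (rule iffD2[OF ln_le_cancel_iff]) (use q in auto)
        then have "\<zeta> * ln (norm (q - ?p)) \<le> \<zeta> * - ((\<kappa> + 2 * l) / \<zeta>)"
          using \<zeta> by (intro mult_left_mono) auto
        also have "\<dots> = - (\<kappa> + 2 * l)" using \<zeta> by simp
        finally have "\<zeta> * ln (norm (q - ?p)) \<le> - (\<kappa> + 2 * l)" .
        moreover have "l * P q \<le> l * 2"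
          using absP[of q] q l by (intro mult_left_mono) (auto simp: abs_le_iff)
        ultimately show "E q \<le> \<eta>" using \<eta> by (simp add: E_def)
      qed
    qed
    then show ?thesis by (simp add: E_def)
  qed
  \<comment> \<open>\<kappa>, \<open>l\<close> and \<delta> do not depend on \<zeta>, so \<zeta> may
    tend to 0 at each fixed \<open>q\<close>.\<close>
  have limit: "\<psi> q + \<kappa> + l * P q \<le> M" if q: "q \<in> closure D" "q \<noteq> ?p" "norm (q - ?p) \<le> \<delta>" for q
  proof (rule ccontr)
    assume neg: "\<not> ?thesis"
    define d where "d = \<psi> q + \<kappa> + l * P q - M"
    have d: "0 < d" using neg by (simp add: d_def)
    define b where "b = \<bar>ln (norm (q - ?p))\<bar> + 1"
    have b: "1 \<le> b" "- b \<le> ln (norm (q - ?p))" by (auto simp: b_def)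
    define \<zeta> where "\<zeta> = min 1 (d / (2 * b))"
    have \<zeta>: "0 < \<zeta>" "\<zeta> \<le> 1" "\<zeta> \<le> d / (2 * b)" using d b by (auto simp: \<zeta>_def)
    have "\<zeta> * - b \<le> \<zeta> * ln (norm (q - ?p))" using b \<zeta> by (intro mult_left_mono) auto
    moreover have "\<zeta> * b \<le> d / 2" using \<zeta>(3) b by (simp add: field_simps)
    ultimately show False
      using step[OF \<zeta>(1,2) q] d by (simp add: d_def)
  qed
  have "0 < \<kappa> / 4" using \<kappa> by simp
  then obtain d where d: "d > 0" "\<And>q. q \<in> closure D \<Longrightarrow> dist q ?p < d \<Longrightarrow> dist (\<psi> q) (\<psi> ?p) < \<kappa> / 4"
    using cont pcl unfolding continuous_on_iff by blast
  \<comment> \<open>On this ball l P is at most \<kappa> / 4 in size; continuity of \<psi> costs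
    another \<kappa> / 4, so at least \<kappa> / 2 remains at the rim.\<close>
  define d' where "d' = min (min d \<delta>) (\<kappa> / (8 * l))"
  have d': "0 < d'" "d' \<le> d" "d' \<le> \<delta>" "d' \<le> \<kappa> / (8 * l)"
    using d \<delta> \<kappa> l unfolding d'_def by (auto simp: min_le_iff_disj)
  obtain x where x: "x \<in> D" "dist x ?p < d'"
    using pcl d' unfolding closure_approachable by blast
  have xc: "x \<in> closure D" using x closure_subset by blast
  have xp: "x \<noteq> ?p" using D_quadrant[OF x(1)] by auto
  have nx: "norm (x - ?p) < d'" using x by (simp add: dist_norm)
  have "\<bar>\<psi> x - \<psi> ?p\<bar> < \<kappa> / 4" using d(2)[OF xc] x d' by (simp add: dist_real_def)
  moreover have "\<psi> x + \<kappa> + l * P x \<le> M" using limit[OF xc xp] nx d' by simp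
  moreover have "\<bar>l * P x\<bar> \<le> \<kappa> / 4"
  proof -
    have "\<bar>l * P x\<bar> \<le> l * (2 * d')"
      unfolding abs_mult using absP[of x] nx l by (intro mult_mono) auto
    also have "\<dots> \<le> l * (2 * (\<kappa> / (8 * l)))" using d' l by (intro mult_left_mono) auto
    also have "\<dots> = \<kappa> / 4" using l by simp
    finally show ?thesis .
  qed
  ultimately show ?thesis using \<kappa> by arith
qed

section \<open>From the rim estimate to the high spot and the two signs of the radial
  derivative\<close>

lemma strip_below_free_surface:
  assumes "0 < a" "b < R"
  shows "\<exists>\<eta>\<^sub>0>0. \<forall>\<eta> r. 0 < \<eta> \<longrightarrow> \<eta> < \<eta>\<^sub>0 \<longrightarrow> a \<le> r \<longrightarrow> r \<le> b \<longrightarrow> (r, - \<eta>) \<in> D"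
proof -
  \<comment> \<open>The implication admits all points with y \<ge> 0, so \<open>S\<close> contains
    full balls around the segment and compactness yields one depth for all of it.\<close>
  define S where "S = {q. snd q < 0 \<longrightarrow> q \<in> D}"
  have "compact ({a..b} \<times> {0::real})" by (intro compact_Times) auto
  moreover have "open (interior S)" by simp
  moreover have "{a..b} \<times> {0} \<subseteq> interior S"
  proof
    fix q assume "q \<in> {a..b} \<times> {0::real}"
    then obtain r where r: "q = (r, 0)" "0 < r" "r < R" using assms by (cases q) auto
    obtain \<delta> where \<delta>: "\<delta> > 0" "\<forall>q\<in>ball (r, 0) \<delta>. snd q < 0 \<longrightarrow> q \<in> D"
      using free_local[OF r(2,3)] by blast
    then have "ball q \<delta> \<subseteq> S" unfolding S_def r(1) by blast
    then show "q \<in> interior S" using \<delta>(1) mem_interior by blast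
  qed
  ultimately obtain e where e: "e > 0" "(\<Union>x\<in>{a..b} \<times> {0}. ball x e) \<subseteq> interior S"
    by (rule compact_subset_open_imp_ball_epsilon_subset)
  have "(r, - \<eta>) \<in> D" if "0 < \<eta>" "\<eta> < e" "a \<le> r" "r \<le> b" for \<eta> r
  proof -
    have "(r, - \<eta>) \<in> ball (r, 0) e" using that by (simp add: dist_Pair_Pair)
    moreover have "(r, 0) \<in> {a..b} \<times> {0::real}" using that by simp
    ultimately have "(r, - \<eta>) \<in> S" using e interior_subset by blast
    then show ?thesis using that by (simp add: S_def)
  qed
  then show ?thesis using e by blast
qed

lemma free_closure: "0 \<le> r \<Longrightarrow> r \<le> R \<Longrightarrow> (r, 0) \<in> closure D"
proof -
  assume r: "0 \<le> r" "r \<le> R"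
  have in_cl: "(s, 0) \<in> closure D" if "s \<in> {0<..<R}" for s
  proof -
    have s: "0 < s" "s < R" using that by auto
    obtain \<eta>\<^sub>0 where \<eta>\<^sub>0: "\<eta>\<^sub>0 > 0" "\<And>\<eta> r. 0 < \<eta> \<Longrightarrow> \<eta> < \<eta>\<^sub>0 \<Longrightarrow> s \<le> r \<Longrightarrow> r \<le> s \<Longrightarrow> (r, - \<eta>) \<in> D"
      using strip_below_free_surface[OF s] by blast
    show ?thesis
      unfolding closure_approachable
    proof (intro allI impI)
      fix e :: real assume e: "0 < e"
      define \<eta> where "\<eta> = min e \<eta>\<^sub>0 / 2"
      have \<eta>: "0 < \<eta>" "\<eta> < e" "\<eta> < \<eta>\<^sub>0" using e \<eta>\<^sub>0 by (auto simp: \<eta>_def)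
      have "dist (s, - \<eta>) (s, 0) < e" using \<eta> by (simp add: dist_Pair_Pair)
      then show "\<exists>y\<in>D. dist y (s, 0) < e" using \<eta>\<^sub>0(2) \<eta> by blast
    qed
  qed
  have "(\<lambda>s. (s, 0)) ` closure {0<..<R} \<subseteq> closure D"
    by (rule image_closure_subset) (auto intro!: continuous_intros in_cl)
  moreover have "r \<in> closure {0<..<R}" using r R_pos by simp
  ultimately show ?thesis by blast
qed

text \<open>\<open>d_r \<psi>\<close> is controlled only inside \<open>D\<close>, so the mean value
  theorem is applied at a small depth; end values within half of the gap keep the strict
  inequality.\<close>

lemma radial_derivative_between:
  assumes "0 < a" "a < b" "b < R"
  shows "\<psi> (a, 0) < \<psi> (b, 0) \<Longrightarrow> \<exists>p\<in>D. 0 < d_r \<psi> p"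
    and "\<psi> (b, 0) < \<psi> (a, 0) \<Longrightarrow> \<exists>p\<in>D. d_r \<psi> p < 0"
proof -
  obtain \<eta>\<^sub>0 where \<eta>\<^sub>0: "\<eta>\<^sub>0 > 0" and strip: "\<And>\<eta> r. 0 < \<eta> \<Longrightarrow> \<eta> < \<eta>\<^sub>0 \<Longrightarrow> a \<le> r \<Longrightarrow> r \<le> b \<Longrightarrow> (r, - \<eta>) \<in> D"
    using strip_below_free_surface[OF assms(1,3)] by blast
  have approx: "\<exists>d>0. \<forall>\<eta>. 0 < \<eta> \<longrightarrow> \<eta> < d \<longrightarrow> \<eta> < \<eta>\<^sub>0 \<longrightarrow> \<bar>\<psi> (r, - \<eta>) - \<psi> (r, 0)\<bar> < e"
    if r: "a \<le> r" "r \<le> b" and e: "0 < e" for r e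
  proof -
    have "(r, 0) \<in> closure D" using r assms by (intro free_closure) auto
    then obtain d where d: "d > 0" "\<And>q. q \<in> closure D \<Longrightarrow> dist q (r, 0) < d \<Longrightarrow> dist (\<psi> q) (\<psi> (r, 0)) < e"
      using cont e unfolding continuous_on_iff by blast
    have "\<bar>\<psi> (r, - \<eta>) - \<psi> (r, 0)\<bar> < e" if "0 < \<eta>" "\<eta> < d" "\<eta> < \<eta>\<^sub>0" for \<eta>
      using d(2)[of "(r, - \<eta>)"] strip[of \<eta> r] that r closure_subset
      by (auto simp: dist_Pair_Pair dist_real_def)
    then show ?thesis using d(1) by blast
  qed
  have mvt: "\<exists>\<eta> p. 0 < \<eta> \<and> \<eta> < \<eta>\<^sub>0 \<and> \<bar>\<psi> (a, - \<eta>) - \<psi> (a, 0)\<bar> < e \<and> \<bar>\<psi> (b, - \<eta>) - \<psi> (b, 0)\<bar> < e \<and>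
     p \<in> D \<and> \<psi> (b, - \<eta>) - \<psi> (a, - \<eta>) = (b - a) * d_r \<psi> p" if e: "0 < e" for e
  proof -
    obtain d1 where d1: "d1 > 0" "\<And>\<eta>. 0 < \<eta> \<Longrightarrow> \<eta> < d1 \<Longrightarrow> \<eta> < \<eta>\<^sub>0 \<Longrightarrow> \<bar>\<psi> (a, - \<eta>) - \<psi> (a, 0)\<bar> < e"
      using approx[of a e] assms e by auto
    obtain d2 where d2: "d2 > 0" "\<And>\<eta>. 0 < \<eta> \<Longrightarrow> \<eta> < d2 \<Longrightarrow> \<eta> < \<eta>\<^sub>0 \<Longrightarrow> \<bar>\<psi> (b, - \<eta>) - \<psi> (b, 0)\<bar> < e"
      using approx[of b e] assms e by auto
    define \<eta> where "\<eta> = min \<eta>\<^sub>0 (min d1 d2) / 2"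
    have \<eta>: "0 < \<eta>" "\<eta> < \<eta>\<^sub>0" "\<eta> < d1" "\<eta> < d2" using \<eta>\<^sub>0 d1 d2 by (auto simp: \<eta>_def)
    have der: "((\<lambda>s. \<psi> (s, - \<eta>)) has_real_derivative d_r \<psi> (s, - \<eta>)) (at s)" if "a \<le> s" "s \<le> b" for s
      using C2_partial_derivatives(1)[OF open_D C2 strip[OF \<eta>(1,2) that]] by (rule eventually_nhds_x_imp_x)
    obtain z where z: "a < z" "z < b" "\<psi> (b, - \<eta>) - \<psi> (a, - \<eta>) = (b - a) * d_r \<psi> (z, - \<eta>)"
      using MVT2[OF assms(2), of "\<lambda>s. \<psi> (s, - \<eta>)" "\<lambda>s. d_r \<psi> (s, - \<eta>)"] der by blast
    have "(z, - \<eta>) \<in> D" using z by (intro strip \<eta>) auto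
    then show ?thesis using \<eta> d1(2) d2(2) z(3) by blast
  qed
  show "\<exists>p\<in>D. 0 < d_r \<psi> p" if "\<psi> (a, 0) < \<psi> (b, 0)"
  proof -
    have "0 < (\<psi> (b, 0) - \<psi> (a, 0)) / 2" using that by simp
    from mvt[OF this] obtain \<eta> p where "p \<in> D" and eq: "\<psi> (b, - \<eta>) - \<psi> (a, - \<eta>) = (b - a) * d_r \<psi> p"
      and h: "\<bar>\<psi> (a, - \<eta>) - \<psi> (a, 0)\<bar> < (\<psi> (b, 0) - \<psi> (a, 0)) / 2" "\<bar>\<psi> (b, - \<eta>) - \<psi> (b, 0)\<bar> < (\<psi> (b, 0) - \<psi> (a, 0)) / 2"
      by blast
    have "0 < \<psi> (b, - \<eta>) - \<psi> (a, - \<eta>)" using h unfolding abs_less_iff by (auto simp: field_simps)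
    then have "0 < (b - a) * d_r \<psi> p" using eq by simp
    then show ?thesis using \<open>p \<in> D\<close> assms by (auto simp: zero_less_mult_iff)
  qed
  show "\<exists>p\<in>D. d_r \<psi> p < 0" if "\<psi> (b, 0) < \<psi> (a, 0)"
  proof -
    have "0 < (\<psi> (a, 0) - \<psi> (b, 0)) / 2" using that by simp
    from mvt[OF this] obtain \<eta> p where "p \<in> D" and eq: "\<psi> (b, - \<eta>) - \<psi> (a, - \<eta>) = (b - a) * d_r \<psi> p"
      and h: "\<bar>\<psi> (a, - \<eta>) - \<psi> (a, 0)\<bar> < (\<psi> (a, 0) - \<psi> (b, 0)) / 2" "\<bar>\<psi> (b, - \<eta>) - \<psi> (b, 0)\<bar> < (\<psi> (a, 0) - \<psi> (b, 0)) / 2"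
      by blast
    have "\<psi> (b, - \<eta>) - \<psi> (a, - \<eta>) < 0" using h unfolding abs_less_iff by (auto simp: field_simps)
    then have "(b - a) * d_r \<psi> p < 0" using eq by simp
    then show ?thesis using \<open>p \<in> D\<close> assms by (auto simp: mult_less_0_iff)
  qed
qed

theorem interior_high_spot:
  "(\<exists>r. 0 < r \<and> r < R \<and> (\<forall>p\<in>closure D. \<psi> p \<le> \<psi> (r, 0))) \<and>
   (\<exists>p\<in>D. 0 < d_r \<psi> p) \<and> (\<exists>p\<in>D. d_r \<psi> p < 0)"
proof -
  have "closure D \<noteq> {}" using wall_closure[OF rim] by auto
  then obtain q where q: "q \<in> closure D" "\<And>p. p \<in> closure D \<Longrightarrow> \<psi> p \<le> \<psi> q"
    using continuous_attains_sup[OF compact_closure _ cont] by blast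
  define M where "M = \<psi> q"
  have M: "\<psi> p \<le> M" if "p \<in> closure D" for p using q(2)[OF that] by (simp add: M_def)
  have Mpos: "0 < M"
  proof -
    obtain p where "p \<in> D" using \<open>closure D \<noteq> {}\<close> by auto
    then show ?thesis using pos[of p] M[of p] closure_subset[of D] by auto
  qed
  have rimM: "\<psi> (R, 0) < M" by (rule rim_below_bound[OF M])
  obtain r where r: "0 < r" "r < R" "q = (r, 0)"
    using closure_cases[OF q(1)]
  proof (elim disjE)
    assume "q \<in> D"
    then show ?thesis using not_interior_max[of q] M closure_subset unfolding M_def by fastforce
  next
    assume "q \<in> \<Gamma>"
    moreover have "q \<noteq> (R, 0)" using rimM by (auto simp: M_def)
    ultimately show ?thesis using wall_not_max[of q] M unfolding M_def by fastforce
  qed (use Mpos that in \<open>auto simp: M_def\<close>)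
  have rM: "\<psi> (r, 0) = M" using r by (simp add: M_def)
  have cf: "continuous_on {0..R} (\<lambda>s. \<psi> (s, 0))"
    by (rule continuous_on_compose2[OF cont]) (auto intro!: continuous_intros free_closure)
  have near: "\<exists>d>0. \<forall>s\<in>{0..R}. \<bar>s - t\<bar> < d \<longrightarrow> \<psi> (s, 0) < M" if t: "t \<in> {0..R}" "\<psi> (t, 0) < M" for t
  proof -
    have "0 < M - \<psi> (t, 0)" using t by simp
    then obtain d where d: "d > 0" "\<forall>s\<in>{0..R}. dist s t < d \<longrightarrow> dist (\<psi> (s, 0)) (\<psi> (t, 0)) < M - \<psi> (t, 0)"
      using cf t(1) unfolding continuous_on_iff by blast
    have "\<psi> (s, 0) < M" if "s \<in> {0..R}" "\<bar>s - t\<bar> < d" for s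
    proof -
      have "\<bar>\<psi> (s, 0) - \<psi> (t, 0)\<bar> < M - \<psi> (t, 0)"
        using d(2) that by (simp add: dist_real_def)
      then show ?thesis by arith
    qed
    then show ?thesis using d(1) by blast
  qed
  \<comment> \<open>All points of \<open>D\<close> and \<Gamma> have positive first coordinate, so
    only the axis alternative remains.\<close>
  have "\<psi> (0, 0) = 0"
    using closure_cases[OF free_closure[of 0]] R_pos D_quadrant[of "(0, 0)"] wall_closure[of "(0, 0)"] by auto
  then obtain d where d: "d > 0" "\<forall>s\<in>{0..R}. \<bar>s - 0\<bar> < d \<longrightarrow> \<psi> (s, 0) < M"
    using near[of 0] Mpos R_pos by auto
  define s where "s = min d r / 2"
  have s: "0 < s" "s < d" "s < r" using d r by (auto simp: s_def)
  then have "\<psi> (s, 0) < \<psi> (r, 0)" using d(2) r rM by simp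
  then have up: "\<exists>p\<in>D. 0 < d_r \<psi> p"
    by (rule radial_derivative_between(1)[OF s(1,3) r(2)])
  obtain d where d: "d > 0" "\<forall>s\<in>{0..R}. \<bar>s - R\<bar> < d \<longrightarrow> \<psi> (s, 0) < M"
    using near[of R] rimM R_pos by auto
  define s where "s = R - min d (R - r) / 2"
  have s: "s < R" "R - s < d" "r < s" using d r by (auto simp: s_def min_def field_simps)
  then have "\<psi> (s, 0) < \<psi> (r, 0)" using d(2) r rM by simp
  then have "\<exists>p\<in>D. d_r \<psi> p < 0"
    by (rule radial_derivative_between(2)[OF r(1) s(3,1)])
  with up show ?thesis
    using r M rM by (intro conjI exI[of _ r]) auto
qed

end

section \<open>Reduction of the spatial problem to the section\<close>

lemma lipschitz_graph:
  fixes W :: "'a::euclidean_space set"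
  assumes "bounded_lipschitz_domain W" "p \<in> frontier W"
  obtains U e g where "open U" "p \<in> U" "norm e = 1"
    "\<forall>x\<in>U. x \<in> W \<longleftrightarrow> x \<bullet> e < g (x - (x \<bullet> e) *\<^sub>R e)"
    "\<forall>x\<in>U \<inter> frontier W. x \<bullet> e = g (x - (x \<bullet> e) *\<^sub>R e)"
    "open {x \<in> U. g (x - (x \<bullet> e) *\<^sub>R e) < x \<bullet> e}"
proof -
  obtain U e g L where U: "open U" "p \<in> U" "norm e = 1" and L: "L-lipschitz_on UNIV g"
    and W: "W \<inter> U = {x \<in> U. x \<bullet> e < g (x - (x \<bullet> e) *\<^sub>R e)}"
    using assms unfolding bounded_lipschitz_domain_def by blast
  have oW: "open W" using assms by (simp add: bounded_lipschitz_domain_def)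
  have "continuous_on UNIV g" using L by (rule lipschitz_on_continuous_on)
  then have "continuous_on UNIV (\<lambda>x. g (x - (x \<bullet> e) *\<^sub>R e))"
    by (rule continuous_on_compose2) (auto intro!: continuous_intros)
  then have "open {x. g (x - (x \<bullet> e) *\<^sub>R e) < x \<bullet> e}"
    by (intro open_Collect_less continuous_intros)
  then have "open (U \<inter> {x. g (x - (x \<bullet> e) *\<^sub>R e) < x \<bullet> e})"
    using U by (intro open_Int)
  moreover have "U \<inter> {x. g (x - (x \<bullet> e) *\<^sub>R e) < x \<bullet> e} = {x \<in> U. g (x - (x \<bullet> e) *\<^sub>R e) < x \<bullet> e}"
    by auto
  ultimately have oE: "open {x \<in> U. g (x - (x \<bullet> e) *\<^sub>R e) < x \<bullet> e}" by simp
  have side: "x \<in> W \<longleftrightarrow> x \<bullet> e < g (x - (x \<bullet> e) *\<^sub>R e)" if "x \<in> U" for x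
    using W that by blast
  have "\<forall>x\<in>U. x \<in> W \<longleftrightarrow> x \<bullet> e < g (x - (x \<bullet> e) *\<^sub>R e)"
    using side by blast
  \<comment> \<open>Points strictly above the graph form an open set disjoint from \<open>W\<close>,
    hence from its closure; points below it lie in the open set \<open>W\<close>. Neither can be
    frontier points.\<close>
  moreover have graph: "x \<bullet> e = g (x - (x \<bullet> e) *\<^sub>R e)" if x: "x \<in> U" "x \<in> frontier W" for x
  proof (rule ccontr)
    assume ne: "x \<bullet> e \<noteq> g (x - (x \<bullet> e) *\<^sub>R e)"
    have "x \<notin> W" using x(2) oW by (simp add: frontier_def interior_open)
    then have "x \<in> {x \<in> U. g (x - (x \<bullet> e) *\<^sub>R e) < x \<bullet> e}" using side[OF x(1)] ne x(1) by simp
    moreover have "{x \<in> U. g (x - (x \<bullet> e) *\<^sub>R e) < x \<bullet> e} \<inter> W = {}" using side by force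
    then have "{x \<in> U. g (x - (x \<bullet> e) *\<^sub>R e) < x \<bullet> e} \<inter> closure W = {}"
      using open_Int_closure_eq_empty[OF oE] by blast
    ultimately show False using x(2) by (auto simp: frontier_def)
  qed
  then have "\<forall>x\<in>U \<inter> frontier W. x \<bullet> e = g (x - (x \<bullet> e) *\<^sub>R e)"
    by blast
  ultimately show ?thesis using oE by (rule that[OF U])
qed

text \<open>Moving from \<open>p\<close> along \<open>e\<close> raises the height over a fixed base
  point, so the region above the graph is reached at once. This rules out a wall with
  \<open>W\<close> on both sides.\<close>

lemma lipschitz_exterior_near:
  fixes W :: "'a::euclidean_space set"
  assumes W: "bounded_lipschitz_domain W" and p: "p \<in> frontier W" and T: "open T" "p \<in> T"
  shows "\<exists>S. open S \<and> S \<noteq> {} \<and> S \<subseteq> T \<and> S \<inter> W = {}"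
proof -
  obtain U e g where U: "open U" "p \<in> U" and e: "norm e = 1"
    and side0: "\<forall>x\<in>U. x \<in> W \<longleftrightarrow> x \<bullet> e < g (x - (x \<bullet> e) *\<^sub>R e)"
    and graph0: "\<forall>x\<in>U \<inter> frontier W. x \<bullet> e = g (x - (x \<bullet> e) *\<^sub>R e)"
    and oE: "open {x \<in> U. g (x - (x \<bullet> e) *\<^sub>R e) < x \<bullet> e}"
    by (rule lipschitz_graph[OF W p])
  note side = bspec[OF side0] and graph = bspec[OF graph0, OF IntI]
  let ?S = "{x \<in> U. g (x - (x \<bullet> e) *\<^sub>R e) < x \<bullet> e} \<inter> T"
  obtain d where d: "d > 0" "ball p d \<subseteq> U \<inter> T"
    using U T open_contains_ball[of "U \<inter> T"] by blast
  let ?x = "p + (d / 2) *\<^sub>R e"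
  have ee: "e \<bullet> e = 1" using e by (simp add: dot_square_norm)
  have "?x \<in> ball p d" using d e by (simp add: dist_norm)
  then have "?x \<in> U \<inter> T" using d by blast
  moreover have "g (?x - (?x \<bullet> e) *\<^sub>R e) < ?x \<bullet> e"
  proof -
    have xe: "?x \<bullet> e = p \<bullet> e + d / 2" using ee by (simp add: inner_add_left)
    have eq: "?x - (?x \<bullet> e) *\<^sub>R e = p - (p \<bullet> e) *\<^sub>R e"
      unfolding xe by (simp add: algebra_simps)
    show ?thesis unfolding eq using xe graph[OF U(2) p] d(1) by linarith
  qed
  ultimately have "?x \<in> ?S" by blast
  moreover have "?S \<inter> W = {}" using side by force
  ultimately show ?thesis using oE T by (intro exI[of _ ?S]) blast
qed

text \<open>The direction \<open>e\<close> of the Lipschitz graph cannot be horizontal, since the graph contains a piece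
  of the plane \<open>y = 0\<close>; hence this piece is the whole graph.\<close>

lemma free_surface_below:
  fixes W :: "(real \<times> real \<times> real) set"
  assumes W: "bounded_lipschitz_domain W" and neg: "W \<subseteq> {(x, y, z). y < 0}"
    and F: "{(x, y, z). y = 0 \<and> x\<^sup>2 + z\<^sup>2 < R\<^sup>2} \<subseteq> frontier W" and p: "fst p ^ 2 + snd (snd p) ^ 2 < R\<^sup>2" "fst (snd p) = 0"
  shows "\<exists>\<delta>>0. \<forall>q\<in>ball p \<delta>. fst (snd q) < 0 \<longrightarrow> q \<in> W"
proof -
  let ?F = "{q :: real \<times> real \<times> real. (fst q)\<^sup>2 + (snd (snd q))\<^sup>2 < R\<^sup>2}"
  have Ff: "q \<in> frontier W" if "q \<in> ?F" "fst (snd q) = 0" for q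
    using F that by (cases q) auto
  have pf: "p \<in> frontier W" using Ff p by simp
  obtain U e g where U: "open U" "p \<in> U" and e: "norm e = 1"
    and side0: "\<forall>x\<in>U. x \<in> W \<longleftrightarrow> x \<bullet> e < g (x - (x \<bullet> e) *\<^sub>R e)"
    and graph0: "\<forall>x\<in>U \<inter> frontier W. x \<bullet> e = g (x - (x \<bullet> e) *\<^sub>R e)"
    by (rule lipschitz_graph[OF W pf])
  note side = bspec[OF side0] and graph = bspec[OF graph0, OF IntI]
  have ee: "e \<bullet> e = 1" using e by (simp add: dot_square_norm)
  have line: "(x + t *\<^sub>R e) \<bullet> e = x \<bullet> e + t" "(x + t *\<^sub>R e) - ((x + t *\<^sub>R e) \<bullet> e) *\<^sub>R e = x - (x \<bullet> e) *\<^sub>R e" for x t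
    using ee by (simp_all add: inner_add_left algebra_simps)
  have "open ?F" by (intro open_Collect_less continuous_intros)
  then have "open (U \<inter> ?F)" using U by (intro open_Int)
  moreover have "p \<in> U \<inter> ?F" using U p by simp
  ultimately obtain d where d: "d > 0" "ball p d \<subseteq> U \<inter> ?F"
    using open_contains_ball[of "U \<inter> ?F"] by blast
  define e2 where "e2 = fst (snd e)"
  \<comment> \<open>For horizontal \<open>e\<close>, \<open>p\<close> and
    \<open>p + (d / 2) *\<^sub>R e\<close> would be frontier points over the same base point at
    different heights.\<close>
  have e2: "e2 \<noteq> 0"
  proof
    assume z: "e2 = 0"
    let ?x = "p + (d / 2) *\<^sub>R e"
    have "?x \<in> ball p d" using d e by (simp add: dist_norm)
    then have x: "?x \<in> U" "?x \<in> ?F" using d by auto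
    have "fst (snd ?x) = 0" using z p by (simp add: e2_def)
    then have "?x \<in> frontier W" using x by (intro Ff)
    then have "?x \<bullet> e = g (p - (p \<bullet> e) *\<^sub>R e)" using graph[OF x(1)] unfolding line(2) by blast
    then show False using graph[OF U(2) pf] line(1)[of p "d / 2"] d by simp
  qed
  \<comment> \<open>Membership of \<open>q\<close> is decided by moving it along \<open>e\<close> to
    the plane y = 0, a shift of at most \<delta> / |e2| that must not leave
    \<open>ball p d\<close>.\<close>
  define \<delta> where "\<delta> = d / (1 + 1 / \<bar>e2\<bar>)"
  have pos: "0 < 1 + 1 / \<bar>e2\<bar>" using e2 by (simp add: add_pos_pos)
  have \<delta>: "0 < \<delta>" "\<delta> + \<delta> / \<bar>e2\<bar> = d" "\<delta> \<le> d"
  proof -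
    show "0 < \<delta>" using d pos by (simp add: \<delta>_def)
    have "\<delta> * (1 + 1 / \<bar>e2\<bar>) = d" using pos by (simp add: \<delta>_def)
    then show "\<delta> + \<delta> / \<bar>e2\<bar> = d" by (simp add: distrib_left)
    moreover have "0 \<le> \<delta> / \<bar>e2\<bar>" using \<open>0 < \<delta>\<close> by simp
    ultimately show "\<delta> \<le> d" by linarith
  qed
  \<comment> \<open>The graph over the base point of \<open>q\<close> passes through the point of
    the disc reached by the shift \<open>t\<close>, so it lies \<open>t\<close> above
    \<open>q\<close>.\<close>
  have mem: "q \<in> W \<longleftrightarrow> 0 < - fst (snd q) / e2" if q: "q \<in> ball p \<delta>" for q
  proof -
    define t where "t = - fst (snd q) / e2"
    let ?x = "q + t *\<^sub>R e"
    have qd: "dist p q < \<delta>" using q by simp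
    have "\<bar>fst (snd q)\<bar> \<le> dist p q"
    proof -
      have "\<bar>fst (snd q)\<bar> = dist (fst (snd p)) (fst (snd q))" using p by (simp add: dist_real_def)
      also have "\<dots> \<le> dist (snd p) (snd q)" by (rule dist_fst_le)
      also have "\<dots> \<le> dist p q" by (rule dist_snd_le)
      finally show ?thesis .
    qed
    then have "\<bar>t\<bar> \<le> \<delta> / \<bar>e2\<bar>"
      unfolding t_def abs_divide abs_minus_cancel using qd by (intro divide_right_mono) auto
    moreover have "dist p ?x \<le> dist p q + \<bar>t\<bar>"
      using dist_triangle[of p ?x q] e by (simp add: dist_norm)
    ultimately have "?x \<in> ball p d" using qd \<delta>(2) by simp
    then have x: "?x \<in> U" "?x \<in> ?F" using d by auto
    have "fst (snd ?x) = 0" using e2 by (simp add: t_def e2_def)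
    then have "?x \<in> frontier W" using x by (intro Ff)
    then have "?x \<bullet> e = g (q - (q \<bullet> e) *\<^sub>R e)" using graph[OF x(1)] unfolding line(2) by blast
    then have "q \<bullet> e + t = g (q - (q \<bullet> e) *\<^sub>R e)" using line(1)[of q t] by simp
    moreover have "q \<in> U" using qd \<delta>(3) d by auto
    ultimately show ?thesis using side[of q] unfolding t_def[symmetric] by auto
  qed
  \<comment> \<open>Otherwise points above the plane y = 0 would belong to \<open>W\<close>.\<close>
  have "0 < e2"
  proof (rule ccontr)
    assume "\<not> 0 < e2"
    then have neg2: "e2 < 0" using e2 by simp
    let ?q = "p + (0, \<delta> / 2, 0)"
    have "?q \<in> ball p \<delta>" using \<delta> by (simp add: dist_norm norm_Pair)
    moreover have "0 < - fst (snd ?q) / e2" using neg2 p \<delta> by (simp add: zero_less_divide_iff divide_less_0_iff)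
    ultimately have "?q \<in> W" using mem by blast
    then have "fst (snd ?q) < 0" using neg by (cases p) auto
    then show False using p \<delta> by simp
  qed
  then show ?thesis using mem \<delta> by (intro exI[of _ \<delta>]) (simp add: zero_less_divide_iff divide_less_0_iff)
qed

text \<open>The two sides of the chart are connected and miss the boundary of \<open>W\<close>, so each lies in \<open>W\<close> or
  in its complement; the Lipschitz property excludes that both do so in the same way.  This also
  covers charts in which the wall is mapped to a half-plane.\<close>

lemma chart_side:
  fixes W F :: "(real \<times> real \<times> real) set" and f :: "real \<times> real \<times> real \<Rightarrow> real \<times> real \<times> real"
  assumes W: "bounded_lipschitz_domain W"
    and U: "open U" "open V" "homeomorphism U V f g"
    and flat: "\<And>x. x \<in> rigid_wall W F \<Longrightarrow> x \<in> U \<Longrightarrow> snd (snd (f x)) = 0"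
    and der: "\<And>x. x \<in> U \<Longrightarrow> ((\<lambda>x. snd (snd (f x))) has_derivative h' x) (at x)"
    and nz: "\<And>x. x \<in> U \<Longrightarrow> h' x \<noteq> (\<lambda>v. 0)"
    and x: "x \<in> rigid_wall W F" "x \<in> U" "x \<notin> closure F"
  shows "\<exists>\<sigma>\<in>{-1, 1::real}. \<exists>\<delta>>0. \<forall>y\<in>ball x \<delta>. y \<in> W \<longleftrightarrow> \<sigma> * snd (snd (f y)) < 0"
proof -
  define h where "h y = snd (snd (f y))" for y
  define c where "c v = snd (snd v)" for v :: "real \<times> real \<times> real"
  have oW: "open W" using W by (simp add: bounded_lipschitz_domain_def)
  have fg: "\<And>y. y \<in> U \<Longrightarrow> g (f y) = y" "\<And>v. v \<in> V \<Longrightarrow> f (g v) = v" "\<And>y. y \<in> U \<Longrightarrow> f y \<in> V"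
    "\<And>v. v \<in> V \<Longrightarrow> g v \<in> U" and cf: "continuous_on U f" and cg: "continuous_on V g"
    using U(3) by (auto simp: homeomorphism_def)
  have xf: "x \<in> frontier W" using x(1) by (simp add: rigid_wall_def)
  \<comment> \<open>Off \<open>closure F\<close> every frontier point of \<open>W\<close> is a wall
    point, so \<open>flat\<close> governs the whole frontier there.\<close>
  define U0 where "U0 = U - closure F"
  have U0: "open U0" "x \<in> U0" "U0 \<subseteq> U" using U x by (auto simp: U0_def intro: open_Diff)
  have "open (g -` U0 \<inter> V)"
    using continuous_on_open_vimage[OF U(2), of g] cg U0(1) by blast
  moreover have "f x \<in> g -` U0 \<inter> V" using fg x(2) U0(2) by simp
  ultimately obtain \<epsilon> where \<epsilon>: "\<epsilon> > 0" "ball (f x) \<epsilon> \<subseteq> g -` U0 \<inter> V"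
    using open_contains_ball[of "g -` U0 \<inter> V"] by blast
  define B where "B = ball (f x) \<epsilon>"
  have B: "v \<in> V" "g v \<in> U0" if "v \<in> B" for v using \<epsilon>(2) that by (auto simp: B_def)
  \<comment> \<open>Half balls in the image of the chart are convex, which makes the two sides
    connected.\<close>
  define A where "A s = g ` (B \<inter> {v. s * c v < 0})" for s :: real
  have A: "A s \<subseteq> W \<or> A s \<inter> W = {}" for s
  proof -
    have "convex {v. s * c v < 0}"
      unfolding convex_def c_def
    proof (intro ballI allI impI)
      fix v w :: "real \<times> real \<times> real" and a b :: real
      assume v: "v \<in> {v. s * snd (snd v) < 0}" and w: "w \<in> {v. s * snd (snd v) < 0}" and ab: "0 \<le> a" "0 \<le> b" "a + b = 1"
      have "a * (s * snd (snd v)) + b * (s * snd (snd w)) < 0"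
        using v w ab convex_bound_lt[of "s * snd (snd v)" 0 "s * snd (snd w)" a b] by simp
      then show "a *\<^sub>R v + b *\<^sub>R w \<in> {v. s * snd (snd v) < 0}" by (simp add: algebra_simps)
    qed
    then have "convex (B \<inter> {v. s * c v < 0})"
      unfolding B_def by (intro convex_Int convex_ball)
    then have "connected (A s)"
      unfolding A_def using B by (intro connected_continuous_image convex_connected continuous_on_subset[OF cg]) auto
    moreover have "A s \<inter> frontier W = {}"
    proof (rule equals0I)
      fix y assume "y \<in> A s \<inter> frontier W"
      then obtain v where v: "v \<in> B" "s * c v < 0" "y = g v" "y \<in> frontier W" by (auto simp: A_def)
      have "y \<notin> F" using B(2)[OF v(1)] v(3) closure_subset[of F] by (auto simp: U0_def)
      then have "y \<in> rigid_wall W F" using v(4) by (simp add: rigid_wall_def)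
      moreover have "y \<in> U" using B(2)[OF v(1)] v(3) U0 by auto
      ultimately have "c (f y) = 0" using flat by (simp add: c_def)
      then show False using fg(2)[OF B(1)[OF v(1)]] v by simp
    qed
    ultimately show ?thesis using connected_Int_frontier[of "A s" W] by blast
  qed
  define T where "T = f -` B \<inter> U0"
  have T: "open T" "x \<in> T" "T \<subseteq> U"
  proof -
    show "open T" unfolding T_def
      using continuous_on_open_vimage[OF U0(1), of f] continuous_on_subset[OF cf U0(3)] B_def by blast
    show "x \<in> T" using U0 \<epsilon> by (simp add: T_def B_def)
    show "T \<subseteq> U" using U0 by (auto simp: T_def)
  qed
  have TA: "y \<in> A s" if "y \<in> T" "s * h y < 0" for y s
  proof -
    have "y \<in> U" using that(1) T(3) by blast
    then have "y = g (f y)" using fg(1) by metis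
    moreover have "f y \<in> B \<inter> {v. s * c v < 0}" using that by (simp add: T_def h_def c_def)
    ultimately show ?thesis unfolding A_def by (rule image_eqI)
  qed
  have hder: "(h has_derivative h' y) (at y)" if "y \<in> T" for y
    unfolding h_def using der T(3) that by blast
  \<comment> \<open>An open set of zeros would make the derivative of \<open>h\<close> vanish; hence
    \<open>W\<close> and its exterior both contain points with h \<noteq> 0.\<close>
  have nonzero: "\<exists>y\<in>S. h y \<noteq> 0" if S: "open S" "S \<noteq> {}" "S \<subseteq> T" for S
  proof (rule ccontr)
    assume z: "\<not> ?thesis"
    obtain y where y: "y \<in> S" using S by auto
    have "h' y = (\<lambda>v. 0)"
      by (rule differential_zero_maxmin[OF y S(1) hder]) (use z y S in auto)
    then show False using nz y S T by blast
  qed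
  have "W \<inter> T \<noteq> {}"
    using xf T open_Int_closure_eq_empty[of T W] by (auto simp: frontier_def)
  then have "\<exists>y\<in>W \<inter> T. h y \<noteq> 0"
    using oW T(1) by (intro nonzero open_Int) simp_all
  then obtain y0 where y0: "y0 \<in> W \<inter> T" "h y0 \<noteq> 0"
    by blast
  define \<sigma> where "\<sigma> = - sgn (h y0)"
  have \<sigma>: "\<sigma> \<in> {-1, 1}" "\<sigma> * h y0 < 0" using y0(2) by (auto simp: \<sigma>_def sgn_if)
  have inW: "A \<sigma> \<subseteq> W" using A[of \<sigma>] TA[of y0 \<sigma>] y0 \<sigma> by blast
  obtain S where S: "open S" "S \<noteq> {}" "S \<subseteq> T" "S \<inter> W = {}"
    using lipschitz_exterior_near[OF W xf T(1,2)] by blast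
  obtain y1 where y1: "y1 \<in> S" "h y1 \<noteq> 0" using nonzero[OF S(1-3)] by blast
  have y1T: "y1 \<in> T" "y1 \<notin> W" using y1 S by auto
  have "\<not> \<sigma> * h y1 < 0" using TA[of y1 \<sigma>] inW y1T by blast
  then have "- \<sigma> * h y1 < 0" using y1(2) \<sigma> by auto
  then have outW: "A (- \<sigma>) \<inter> W = {}" using A[of "- \<sigma>"] TA[of y1 "- \<sigma>"] y1T by blast
  have le: "\<sigma> * h y \<le> 0" if "y \<in> T" "y \<in> W" for y
  proof (rule ccontr)
    assume "\<not> \<sigma> * h y \<le> 0"
    then have "- \<sigma> * h y < 0" by simp
    then show False using TA[OF that(1)] outW that(2) by blast
  qed
  have "y \<in> W \<longleftrightarrow> \<sigma> * h y < 0" if y: "y \<in> T" for y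
  proof
    assume yW: "y \<in> W"
    show "\<sigma> * h y < 0"
    proof (rule ccontr)
      assume "\<not> \<sigma> * h y < 0"
      then have zero: "\<sigma> * h y = 0" using le[OF y yW] by simp
      \<comment> \<open>A point of \<open>W\<close> with h = 0 would be a maximum of \<sigma> h on
        an open set, against the nonvanishing derivative.\<close>
      have "(\<lambda>v. \<sigma> * h' y v) = (\<lambda>v. 0)"
      proof (rule differential_zero_maxmin)
        show "y \<in> W \<inter> T" "open (W \<inter> T)" using y yW oW T by auto
        show "((\<lambda>y. \<sigma> * h y) has_derivative (\<lambda>v. \<sigma> * h' y v)) (at y)"
          by (intro has_derivative_mult_right hder y)
        show "(\<forall>z\<in>W \<inter> T. \<sigma> * h z \<le> \<sigma> * h y) \<or> (\<forall>z\<in>W \<inter> T. \<sigma> * h y \<le> \<sigma> * h z)"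
          using le zero by auto
      qed
      then have "h' y = (\<lambda>v. 0)" using \<sigma>(1) by (auto simp: fun_eq_iff)
      then show False using nz y T by blast
    qed
  next
    assume "\<sigma> * h y < 0"
    then show "y \<in> W" using TA[OF y] inW by blast
  qed
  moreover obtain \<delta> where "\<delta> > 0" "ball x \<delta> \<subseteq> T"
    using T open_contains_ball[of T] by blast
  ultimately show ?thesis
    using \<sigma>(1) unfolding h_def by (intro bexI[of _ \<sigma>] exI[of _ \<delta>]) auto
qed

section \<open>Axial symmetry and charts of the wall in the meridian plane\<close>

lemma axisymmetric_frontier:
  assumes W: "axisymmetric W" and p: "(r, y, 0) \<in> frontier W"
  shows "(r * cos t, y, r * sin t) \<in> frontier W"
proof -
  define rot :: "real \<times> real \<times> real \<Rightarrow> real \<times> real \<times> real"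
    where "rot q = (fst q * cos t - snd (snd q) * sin t, fst (snd q), fst q * sin t + snd (snd q) * cos t)" for q
  have W': "rot q \<in> W \<longleftrightarrow> q \<in> W" for q
  proof -
    obtain x y z where q: "q = (x, y, z)" by (cases q) auto
    have "(x * cos t - z * sin t)\<^sup>2 + (x * sin t + z * cos t)\<^sup>2 = (x\<^sup>2 + z\<^sup>2) * ((cos t)\<^sup>2 + (sin t)\<^sup>2)"
      by algebra
    then have "(x * cos t - z * sin t)\<^sup>2 + (x * sin t + z * cos t)\<^sup>2 = x\<^sup>2 + z\<^sup>2" by simp
    then have "(x * cos t - z * sin t, y, x * sin t + z * cos t) \<in> W \<longleftrightarrow> (x, y, z) \<in> W"
      using W unfolding axisymmetric_def by blast
    then show ?thesis by (simp add: rot_def q)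
  qed
  have rotc: "rot q \<in> closure A" if "q \<in> closure A" "\<And>x. x \<in> A \<Longrightarrow> rot x \<in> A" for q A
  proof -
    have "rot ` closure A \<subseteq> closure A"
    proof (rule image_closure_subset)
      show "continuous_on (closure A) rot" unfolding rot_def[abs_def] by (intro continuous_intros)
      show "rot ` A \<subseteq> closure A" using that(2) closure_subset by blast
    qed simp
    then show ?thesis using that(1) by blast
  qed
  have "rot (r, y, 0) \<in> frontier W"
    using p rotc[of "(r, y, 0)" W] rotc[of "(r, y, 0)" "- W"] W' unfolding frontier_closures by auto
  then show ?thesis by (simp add: rot_def)
qed

lemma norm_snd_snd_le: "norm (snd (snd w)) \<le> norm (w :: 'a::real_normed_vector \<times> 'b::real_normed_vector \<times> 'c::real_normed_vector)"
  using norm_snd_le[of "snd (snd w)" "fst (snd w)"] norm_snd_le[of "snd w" "fst w"] by simp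

text \<open>Differentiability of \<open>f'\<close> at the base point bounds its increment by |f''| +
  1 times the distance; the factor 2 in \<open>C\<close> is for the two components of the
  gradient.\<close>

lemma C2_on_gradient_Lipschitz:
  fixes h :: "real \<times> real \<times> real \<Rightarrow> real" and f :: "real \<times> real \<times> real \<Rightarrow> real \<times> real \<times> real"
  assumes U: "open U" and f: "\<And>x. x \<in> U \<Longrightarrow> (f has_derivative blinfun_apply (f' x)) (at x)"
    and f2: "(f' has_derivative blinfun_apply f'') (at (fst p, snd p, 0))" and p: "(fst p, snd p, 0) \<in> U"
  shows "\<exists>N C. (\<forall>q\<in>N. (fst q, snd q, 0) \<in> U) \<and> gradient_Lipschitz_at p N (\<lambda>q. snd (snd (f (fst q, snd q, 0))))
     (\<lambda>q. (snd (snd (f' (fst q, snd q, 0) (1, 0, 0))), snd (snd (f' (fst q, snd q, 0) (0, 1, 0))))) C"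
proof -
  define \<iota> :: "real \<times> real \<Rightarrow> real \<times> real \<times> real" where "\<iota> q = (fst q, snd q, 0)" for q
  define G where "G q = (snd (snd (f' (\<iota> q) (1, 0, 0))), snd (snd (f' (\<iota> q) (0, 1, 0))))" for q
  have c\<iota>: "continuous_on UNIV \<iota>" unfolding \<iota>_def[abs_def] by (intro continuous_intros)
  have d\<iota>: "norm (\<iota> q - \<iota> q') = norm (q - q')" for q q'
    by (simp add: \<iota>_def norm_prod_def)
  obtain d where d: "d > 0" "\<And>x. norm (x - \<iota> p) < d \<Longrightarrow>
     norm (f' x - f' (\<iota> p) - blinfun_apply f'' (x - \<iota> p)) \<le> 1 * norm (x - \<iota> p)"
  proof -
    have "\<exists>d>0. \<forall>x. norm (x - \<iota> p) < d \<longrightarrow>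
        norm (f' x - f' (\<iota> p) - blinfun_apply f'' (x - \<iota> p)) \<le> 1 * norm (x - \<iota> p)"
      using f2 unfolding has_derivative_at_alt \<iota>_def[symmetric]
      by (elim conjE allE[of _ "1::real"] mp) simp
    then show ?thesis using that by blast
  qed
  define N where "N = \<iota> -` U \<inter> ball p d"
  have der: "((\<lambda>q. snd (snd (f (\<iota> q)))) has_derivative (\<lambda>v. G q \<bullet> v)) (at q)" if "q \<in> N" for q
  proof -
    have "(\<iota> has_derivative \<iota>) (at q)"
      unfolding \<iota>_def[abs_def] by (auto intro!: derivative_eq_intros)
    then have "((\<lambda>q. f (\<iota> q)) has_derivative (\<lambda>v. f' (\<iota> q) (\<iota> v))) (at q)"
      by (rule has_derivative_compose) (use f that in \<open>simp add: N_def\<close>)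
    then have "((\<lambda>q. snd (snd (f (\<iota> q)))) has_derivative (\<lambda>v. snd (snd (f' (\<iota> q) (\<iota> v))))) (at q)"
      by (intro has_derivative_snd)
    moreover have "snd (snd (f' (\<iota> q) (\<iota> v))) = G q \<bullet> v" for v
    proof -
      have eq: "\<iota> v = fst v *\<^sub>R (1, 0, 0) + snd v *\<^sub>R (0, 1, 0)" by (simp add: \<iota>_def)
      show ?thesis
        unfolding eq blinfun.add_right blinfun.scaleR_right by (simp add: G_def inner_prod_def mult.commute)
    qed
    ultimately show ?thesis by simp
  qed
  define C where "C = 2 * (norm f'' + 1)"
  have lip: "norm (G q - G p) \<le> C * norm (q - p)" if "q \<in> N" for q
  proof -
    have qd: "norm (\<iota> q - \<iota> p) < d" using that by (simp add: d\<iota> N_def dist_norm norm_minus_commute)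
    have "norm (f' (\<iota> q) - f' (\<iota> p)) \<le> norm (f' (\<iota> q) - f' (\<iota> p) - f'' (\<iota> q - \<iota> p)) + norm (f'' (\<iota> q - \<iota> p))"
      using norm_triangle_ineq[of "f' (\<iota> q) - f' (\<iota> p) - f'' (\<iota> q - \<iota> p)" "f'' (\<iota> q - \<iota> p)"] by simp
    also have "\<dots> \<le> norm (\<iota> q - \<iota> p) + norm f'' * norm (\<iota> q - \<iota> p)"
      using d(2)[OF qd] norm_blinfun[of f'' "\<iota> q - \<iota> p"] by simp
    finally have le: "norm (f' (\<iota> q) - f' (\<iota> p)) \<le> (norm f'' + 1) * norm (q - p)"
      by (simp add: d\<iota> algebra_simps)
    have comp: "\<bar>snd (snd (f' (\<iota> q) v)) - snd (snd (f' (\<iota> p) v))\<bar> \<le> (norm f'' + 1) * norm (q - p)"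
      if "norm v = 1" for v
    proof -
      have "\<bar>snd (snd (f' (\<iota> q) v)) - snd (snd (f' (\<iota> p) v))\<bar> = norm (snd (snd ((f' (\<iota> q) - f' (\<iota> p)) v)))"
        by (simp add: blinfun.diff_left)
      also have "\<dots> \<le> norm ((f' (\<iota> q) - f' (\<iota> p)) v)"
        by (rule norm_snd_snd_le)
      also have "\<dots> \<le> norm (f' (\<iota> q) - f' (\<iota> p))"
        using norm_blinfun[of "f' (\<iota> q) - f' (\<iota> p)" v] that by simp
      finally show ?thesis using le by linarith
    qed
    have "norm (G q - G p) \<le> \<bar>fst (G q - G p)\<bar> + \<bar>snd (G q - G p)\<bar>"
      using norm_Pair_le[of "fst (G q - G p)" "snd (G q - G p)"] by (simp only: prod.collapse real_norm_def)
    also have "\<dots> \<le> C * norm (q - p)"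
    proof -
      have e: "C * norm (q - p) = (norm f'' + 1) * norm (q - p) + (norm f'' + 1) * norm (q - p)"
        by (simp add: C_def algebra_simps)
      show ?thesis
        unfolding e G_def fst_diff snd_diff fst_conv snd_conv
        by (intro add_mono comp) (simp_all add: norm_Pair)
    qed
    finally show ?thesis .
  qed
  have "open N" unfolding N_def by (intro open_Int open_vimage U c\<iota> open_ball)
  moreover have "p \<in> N" using p d by (simp add: N_def \<iota>_def)
  ultimately have "gradient_Lipschitz_at p N (\<lambda>q. snd (snd (f (\<iota> q)))) G C"
    unfolding gradient_Lipschitz_at_def using der lip by blast
  moreover have "\<forall>q\<in>N. \<iota> q \<in> U" by (simp add: N_def)
  ultimately show ?thesis unfolding G_def[abs_def] \<iota>_def by blast
qed

text \<open>By the chain rule f' after k' is the identity, so \<open>f'\<close> reaches the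
  direction \<open>(0, 0, 1)\<close>.\<close>

lemma chart_derivative_nonzero:
  fixes f g :: "'a::real_normed_vector \<Rightarrow> real \<times> real \<times> real"
  assumes "open V" "f x \<in> V" "\<And>v. v \<in> V \<Longrightarrow> f (k v) = v" "k (f x) = x"
    and "(f has_derivative f') (at x)" "(k has_derivative k') (at (f x))"
  shows "(\<lambda>v. snd (snd (f' v))) \<noteq> (\<lambda>v. 0)"
proof
  assume z: "(\<lambda>v. snd (snd (f' v))) = (\<lambda>v. 0)"
  have "((\<lambda>v. f (k v)) has_derivative (\<lambda>v. f' (k' v))) (at (f x))"
    by (rule has_derivative_compose[OF assms(6)]) (use assms(4,5) in simp)
  moreover have "((\<lambda>v. f (k v)) has_derivative (\<lambda>v. v)) (at (f x))"
    by (rule has_derivative_transform_within_open[of "\<lambda>v. v" _ _ _ V])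
      (use assms in \<open>auto intro: has_derivative_ident\<close>)
  ultimately have "(\<lambda>v. f' (k' v)) = (\<lambda>v. v)" by (rule has_derivative_unique)
  then have "f' (k' (0, 0, 1)) = (0, 0, 1)" by metis
  then show False using fun_cong[OF z, of "k' (0, 0, 1)"] by simp
qed

text \<open>A spatial chart is restricted to the meridian plane. A nonzero spatial derivative could
  still vanish on that plane; symmetry prevents it, because the derivative in the remaining
  direction, along the circle about the axis, is zero.\<close>

lemma meridian_chart:
  fixes W :: "(real \<times> real \<times> real) set" and R :: real
  defines "F \<equiv> {(x, y, z). y = 0 \<and> x\<^sup>2 + z\<^sup>2 < R\<^sup>2}"
  assumes W: "bounded_lipschitz_domain W" and ax: "axisymmetric W" and S: "C2_surface (rigid_wall W F)" and R: "0 < R"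
    and p: "0 < fst p" "(fst p, snd p, 0) \<in> rigid_wall W F"
  shows "\<exists>N h G C. gradient_Lipschitz_at p N h G C \<and>
      (\<forall>q\<in>N \<inter> {q. 0 < fst q \<and> (fst q, snd q, 0) \<in> rigid_wall W F}. h q = 0 \<and> G q \<noteq> 0 \<and>
        (q \<noteq> (R, 0) \<longrightarrow> (\<exists>\<sigma>\<in>{-1, 1}. \<exists>\<delta>>0. \<forall>x\<in>ball q \<delta>. x \<in> meridian_domain W \<longleftrightarrow> \<sigma> * h x < 0)))"
proof -
  obtain U V and f k :: "real \<times> real \<times> real \<Rightarrow> real \<times> real \<times> real" where U: "open U" "(fst p, snd p, 0) \<in> U" "open V" "homeomorphism U V f k"
    and C2: "C2_on U f" "C2_on V k"
    and flat0: "f ` (rigid_wall W F \<inter> U) = {(a, b, c). c = 0} \<inter> V \<or>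
         f ` (rigid_wall W F \<inter> U) = {(a, b, c). c = 0 \<and> a \<ge> 0} \<inter> V"
    using bspec[OF S[unfolded C2_surface_def] p(2)] by (elim exE conjE) (rule that)
  have flat: "snd (snd (f x)) = 0" if "x \<in> rigid_wall W F" "x \<in> U" for x
  proof -
    have m: "f x \<in> f ` (rigid_wall W F \<inter> U)" using that by simp
    from flat0 show ?thesis
    proof
      assume e: "f ` (rigid_wall W F \<inter> U) = {(a, b, c). c = 0} \<inter> V"
      show ?thesis using m unfolding e by (simp add: case_prod_beta)
    next
      assume e: "f ` (rigid_wall W F \<inter> U) = {(a, b, c). c = 0 \<and> a \<ge> 0} \<inter> V"
      show ?thesis using m unfolding e by (simp add: case_prod_beta)
    qed
  qed
  obtain f' :: "real \<times> real \<times> real \<Rightarrow> (real \<times> real \<times> real) \<Rightarrow>\<^sub>L (real \<times> real \<times> real)"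
    and f'' :: "real \<times> real \<times> real \<Rightarrow> (real \<times> real \<times> real) \<Rightarrow>\<^sub>L ((real \<times> real \<times> real) \<Rightarrow>\<^sub>L (real \<times> real \<times> real))"
    where fd: "\<forall>x\<in>U. (f has_derivative blinfun_apply (f' x)) (at x) \<and> (f' has_derivative blinfun_apply (f'' x)) (at x)"
    using C2(1)[unfolded C2_on_def] by (elim exE conjE) (rule that)
  note f' = bspec[OF fd, THEN conjunct1] and f'' = bspec[OF fd, THEN conjunct2]
  obtain k' :: "real \<times> real \<times> real \<Rightarrow> (real \<times> real \<times> real) \<Rightarrow>\<^sub>L (real \<times> real \<times> real)"
    and k'' :: "real \<times> real \<times> real \<Rightarrow> (real \<times> real \<times> real) \<Rightarrow>\<^sub>L ((real \<times> real \<times> real) \<Rightarrow>\<^sub>L (real \<times> real \<times> real))"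
    where kd: "\<forall>x\<in>V. (k has_derivative blinfun_apply (k' x)) (at x) \<and> (k' has_derivative blinfun_apply (k'' x)) (at x)"
    using C2(2)[unfolded C2_on_def] by (elim exE conjE) (rule that)
  note k' = bspec[OF kd, THEN conjunct1]
  have inv: "\<And>y. y \<in> U \<Longrightarrow> k (f y) = y" "\<And>v. v \<in> V \<Longrightarrow> f (k v) = v" "\<And>y. y \<in> U \<Longrightarrow> f y \<in> V"
    using U(4) by (auto simp: homeomorphism_def)
  have nz: "(\<lambda>v. snd (snd (f' x v))) \<noteq> (\<lambda>v. 0)" if "x \<in> U" for x
    by (rule chart_derivative_nonzero[OF U(3) inv(3)[OF that] inv(2) inv(1)[OF that] f'[OF that] k'[OF inv(3)[OF that]]])
  have der: "((\<lambda>x. snd (snd (f x))) has_derivative (\<lambda>v. snd (snd (f' x v)))) (at x)" if "x \<in> U" for x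
    by (intro has_derivative_snd f' that)
  define h where "h q = snd (snd (f (fst q, snd q, 0)))" for q
  define G where "G q = (snd (snd (f' (fst q, snd q, 0) (1, 0, 0))), snd (snd (f' (fst q, snd q, 0) (0, 1, 0))))" for q
  have "\<exists>N C. (\<forall>q\<in>N. (fst q, snd q, 0) \<in> U) \<and> gradient_Lipschitz_at p N h G C"
    unfolding h_def[abs_def] G_def[abs_def]
    by (rule C2_on_gradient_Lipschitz[OF U(1) f' f''[OF U(2)] U(2)])
  then obtain N C where N: "\<forall>q\<in>N. (fst q, snd q, 0) \<in> U" and lip: "gradient_Lipschitz_at p N h G C"
    by (elim exE conjE) (rule that)
  have main: "h q = 0 \<and> G q \<noteq> 0 \<and>
        (q \<noteq> (R, 0) \<longrightarrow> (\<exists>\<sigma>\<in>{-1, 1}. \<exists>\<delta>>0. \<forall>x\<in>ball q \<delta>. x \<in> meridian_domain W \<longleftrightarrow> \<sigma> * h x < 0))"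
    if q: "q \<in> N" "0 < fst q" "(fst q, snd q, 0) \<in> rigid_wall W F" for q
  proof (intro conjI impI)
    let ?q = "(fst q, snd q, 0) :: real \<times> real \<times> real"
    have qU: "?q \<in> U" using N q by blast
    show "h q = 0" unfolding h_def by (rule flat[OF q(3) qU])
    \<comment> \<open>The wall contains the circle through \<open>?q\<close> about the axis.\<close>
    have z0: "snd (snd (f' ?q (0, 0, 1))) = 0"
    proof -
      define \<gamma> where "\<gamma> t = (fst q * cos t, snd q, fst q * sin t)" for t
      have \<gamma>0: "\<gamma> 0 = ?q" by (simp add: \<gamma>_def)
      have "(\<gamma> has_derivative (\<lambda>t. (0, 0, fst q * t))) (at 0)"
        unfolding \<gamma>_def[abs_def] by (auto intro!: derivative_eq_intros)
      then have "((\<lambda>t. snd (snd (f (\<gamma> t)))) has_derivative (\<lambda>t. snd (snd (f' ?q (0, 0, fst q * t))))) (at 0)"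
        by (rule has_derivative_compose[where g = "\<lambda>x. snd (snd (f x))"]) (use der[OF qU] \<gamma>0 in simp)
      moreover have "((\<lambda>t. snd (snd (f (\<gamma> t)))) has_derivative (\<lambda>t. 0)) (at 0)"
      proof (rule has_derivative_transform_within_open[of "\<lambda>t. 0" _ _ _ "\<gamma> -` U"])
        have "continuous_on UNIV \<gamma>" unfolding \<gamma>_def[abs_def] by (intro continuous_intros)
        then show "open (\<gamma> -` U)" by (rule open_vimage[OF U(1)])
        show "0 \<in> \<gamma> -` U" using qU \<gamma>0 by simp
        show "0 = snd (snd (f (\<gamma> t)))" if t: "t \<in> \<gamma> -` U" for t
        proof -
          have "\<gamma> t \<in> frontier W"
            unfolding \<gamma>_def using q(3) by (intro axisymmetric_frontier[OF ax]) (simp add: rigid_wall_def)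
          moreover have "\<gamma> t \<notin> F"
          proof -
            have "(fst q * cos t)\<^sup>2 + (fst q * sin t)\<^sup>2 = (fst q)\<^sup>2 * ((cos t)\<^sup>2 + (sin t)\<^sup>2)"
              by algebra
            then have "(fst q * cos t)\<^sup>2 + (fst q * sin t)\<^sup>2 = (fst q)\<^sup>2" by simp
            then show ?thesis using q(3) by (simp add: F_def \<gamma>_def rigid_wall_def)
          qed
          ultimately show ?thesis using flat[of "\<gamma> t"] t by (simp add: rigid_wall_def)
        qed
      qed simp
      ultimately have "(\<lambda>t. snd (snd (f' ?q (0, 0, fst q * t)))) = (\<lambda>t. 0)"
        by (rule has_derivative_unique)
      then have "snd (snd (f' ?q (0, 0, fst q * (1 / fst q)))) = 0" by metis
      then show ?thesis using q(2) by simp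
    qed
    show "G q \<noteq> 0"
    proof
      assume "G q = 0"
      then have z1: "snd (snd (f' ?q (1, 0, 0))) = 0" "snd (snd (f' ?q (0, 1, 0))) = 0"
        by (auto simp: G_def zero_prod_def)
      have "snd (snd (f' ?q v)) = 0" for v
      proof -
        have eq: "v = fst v *\<^sub>R (1, 0, 0) + (fst (snd v) *\<^sub>R (0, 1, 0) + snd (snd v) *\<^sub>R (0, 0, 1))"
          by (cases v) simp
        have "f' ?q v = fst v *\<^sub>R f' ?q (1, 0, 0) + (fst (snd v) *\<^sub>R f' ?q (0, 1, 0) + snd (snd v) *\<^sub>R f' ?q (0, 0, 1))"
          using arg_cong[OF eq, of "blinfun_apply (f' ?q)"]
          unfolding blinfun.add_right blinfun.scaleR_right .
        then show ?thesis using z0 z1 by simp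
      qed
      then show False using nz[OF qU] by auto
    qed
    assume ne: "q \<noteq> (R, 0)"
    \<comment> \<open>\<open>closure F\<close> lies in the closed disc, which the wall section meets
      for r > 0 only at the rim.\<close>
    have ncl: "?q \<notin> closure F"
    proof
      assume cl: "?q \<in> closure F"
      have "closed {x :: real \<times> real \<times> real. fst (snd x) = 0 \<and> (fst x)\<^sup>2 + (snd (snd x))\<^sup>2 \<le> R\<^sup>2}"
        by (intro closed_Collect_conj closed_Collect_eq closed_Collect_le continuous_intros)
      then have "closure F \<subseteq> {x. fst (snd x) = 0 \<and> (fst x)\<^sup>2 + (snd (snd x))\<^sup>2 \<le> R\<^sup>2}"
        by (rule closure_minimal[rotated]) (auto simp: F_def)
      from subsetD[OF this cl] have "snd q = 0" and "(fst q)\<^sup>2 \<le> R\<^sup>2" by simp_all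
      then have "fst q \<le> R" using R power2_le_imp_le[of "fst q" R] by simp
      moreover have "\<not> (fst q)\<^sup>2 < R\<^sup>2"
        using q(3) \<open>snd q = 0\<close> by (simp add: rigid_wall_def F_def)
      then have "R \<le> fst q"
        using power_strict_mono[of "fst q" R 2] q(2) by (cases "fst q < R") simp_all
      ultimately have "fst q = R" by simp
      then show False using ne \<open>snd q = 0\<close> by (simp add: prod_eq_iff)
    qed
    have "\<exists>\<sigma>\<in>{-1, 1::real}. \<exists>\<delta>>0. \<forall>y\<in>ball ?q \<delta>. y \<in> W \<longleftrightarrow> \<sigma> * snd (snd (f y)) < 0"
      by (rule chart_side[OF W U(1,3,4) flat der nz q(3) qU ncl])
    then obtain \<sigma> \<delta> where \<sigma>: "\<sigma> \<in> {-1, 1::real}" and \<delta>: "\<delta> > 0" "\<forall>y\<in>ball ?q \<delta>. y \<in> W \<longleftrightarrow> \<sigma> * snd (snd (f y)) < 0"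
      by (elim bexE exE conjE) (rule that)
    \<comment> \<open>A radius of at most \<open>fst q\<close> keeps the ball in r > 0, where the
      section is exactly the trace of \<open>W\<close>.\<close>
    have "x \<in> meridian_domain W \<longleftrightarrow> \<sigma> * h x < 0" if x: "x \<in> ball q (min \<delta> (fst q))" for x
    proof -
      have d: "dist ?q (fst x, snd x, 0) = dist q x"
        by (cases q; cases x) (simp add: dist_Pair_Pair)
      have "\<bar>fst q - fst x\<bar> \<le> dist q x" using dist_fst_le[of q x] by (simp add: dist_real_def)
      then have "0 < fst x" using x by auto
      moreover have "(fst x, snd x, 0) \<in> ball ?q \<delta>" using x d by simp
      ultimately show ?thesis
        using \<delta>(2) by (simp add: meridian_domain_def h_def case_prod_beta)
    qed
    then have "\<forall>x\<in>ball q (min \<delta> (fst q)). x \<in> meridian_domain W \<longleftrightarrow> \<sigma> * h x < 0"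
      by (intro ballI)
    moreover have "0 < min \<delta> (fst q)" using \<delta>(1) q(2) by simp
    ultimately have "\<exists>\<delta>>0. \<forall>x\<in>ball q \<delta>. x \<in> meridian_domain W \<longleftrightarrow> \<sigma> * h x < 0"
      by (intro exI[of _ "min \<delta> (fst q)"] conjI)
    then show "\<exists>\<sigma>\<in>{-1, 1}. \<exists>\<delta>>0. \<forall>x\<in>ball q \<delta>. x \<in> meridian_domain W \<longleftrightarrow> \<sigma> * h x < 0"
      using \<sigma> by (rule bexI)
  qed
  have "\<forall>q\<in>N \<inter> {q. 0 < fst q \<and> (fst q, snd q, 0) \<in> rigid_wall W F}. h q = 0 \<and> G q \<noteq> 0 \<and>
        (q \<noteq> (R, 0) \<longrightarrow> (\<exists>\<sigma>\<in>{-1, 1}. \<exists>\<delta>>0. \<forall>x\<in>ball q \<delta>. x \<in> meridian_domain W \<longleftrightarrow> \<sigma> * h x < 0))"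
    by (intro ballI main) simp_all
  with lip show ?thesis
    by (intro exI[of _ N] exI[of _ h] exI[of _ G] exI[of _ C] conjI)
qed

section \<open>Closure of the meridian section and the values on the axis\<close>

definition meridian_projection :: "real \<times> real \<times> real \<Rightarrow> real \<times> real" where
  "meridian_projection w = (sqrt ((fst w)\<^sup>2 + (snd (snd w))\<^sup>2), fst (snd w))"

lemma continuous_meridian_projection: "continuous_on A meridian_projection"
  unfolding meridian_projection_def[abs_def] by (intro continuous_intros)

lemma meridian_projection_mem:
  assumes "axisymmetric W" "w \<in> W" "0 < fst (meridian_projection w)"
  shows "meridian_projection w \<in> meridian_domain W"
proof -
  obtain x y z where w: "w = (x, y, z)" by (cases w) auto
  define s where "s = sqrt (x\<^sup>2 + z\<^sup>2)"
  have "s\<^sup>2 + 0\<^sup>2 = x\<^sup>2 + z\<^sup>2" by (simp add: s_def)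
  then have "(s, y, 0) \<in> W \<longleftrightarrow> (x, y, z) \<in> W"
    using assms(1) unfolding axisymmetric_def by blast
  then show ?thesis
    using assms(2,3) by (simp add: meridian_projection_def meridian_domain_def w s_def)
qed

lemma open_meridian_domain:
  assumes "open W"
  shows "open (meridian_domain W)"
proof -
  have "continuous_on UNIV (\<lambda>q :: real \<times> real. (fst q, snd q, 0::real))"
    by (intro continuous_intros)
  then have "open ((\<lambda>q. (fst q, snd q, 0)) -` W)"
    by (rule open_vimage[OF assms])
  moreover have "open {q :: real \<times> real. 0 < fst q}"
    by (intro open_Collect_less continuous_intros)
  moreover have "meridian_domain W = (\<lambda>q. (fst q, snd q, 0)) -` W \<inter> {q. 0 < fst q}"
    by (auto simp: meridian_domain_def)
  ultimately show ?thesis by auto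
qed

lemma bounded_meridian_domain:
  assumes "bounded W"
  shows "bounded (meridian_domain W)"
proof -
  obtain B where B: "\<And>w. w \<in> W \<Longrightarrow> norm w \<le> B"
    using assms unfolding bounded_iff by blast
  have "norm q \<le> B" if "q \<in> meridian_domain W" for q
  proof -
    have "(fst q, snd q, 0) \<in> W" using that by (simp add: meridian_domain_def case_prod_beta)
    then have "norm (fst q, snd q, 0::real) \<le> B" by (rule B)
    then show ?thesis by (simp add: norm_prod_def)
  qed
  then show ?thesis unfolding bounded_iff by blast
qed

lemma closure_meridian_domain:
  assumes "q \<in> closure (meridian_domain W)"
  shows "0 \<le> fst q" "(fst q, snd q, 0) \<in> closure W"
proof -
  show "0 \<le> fst q"
    by (rule continuous_ge_on_closure[of "meridian_domain W" fst, OF _ assms])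
      (auto intro!: continuous_intros simp: meridian_domain_def)
  have "(\<lambda>q. (fst q, snd q, 0)) ` closure (meridian_domain W) \<subseteq> closure W"
  proof (rule image_closure_subset)
    show "(\<lambda>q. (fst q, snd q, 0)) ` meridian_domain W \<subseteq> closure W"
      using closure_subset[of W] by (auto simp: meridian_domain_def)
  qed (auto intro!: continuous_intros)
  then show "(fst q, snd q, 0) \<in> closure W" using assms by blast
qed

text \<open>Points of \<open>W\<close> approximating \<open>p\<close> need not lie in the meridian
  plane; rotating them into it stays in \<open>W\<close> and, by continuity of the projection, still
  approximates \<open>p\<close>.\<close>

lemma closure_meridian_domainI:
  assumes W: "axisymmetric W" and p: "0 < fst p" "(fst p, snd p, 0) \<in> closure W"
  shows "p \<in> closure (meridian_domain W)"
  unfolding closure_approachable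
proof (intro allI impI)
  fix e :: real assume e: "0 < e"
  let ?p = "(fst p, snd p, 0) :: real \<times> real \<times> real"
  have pp: "meridian_projection ?p = p" using p(1) by (simp add: meridian_projection_def)
  have "meridian_projection ` closure W \<subseteq> closure (meridian_projection ` W)"
    by (intro image_closure_subset continuous_meridian_projection closure_subset) simp
  then have "p \<in> closure (meridian_projection ` W)" using p(2) pp by force
  moreover have "0 < min e (fst p)" using e p(1) by simp
  ultimately obtain w where w: "w \<in> W" "dist (meridian_projection w) p < min e (fst p)"
    unfolding closure_approachable by blast
  have "\<bar>fst (meridian_projection w) - fst p\<bar> < fst p"
    using w(2) dist_fst_le[of "meridian_projection w" p] by (simp add: dist_real_def)
  then have "0 < fst (meridian_projection w)" by arith
  then have "meridian_projection w \<in> meridian_domain W"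
    by (rule meridian_projection_mem[OF W w(1)])
  then show "\<exists>y\<in>meridian_domain W. dist y p < e" using w(2) by auto
qed

text \<open>On the meridian half-plane \<open>cos_mode \<psi>\<close> is \<psi> for r > 0 and 0 on
  the axis, where \<open>x / 0 = 0\<close>; continuity of both functions makes \<psi> vanish
  there.\<close>

lemma cos_mode_axis:
  assumes c3: "continuous_on (closure W) (cos_mode \<psi>)" and c2: "continuous_on (closure (meridian_domain W)) \<psi>"
    and q: "q \<in> closure (meridian_domain W)" "fst q = 0"
  shows "\<psi> q = 0"
proof -
  obtain x where x: "\<And>n. x n \<in> meridian_domain W" "x \<longlonglongrightarrow> q"
    using q(1) unfolding closure_sequential by blast
  have xc: "x n \<in> closure (meridian_domain W)" for n using x(1) closure_subset by blast
  define \<iota> :: "real \<times> real \<Rightarrow> real \<times> real \<times> real" where "\<iota> p = (fst p, snd p, 0)" for p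
  have l1: "(\<lambda>n. \<psi> (x n)) \<longlonglongrightarrow> \<psi> q"
    using continuous_on_tendsto_compose[OF c2 x(2) q(1)] xc by simp
  have "(\<lambda>n. \<iota> (x n)) \<longlonglongrightarrow> \<iota> q" unfolding \<iota>_def by (intro tendsto_intros x(2))
  then have "(\<lambda>n. cos_mode \<psi> (\<iota> (x n))) \<longlonglongrightarrow> cos_mode \<psi> (\<iota> q)"
    using closure_meridian_domain(2)[OF q(1)] closure_meridian_domain(2)[OF xc]
    by (intro continuous_on_tendsto_compose[OF c3]) (auto simp: \<iota>_def)
  moreover have "cos_mode \<psi> (\<iota> (x n)) = \<psi> (x n)" for n
    using x(1)[of n] by (auto simp: cos_mode_def \<iota>_def meridian_domain_def)
  moreover have "cos_mode \<psi> (\<iota> q) = 0" using q(2) by (simp add: cos_mode_def \<iota>_def)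
  ultimately have "(\<lambda>n. \<psi> (x n)) \<longlonglongrightarrow> 0" by simp
  then show ?thesis using l1 LIMSEQ_unique by blast
qed

lemma rim_in_closure:
  fixes W :: "(real \<times> real \<times> real) set"
  assumes "0 < R" and F: "{(x, y, z). y = 0 \<and> x\<^sup>2 + z\<^sup>2 < R\<^sup>2} \<subseteq> frontier W"
  shows "(R, 0, 0) \<in> frontier W"
proof -
  have "(\<lambda>r. (r, 0, 0)) ` closure {0<..<R} \<subseteq> frontier W"
  proof (rule image_closure_subset)
    show "(\<lambda>r. (r, 0, 0)) ` {0<..<R} \<subseteq> frontier W"
    proof (intro image_subsetI subsetD[OF F])
      fix r assume "r \<in> {0<..<R}"
      then have "r\<^sup>2 < R\<^sup>2" using power_strict_mono[of r R 2] by simp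
      then show "(r, 0, 0) \<in> {(x, y, z). y = 0 \<and> x\<^sup>2 + z\<^sup>2 < R\<^sup>2}" by simp
    qed
  qed (auto intro!: continuous_intros)
  then show ?thesis using assms(1) by force
qed

theorem proposition1p2:
  fixes W F :: "(real \<times> real \<times> real) set"
    and R \<alpha> \<nu>\<^sub>1\<^sub>1 :: real
    and \<psi>\<^sub>1\<^sub>1 :: "real \<times> real \<Rightarrow> real"
  assumes "liquid_domain W F"
    and "axisymmetric W"
    and "R > 0"
    and "F = {(x, y, z). y = 0 \<and> x\<^sup>2 + z\<^sup>2 < R\<^sup>2}"
    and "C2_surface (rigid_wall W F)"
    and "fundamental_mode1 W F \<nu>\<^sub>1\<^sub>1 \<psi>\<^sub>1\<^sub>1"
    and "\<forall>p\<in>meridian_domain W. \<psi>\<^sub>1\<^sub>1 p > 0"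
    and "has_interior_angle (meridian_domain W) (R, 0) \<alpha>"
    and "pi / 2 < \<alpha>" and "\<alpha> < pi"
  shows "(\<exists>r. 0 < r \<and> r < R \<and> (\<forall>p\<in>closure (meridian_domain W). \<psi>\<^sub>1\<^sub>1 p \<le> \<psi>\<^sub>1\<^sub>1 (r, 0))) \<and>
         (\<exists>p\<in>meridian_domain W. d_r \<psi>\<^sub>1\<^sub>1 p > 0) \<and>
         (\<exists>p\<in>meridian_domain W. d_r \<psi>\<^sub>1\<^sub>1 p < 0)"
proof -
  have W: "bounded_lipschitz_domain W" and neg: "W \<subseteq> {(x, y, z). y < 0}" and F: "F \<subseteq> frontier W"
    using assms(1) by (auto simp: liquid_domain_def)
  have oW: "open W" and bW: "bounded W" using W by (auto simp: bounded_lipschitz_domain_def)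
  have mode: "mode1_eigenfunction W F \<nu>\<^sub>1\<^sub>1 \<psi>\<^sub>1\<^sub>1" using assms(6) by (simp add: fundamental_mode1_def)
  define D where "D = meridian_domain W"
  define \<Gamma> where "\<Gamma> = {q. 0 < fst q \<and> (fst q, snd q, 0) \<in> rigid_wall W F}"
  have c3: "continuous_on (closure W) (cos_mode \<psi>\<^sub>1\<^sub>1)" and c2: "continuous_on (closure D) \<psi>\<^sub>1\<^sub>1"
    and C2: "C2_on D \<psi>\<^sub>1\<^sub>1"
    and PDE: "\<forall>(r, y)\<in>D. d_r (d_r \<psi>\<^sub>1\<^sub>1) (r, y) + 1 / r * d_r \<psi>\<^sub>1\<^sub>1 (r, y) + d_y (d_y \<psi>\<^sub>1\<^sub>1) (r, y)
                     - 1 / r\<^sup>2 * \<psi>\<^sub>1\<^sub>1 (r, y) = 0"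
    and free: "\<forall>(r, y)\<in>cross_section F.
          ((\<lambda>s. \<psi>\<^sub>1\<^sub>1 (r, s)) has_real_derivative \<nu>\<^sub>1\<^sub>1 * \<psi>\<^sub>1\<^sub>1 (r, y)) (at_left y)"
    and wall: "\<forall>p\<in>cross_section (rigid_wall W F). \<forall>n. outward_normal D p n \<longrightarrow>
          ((\<lambda>t. \<psi>\<^sub>1\<^sub>1 (p + t *\<^sub>R n)) has_real_derivative 0) (at_left 0)"
    using mode unfolding mode1_eigenfunction_def Let_def D_def by blast+
  have F_iff: "(r, 0, 0) \<in> F \<longleftrightarrow> r < R" if "0 \<le> r" for r
    using that assms(3) by (auto simp: assms(4) power_strict_mono dest: power_less_imp_less_base)
  have front_notin: "w \<notin> W" if "w \<in> frontier W" for w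
    using that oW by (simp add: frontier_def interior_open)
  interpret sloshing_section D \<Gamma> R \<nu>\<^sub>1\<^sub>1 \<alpha> \<psi>\<^sub>1\<^sub>1
  proof
    show "0 < R" by (rule assms)
    show "open D" unfolding D_def by (rule open_meridian_domain[OF oW])
    show "bounded D" unfolding D_def by (rule bounded_meridian_domain[OF bW])
    show "0 < fst q \<and> snd q < 0" if "q \<in> D" for q
      using that neg by (auto simp: D_def meridian_domain_def)
    show "continuous_on (closure D) \<psi>\<^sub>1\<^sub>1" by (rule c2)
    show "0 < \<psi>\<^sub>1\<^sub>1 q" if "q \<in> D" for q using assms(7) that by (simp add: D_def)
    show "C2_on D \<psi>\<^sub>1\<^sub>1" by (rule C2)
    show "d_r (d_r \<psi>\<^sub>1\<^sub>1) (r, y) + 1 / r * d_r \<psi>\<^sub>1\<^sub>1 (r, y) + d_y (d_y \<psi>\<^sub>1\<^sub>1) (r, y)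
                     - 1 / r\<^sup>2 * \<psi>\<^sub>1\<^sub>1 (r, y) = 0" if "(r, y) \<in> D" for r y
      using bspec[OF PDE that] by simp
    show "((\<lambda>s. \<psi>\<^sub>1\<^sub>1 (r, s)) has_real_derivative \<nu>\<^sub>1\<^sub>1 * \<psi>\<^sub>1\<^sub>1 (r, 0)) (at_left 0)" if "0 < r" "r < R" for r
    proof -
      have "(r, 0) \<in> cross_section F" using that F_iff[of r] by (simp add: cross_section_def)
      from bspec[OF free this] show ?thesis by simp
    qed
    show "((\<lambda>t. \<psi>\<^sub>1\<^sub>1 (p + t *\<^sub>R n)) has_real_derivative 0) (at_left 0)" if "p \<in> \<Gamma>" "outward_normal D p n" for p n
    proof -
      have "p \<in> cross_section (rigid_wall W F)"
        using that(1) by (auto simp: \<Gamma>_def cross_section_def)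
      then show ?thesis using wall that(2) by blast
    qed
    show "p \<in> closure D \<and> p \<notin> D \<and> 0 < fst p" if "p \<in> \<Gamma>" for p
    proof (intro conjI)
      have p: "0 < fst p" "(fst p, snd p, 0) \<in> frontier W"
        using that by (auto simp: \<Gamma>_def rigid_wall_def)
      then show "p \<in> closure D"
        unfolding D_def by (intro closure_meridian_domainI assms(2)) (auto simp: frontier_def)
      show "p \<notin> D" using front_notin[OF p(2)] by (auto simp: D_def meridian_domain_def)
      show "0 < fst p" by (rule p)
    qed
    show "(r, 0) \<notin> \<Gamma>" if "0 \<le> r" "r < R" for r
      using F_iff[OF that(1)] that by (simp add: \<Gamma>_def rigid_wall_def)
    show "q \<in> D \<or> fst q = 0 \<and> \<psi>\<^sub>1\<^sub>1 q = 0 \<or> (\<exists>r>0. r < R \<and> q = (r, 0)) \<or> q \<in> \<Gamma>" if q: "q \<in> closure D" for q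
    proof (cases "fst q = 0")
      case True
      then show ?thesis using cos_mode_axis[OF c3] c2 q unfolding D_def by blast
    next
      case False
      have f: "0 < fst q" "(fst q, snd q, 0) \<in> closure W"
        using closure_meridian_domain[of q W] q False by (auto simp: D_def)
      show ?thesis
      proof (cases "(fst q, snd q, 0) \<in> W")
        case True
        then have "q \<in> D" using f(1) by (auto simp: D_def meridian_domain_def)
        then show ?thesis ..
      next
        case nW: False
        then have fr: "(fst q, snd q, 0) \<in> frontier W" using f(2) oW by (simp add: frontier_def interior_open)
        show ?thesis
        proof (cases "(fst q, snd q, 0) \<in> F")
          case True
          then have "snd q = 0" by (simp add: assms(4))
          moreover from this have "fst q < R" using F_iff[of "fst q"] True f(1) by simp
          ultimately show ?thesis using f(1) by (intro disjI2 disjI1 exI[of _ "fst q"]) (simp add: prod_eq_iff)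
        next
          case False
          then have "q \<in> \<Gamma>" using fr f(1) by (simp add: \<Gamma>_def rigid_wall_def)
          then show ?thesis by blast
        qed
      qed
    qed
    \<comment> \<open>\<open>F\<close> is the open disc, so its bounding circle belongs to the
      wall.\<close>
    show "(R, 0) \<in> \<Gamma>"
      using rim_in_closure[OF assms(3)] F assms(3) F_iff[of R] by (simp add: \<Gamma>_def rigid_wall_def assms(4))
    show "\<exists>\<delta>>0. \<forall>q\<in>ball (r, 0) \<delta>. snd q < 0 \<longrightarrow> q \<in> D" if r: "0 < r" "r < R" for r
    proof -
      have "r\<^sup>2 < R\<^sup>2" using r by (intro power_strict_mono) auto
      then obtain \<delta> where \<delta>: "\<delta> > 0" "\<And>q. q \<in> ball (r, 0, 0) \<delta> \<Longrightarrow> fst (snd q) < 0 \<Longrightarrow> q \<in> W"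
        using free_surface_below[OF W neg F[unfolded assms(4)], of "(r, 0, 0)"] by auto
      have "q \<in> D" if q: "q \<in> ball (r, 0) (min \<delta> r)" "snd q < 0" for q
      proof -
        have "\<bar>r - fst q\<bar> \<le> dist (r, 0) q" using dist_fst_le[of "(r, 0)" q] by (simp add: dist_real_def)
        then have "0 < fst q" using q(1) by auto
        moreover have "dist (r, 0, 0) (fst q, snd q, 0::real) = dist (r, 0) q"
          by (simp add: dist_prod_def)
        then have "(fst q, snd q, 0) \<in> W" using q by (intro \<delta>(2)) auto
        ultimately show ?thesis by (auto simp: D_def meridian_domain_def)
      qed
      then show ?thesis using \<delta>(1) r by (intro exI[of _ "min \<delta> r"]) auto
    qed
    show "\<exists>N h G C. gradient_Lipschitz_at p N h G C \<and>
      (\<forall>q\<in>N \<inter> \<Gamma>. h q = 0 \<and> G q \<noteq> 0 \<and>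
        (q \<noteq> (R, 0) \<longrightarrow> (\<exists>\<sigma>\<in>{-1, 1}. \<exists>\<delta>>0. \<forall>x\<in>ball q \<delta>. x \<in> D \<longleftrightarrow> \<sigma> * h x < 0)))" if "p \<in> \<Gamma>" for p
      using meridian_chart[OF W assms(2) assms(5)[unfolded assms(4)] assms(3)] that
      unfolding \<Gamma>_def D_def assms(4) by blast
    show "has_interior_angle D (R, 0) \<alpha>" unfolding D_def by (rule assms)
    show "pi / 2 < \<alpha>" "\<alpha> < pi" by (rule assms)+
  qed
  show ?thesis
    using interior_high_spot unfolding D_def .
qed

end
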